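(* Let $\bar H$ be the quotient of $H=H(\mathrm{GL}_2(\mathbb{Q}_2)//K_0(4))$ by the two-sided ideal generated by $\mathcal{Z}-1$. Then $\bar H$ is generated by (the images of) $\mathcal{U}_1,\mathcal{U}_2,\mathcal{V}$ with defining relations: (1) $\mathcal{U}_1^2=2(1+\mathcal{V})$; (2) $\mathcal{U}_2^2=1$; (3) $\mathcal{U}_1\mathcal{V}=\mathcal{V}\mathcal{U}_1=\mathcal{U}_1$; (4) $\mathcal{U}_2\mathcal{V}\mathcal{U}_2=\mathcal{V}\mathcal{U}_2\mathcal{V}$.
   Context: Let $K_0(4)=\{\begin{pmatrix}a&b\\c&d\end{pmatrix}\in\mathrm{GL}_2(\mathbb{Z}_2):c\in4\mathbb{Z}_2\}$. $H(\mathrm{GL}_2(\mathbb{Q}_2)//K_0(4))$ is the algebra of compactly supported bi-$K_0(4)$-invariant functions on $\mathrm{GL}_2(\mathbb{Q}_2)$ under convolution with respect to the Haar measure giving $K_0(4)$ volume $1$. For $g$ let $X_g$ be the characteristic function of $K_0(4)gK_0(4)$. Put $w(t)=\begin{pmatrix}0&-1\\t&0\end{pmatrix}$, $y(2)=\begin{pmatrix}1&0\\2&1\end{pmatrix}$, $z(2)=2I$, and $\mathcal{U}_n=X_{w(2^n)}$, $\mathcal{V}=X_{y(2)}$, $\mathcal{Z}=X_{z(2)}$ (a central invertible element). *)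

theory Defs
  imports
    "HOL-Analysis.Analysis"
    "HOL-Computational_Algebra.Fraction_Field"
    "HOL-Library.Poly_Mapping"
    "HOL-Algebra.QuotRing"
    "HOL-Algebra.Algebraic_Closure_Type"
begin

section \<open>The 2-adic integers and the 2-adic numbers\<close>

text \<open>
  The ring of 2-adic integers is the inverse limit of the rings of integers modulo \<open>2 ^ n\<close>;
  the residue at level \<open>n\<close> is represented by its least nonnegative representative.
\<close>

typedef z2 = "{x :: nat \<Rightarrow> int. \<forall>n. x n mod 2 ^ n = x n \<and> x (Suc n) mod 2 ^ n = x n}"
  by (rule exI[of _ "\<lambda>_. 0"]) simp

setup_lifting type_definition_z2

lemma mod_pow2_Suc: "(a :: int) mod 2 ^ Suc n mod 2 ^ n = a mod 2 ^ n"
  by (rule mod_mod_cancel) (simp add: le_imp_power_dvd)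

instantiation z2 :: comm_ring_1
begin

lift_definition zero_z2 :: z2 is "\<lambda>_. 0" by simp

lift_definition one_z2 :: z2 is "\<lambda>n. 1 mod 2 ^ n"
  by (simp only: mod_pow2_Suc mod_mod_trivial simp_thms)

lift_definition plus_z2 :: "z2 \<Rightarrow> z2 \<Rightarrow> z2" is "\<lambda>x y n. (x n + y n) mod 2 ^ n"
  by (simp only: mod_pow2_Suc mod_mod_trivial simp_thms) (metis mod_add_eq)

lift_definition minus_z2 :: "z2 \<Rightarrow> z2 \<Rightarrow> z2" is "\<lambda>x y n. (x n - y n) mod 2 ^ n"
  by (simp only: mod_pow2_Suc mod_mod_trivial simp_thms) (metis mod_diff_eq)

lift_definition uminus_z2 :: "z2 \<Rightarrow> z2" is "\<lambda>x n. (- x n) mod 2 ^ n"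
  by (simp only: mod_pow2_Suc mod_mod_trivial simp_thms) (metis mod_minus_eq)

lift_definition times_z2 :: "z2 \<Rightarrow> z2 \<Rightarrow> z2" is "\<lambda>x y n. (x n * y n) mod 2 ^ n"
  by (simp only: mod_pow2_Suc mod_mod_trivial simp_thms) (metis mod_mult_eq)

instance
proof
  fix a b c :: z2
  show "a * b * c = a * (b * c)"
    by transfer (auto simp: mod_simps mult.assoc)
  show "a * b = b * a"
    by transfer (auto simp: mult.commute)
  show "1 * a = a"
    by transfer (simp only: mod_mult_left_eq mult_1_left fun_eq_iff simp_thms)
  show "a + b + c = a + (b + c)"
    by transfer (auto simp: mod_simps add.assoc)
  show "a + b = b + a"
    by transfer (auto simp: add.commute)
  show "0 + a = a"
    by transfer auto
  show "- a + a = 0"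
    by transfer (auto simp: mod_simps)
  show "a - b = a + - b"
    by transfer (auto simp: mod_simps)
  show "(a + b) * c = a * c + b * c"
    by transfer (auto simp: mod_simps distrib_right)
  show "(0 :: z2) \<noteq> 1"
    by transfer (auto simp: fun_eq_iff intro!: exI[of _ 1])
qed

end

lemma z2_compat:
  assumes "\<forall>n. x n mod 2 ^ n = x n \<and> x (Suc n) mod 2 ^ n = (x n :: int)"
  shows "x (n + k) mod 2 ^ n = x n"
proof (induction k)
  case (Suc k)
  have "x (n + Suc k) mod 2 ^ n = x (Suc (n + k)) mod 2 ^ (n + k) mod 2 ^ n"
    by (simp add: mod_mod_cancel le_imp_power_dvd)
  then show ?case using assms Suc.IH by simp
qed (use assms in simp)

lemma pow2_mult_dvd:
  assumes "(2 :: int) ^ (k + l) dvd a * b"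
  shows "2 ^ k dvd a \<or> 2 ^ l dvd b"
proof (rule ccontr)
  assume *: "\<not> ?thesis"
  then have nz: "a \<noteq> 0" "b \<noteq> 0" by auto
  have "multiplicity 2 a < k" "multiplicity 2 b < l"
    using * multiplicity_dvd'[of k 2 a] multiplicity_dvd'[of l 2 b] by (auto simp: not_le[symmetric])
  moreover have "multiplicity 2 (a * b) = multiplicity 2 a + multiplicity 2 b"
    using nz by (intro prime_elem_multiplicity_mult_distrib) auto
  moreover have "k + l \<le> multiplicity 2 (a * b)"
    using assms nz by (intro multiplicity_geI) auto
  ultimately show False by linarith
qed

instance z2 :: idom
proof
  fix a b :: z2
  assume "a \<noteq> 0" "b \<noteq> 0"
  then show "a * b \<noteq> 0"
  proof (transfer, safe)
    fix a b :: "nat \<Rightarrow> int"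
    assume a: "\<forall>n. a n mod 2 ^ n = a n \<and> a (Suc n) mod 2 ^ n = a n"
      and b: "\<forall>n. b n mod 2 ^ n = b n \<and> b (Suc n) mod 2 ^ n = b n"
      and nz: "a \<noteq> (\<lambda>_. 0)" "b \<noteq> (\<lambda>_. 0)"
      and eq: "(\<lambda>n. a n * b n mod 2 ^ n) = (\<lambda>_. 0)"
    obtain k l where kl: "a k \<noteq> 0" "b l \<noteq> 0" using nz by (auto simp: fun_eq_iff)
    have "(2 :: int) ^ (k + l) dvd a (k + l) * b (k + l)"
      using fun_cong[OF eq, of "k + l"] by (simp add: dvd_eq_mod_eq_0)
    then have "2 ^ k dvd a (k + l) \<or> 2 ^ l dvd b (k + l)" by (rule pow2_mult_dvd)
    moreover have "a (k + l) mod 2 ^ k = a k" using z2_compat[OF a] .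
    moreover have "b (k + l) mod 2 ^ l = b l" using z2_compat[OF b, of l k] by (simp add: add.commute)
    ultimately show False using kl by auto
  qed
qed

text \<open>
  The fraction field of a domain \<open>R\<close> carries the topology in which the sets \<open>x + r R\<close>
  with \<open>r \<noteq> 0\<close> in \<open>R\<close> form a neighbourhood basis of \<open>x\<close>. As every nonzero 2-adic integer
  is a unit times a power of 2, for \<^typ>\<open>z2\<close> these are the balls \<open>x + 2 ^ n R\<close>, and the
  topology is the one given by the 2-adic absolute value.
\<close>

instantiation fract :: (idom) topological_space
begin

definition open_fract :: "'a fract set \<Rightarrow> bool" where
  "open_fract S \<longleftrightarrow> (\<forall>x\<in>S. \<exists>r. r \<noteq> 0 \<and> (\<forall>a. x + Fract (r * a) 1 \<in> S))"

instance
proof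
  show "open (UNIV :: 'a fract set)"
    by (auto simp: open_fract_def intro!: exI[of _ 1])
next
  fix S T :: "'a fract set"
  assume S: "open S" and T: "open T"
  show "open (S \<inter> T)"
    unfolding open_fract_def
  proof
    fix x assume "x \<in> S \<inter> T"
    then obtain r s where rs: "r \<noteq> 0" "s \<noteq> 0"
      "\<And>a. x + Fract (r * a) 1 \<in> S" "\<And>a. x + Fract (s * a) 1 \<in> T"
      using S T unfolding open_fract_def by blast
    have "x + Fract (r * s * a) 1 \<in> S \<inter> T" for a
      using rs(3)[of "s * a"] rs(4)[of "r * a"] by (simp add: mult.left_commute mult.assoc)
    then show "\<exists>t. t \<noteq> 0 \<and> (\<forall>a. x + Fract (t * a) 1 \<in> S \<inter> T)"
      using rs(1,2) by (intro exI[of _ "r * s"]) auto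
  qed
next
  fix K :: "'a fract set set"
  assume "\<forall>S\<in>K. open S"
  then show "open (\<Union>K)" unfolding open_fract_def by (meson Union_iff)
qed

end

type_synonym q2 = "z2 fract"

section \<open>The group and its Haar measure\<close>

type_synonym q2mat = "q2 ^ 2 ^ 2"

definition GL2 :: "q2mat set" where
  "GL2 = {A. invertible A}"

definition K0 :: "z2 \<Rightarrow> q2mat set" where
  "K0 N = {map_matrix (\<lambda>a. Fract a 1) A | A :: z2 ^ 2 ^ 2. invertible A \<and> N dvd A $ 2 $ 1}"

text \<open>
  The topology of the general linear group is the subspace topology of the space of matrices,
  since inversion is continuous for it. The group is locally compact and second countable, so a Borel
  measure that is finite on compact sets is automatically regular.
\<close>

definition haar_measure :: "q2mat measure \<Rightarrow> bool" where
  "haar_measure \<mu> \<longleftrightarrow>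
     space \<mu> = GL2 \<and> sets \<mu> = sets (restrict_space borel GL2) \<and>
     (\<forall>g\<in>GL2. \<forall>A\<in>sets \<mu>. emeasure \<mu> ((\<lambda>x. g ** x) ` A) = emeasure \<mu> A) \<and>
     (\<forall>C. compact C \<and> C \<subseteq> GL2 \<longrightarrow> emeasure \<mu> C < \<infinity>) \<and>
     emeasure \<mu> GL2 \<noteq> 0"

section \<open>The Hecke algebra\<close>

text \<open>Functions on the group are extended by 0 to all matrices.\<close>

definition hecke_carrier :: "q2mat set \<Rightarrow> (q2mat \<Rightarrow> complex) set" where
  "hecke_carrier K = {f.
     (\<forall>x. x \<notin> GL2 \<longrightarrow> f x = 0) \<and>
     (\<exists>C. compact C \<and> C \<subseteq> GL2 \<and> (\<forall>x. f x \<noteq> 0 \<longrightarrow> x \<in> C)) \<and>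
     (\<forall>k\<in>K. \<forall>l\<in>K. \<forall>x\<in>GL2. f (k ** x ** l) = f x)}"

definition convolution ::
  "q2mat measure \<Rightarrow> (q2mat \<Rightarrow> complex) \<Rightarrow> (q2mat \<Rightarrow> complex) \<Rightarrow> q2mat \<Rightarrow> complex" where
  "convolution \<mu> f g x =
     (if x \<in> GL2 then (\<integral>y. f y * g (matrix_inv y ** x) \<partial>\<mu>) else 0)"

definition double_coset :: "q2mat set \<Rightarrow> q2mat \<Rightarrow> q2mat set" where
  "double_coset K g = {k ** g ** l | k l. k \<in> K \<and> l \<in> K}"

definition char_fun :: "q2mat set \<Rightarrow> q2mat \<Rightarrow> q2mat \<Rightarrow> complex" where
  "char_fun K g = indicator (double_coset K g)"

definition hecke_algebra :: "q2mat measure \<Rightarrow> q2mat set \<Rightarrow> (q2mat \<Rightarrow> complex) ring" where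
  "hecke_algebra \<mu> K =
     \<lparr>carrier = hecke_carrier K, mult = convolution \<mu>, one = char_fun K (mat 1),
      zero = (\<lambda>x. 0), add = (\<lambda>f g x. f x + g x)\<rparr>"

definition w_mat :: "q2 \<Rightarrow> q2mat" where "w_mat t = vector [vector [0, -1], vector [t, 0]]"
definition y_mat :: "q2 \<Rightarrow> q2mat" where "y_mat t = vector [vector [1, 0], vector [t, 1]]"
definition z_mat :: "q2 \<Rightarrow> q2mat" where "z_mat t = vector [vector [t, 0], vector [0, t]]"

definition hecke_U :: "nat \<Rightarrow> q2mat \<Rightarrow> complex" where "hecke_U n = char_fun (K0 4) (w_mat (2 ^ n))"
definition hecke_V :: "q2mat \<Rightarrow> complex" where "hecke_V = char_fun (K0 4) (y_mat 2)"
definition hecke_Z :: "q2mat \<Rightarrow> complex" where "hecke_Z = char_fun (K0 4) (z_mat 2)"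

definition H_alg :: "q2mat measure \<Rightarrow> (q2mat \<Rightarrow> complex) ring" where
  "H_alg \<mu> = hecke_algebra \<mu> (K0 4)"

definition Z_ideal :: "q2mat measure \<Rightarrow> (q2mat \<Rightarrow> complex) set" where
  "Z_ideal \<mu> = Idl\<^bsub>H_alg \<mu>\<^esub> {hecke_Z \<ominus>\<^bsub>H_alg \<mu>\<^esub> \<one>\<^bsub>H_alg \<mu>\<^esub>}"

definition H_bar :: "q2mat measure \<Rightarrow> (q2mat \<Rightarrow> complex) set ring" where
  "H_bar \<mu> = H_alg \<mu> Quot Z_ideal \<mu>"

text \<open>The scalar \<open>c\<close> of the complex algebra, as a multiple of the identity.\<close>

definition H_scalar :: "q2mat measure \<Rightarrow> complex \<Rightarrow> q2mat \<Rightarrow> complex" where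
  "H_scalar \<mu> c = (\<lambda>x. c * \<one>\<^bsub>H_alg \<mu>\<^esub> x)"

section \<open>The presented algebra\<close>

text \<open>
  Words form the free monoid, written additively because \<^typ>\<open>'a \<Rightarrow>\<^sub>0 'b\<close> is the monoid
  algebra of an additive monoid \<^typ>\<open>'a\<close>.
\<close>

datatype 'a word = Word (letters: "'a list")

instantiation word :: (type) monoid_add
begin

definition zero_word :: "'a word" where "0 = Word []"
definition plus_word :: "'a word \<Rightarrow> 'a word \<Rightarrow> 'a word" where
  "u + v = Word (letters u @ letters v)"

instance
  by standard (simp_all add: zero_word_def plus_word_def)

end

type_synonym 'a free_algebra = "'a word \<Rightarrow>\<^sub>0 complex"

definition free_var :: "'a \<Rightarrow> 'a free_algebra" where
  "free_var a = Poly_Mapping.single (Word [a]) 1"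

definition free_scalar :: "complex \<Rightarrow> 'a free_algebra" where
  "free_scalar c = Poly_Mapping.single 0 c"

datatype gen = GU1 | GU2 | GV

definition free_alg :: "gen free_algebra ring" where
  "free_alg = ring_of_type_algebra"

definition relators :: "gen free_algebra set" where
  "relators = (let u1 = free_var GU1; u2 = free_var GU2; v = free_var GV in
     {u1 ^ 2 - 2 * (1 + v),
      u2 ^ 2 - 1,
      u1 * v - v * u1, v * u1 - u1,
      u2 * v * u2 - v * u2 * v})"

definition rel_ideal :: "gen free_algebra set" where
  "rel_ideal = Idl\<^bsub>free_alg\<^esub> relators"

end

theory Submission
  imports Defs "HOL-Number_Theory.Cong"
begin

text \<open>
  Conjugation by \<open>diag(2, 1)\<close> turns \<open>K0 4\<close> into the principal congruence subgroup of level 2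
  in the maximal compact subgroup. By elementary divisors, a double coset modulo powers of 2 is
  therefore a pair of a nonzero matrix over the field with two elements (a primitive integral
  representative modulo 2) and the valuation of a determinant. The relations reduce every word to
  one of the words \<open>s u1 (u2 u1) ^ k t\<close> or to one of six words in \<open>u2, v\<close>, and such a word
  evaluates to a positive multiple of the characteristic function of a single double coset; distinct
  words give distinct pairs and all pairs occur. Dividing by \<open>Z - 1\<close> identifies precisely the
  translates under powers of 2.
\<close>

section \<open>Arithmetic of the 2-adic integers\<close>

text \<open>The maximal compact subgroup modulo its level 2 subgroup is \<open>GL_2\<close> over the
  field with two elements, a copy of the symmetric group on three letters. Up to a scalar,
  \<open>w2\<close> and \<open>y2\<close> give two involutions generating it, which is the source of
  relation (4). The six words in \<open>u2, v\<close> are its elements; for each \<open>k\<close>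
  the other words give the nine matrices of rank one, three choices of \<open>s\<close> times three
  of \<open>t\<close>, and 6 + 9 = 15 counts the nonzero matrices. Since \<open>w2\<close> and
  \<open>y2\<close> normalize \<open>K0 4\<close>, convolution with them is translation, and the
  genuine convolutions involve \<open>u1\<close>. For these it mostly suffices that a product is a
  positive multiple of one characteristic function, because the multiplicity can be divided out; the
  2 in relation (1) is the one that has to be computed. The obstacle is the quotient: independence
  of characteristic functions does not by itself survive division by \<open>Z - 1\<close>. Compact
  support saves it. Along an orbit of the powers of 2, an element of the ideal is the difference of
  a finitely supported sequence and its shift, and such a difference cannot be nonzero at exactly
  one point.\<close>

lemma Rep_z2_mod: "Rep_z2 a (n + k) mod 2 ^ n = Rep_z2 a n"
  using z2_compat[of "Rep_z2 a"] Rep_z2[of a] by blast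

lemma Rep_z2_mod_self [simp]: "Rep_z2 a n mod 2 ^ n = Rep_z2 a n"
  using Rep_z2_mod[of a n 0] by simp

lemma Rep_z2_Suc_mod: "Rep_z2 a (Suc n) mod 2 ^ n = Rep_z2 a n"
  using Rep_z2_mod[of a n 1] by simp

lemma Rep_z2_of_nat: "Rep_z2 (of_nat k) n = int k mod 2 ^ n"
  by (induction k) (auto simp: zero_z2.rep_eq plus_z2.rep_eq one_z2.rep_eq mod_simps)

lemma Rep_z2_numeral: "Rep_z2 (numeral k) n = numeral k mod 2 ^ n"
  using Rep_z2_of_nat[of "numeral k" n] by simp

lemma Rep_z2_pow2: "Rep_z2 (2 ^ k) n = 2 ^ k mod 2 ^ n"
  using Rep_z2_of_nat[of "2 ^ k" n] by simp

lemma Rep_z2_nonneg: "0 \<le> Rep_z2 a n"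
  by (metis Rep_z2_mod_self pos_mod_sign zero_less_numeral zero_less_power)

lemma Rep_z2_less: "Rep_z2 a n < 2 ^ n"
  by (metis Rep_z2_mod_self pos_mod_bound zero_less_numeral zero_less_power)

lemma pow2_dvd_z2_iff: "2 ^ n dvd a \<longleftrightarrow> Rep_z2 a n = 0"
proof
  assume "2 ^ n dvd a"
  then obtain b where "a = 2 ^ n * b" by auto
  then show "Rep_z2 a n = 0" by (simp add: times_z2.rep_eq Rep_z2_pow2)
next
  assume a: "Rep_z2 a n = 0"
  \<comment> \<open>Division by \<open>2 ^ n\<close> costs \<open>n\<close> binary digits, so level
    \<open>m\<close> of the quotient is read off level \<open>n + m\<close> of
    \<open>a\<close>.\<close>
  define b where "b m = Rep_z2 a (n + m) div 2 ^ n" for m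
  have ab: "Rep_z2 a (n + m) = 2 ^ n * b m" for m
    using Rep_z2_mod[of a n m] a by (auto simp: b_def)
  have compat: "\<forall>m. b m mod 2 ^ m = b m \<and> b (Suc m) mod 2 ^ m = b m"
  proof safe
    fix m
    have "2 ^ n * (b m mod 2 ^ m) = 2 ^ n * b m"
      using Rep_z2_mod_self[of a "n + m"] by (simp only: ab power_add mult_mod_right)
    then show "b m mod 2 ^ m = b m" by simp
    have "2 ^ n * (b (Suc m) mod 2 ^ m) = 2 ^ n * b m"
      using Rep_z2_Suc_mod[of a "n + m"]
      by (simp only: ab power_add mult_mod_right add_Suc_right[symmetric])
    then show "b (Suc m) mod 2 ^ m = b m" by simp
  qed
  have "a = 2 ^ n * Abs_z2 b"
  proof (rule Rep_z2_inject[THEN iffD1], rule ext)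
    fix m
    have "Rep_z2 a m = Rep_z2 a (n + m) mod 2 ^ m"
      using Rep_z2_mod[of a m n] by (simp add: add.commute)
    also have "\<dots> = 2 ^ n * b m mod 2 ^ m" by (simp add: ab)
    also have "\<dots> = Rep_z2 (2 ^ n * Abs_z2 b) m"
      using compat by (simp add: times_z2.rep_eq Rep_z2_pow2 Abs_z2_inverse mod_simps)
    finally show "Rep_z2 a m = Rep_z2 (2 ^ n * Abs_z2 b) m" .
  qed
  then show "2 ^ n dvd a" by simp
qed

text \<open>Reduction to the field with two elements, as a truth value: sums become exclusive
  disjunctions and products become conjunctions, so parity goals turn into propositional
  ones.\<close>

definition odd2 :: "z2 \<Rightarrow> bool" where "odd2 a \<longleftrightarrow> Rep_z2 a 1 = 1"

lemma Rep_z2_1_cases: "Rep_z2 a 1 = 0 \<or> Rep_z2 a 1 = 1"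
  using Rep_z2_less[of a 1] Rep_z2_nonneg[of a 1] by auto

lemma odd2_altdef: "odd2 a \<longleftrightarrow> odd (Rep_z2 a 1)"
  using Rep_z2_1_cases[of a] unfolding odd2_def by auto

lemma odd2_simps [simp]:
  "odd2 (a + b) \<longleftrightarrow> odd2 a \<noteq> odd2 b" "odd2 (a - b) \<longleftrightarrow> odd2 a \<noteq> odd2 b"
  "odd2 (a * b) \<longleftrightarrow> odd2 a \<and> odd2 b" "odd2 (- a) \<longleftrightarrow> odd2 a"
  "\<not> odd2 0" "odd2 1"
proof -
  show "odd2 (a + b) \<longleftrightarrow> odd2 a \<noteq> odd2 b" "odd2 (a - b) \<longleftrightarrow> odd2 a \<noteq> odd2 b"
    "odd2 (a * b) \<longleftrightarrow> odd2 a \<and> odd2 b"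
    using Rep_z2_1_cases[of a] Rep_z2_1_cases[of b]
    by (elim disjE; simp add: odd2_def plus_z2.rep_eq minus_z2.rep_eq times_z2.rep_eq)+
  show "odd2 (- a) \<longleftrightarrow> odd2 a"
    using Rep_z2_1_cases[of a] by (elim disjE) (simp_all add: odd2_def uminus_z2.rep_eq)
  show "\<not> odd2 0" "odd2 1" by (simp_all add: odd2_def zero_z2.rep_eq one_z2.rep_eq)
qed

lemma odd2_numeral [simp]: "\<not> odd2 (numeral (num.Bit0 k))" "odd2 (numeral (num.Bit1 k))"
  unfolding numeral_Bit0 numeral_Bit1 odd2_simps by simp_all

lemma odd2_power [simp]: "odd2 (a ^ n) \<longleftrightarrow> odd2 a \<or> n = 0"
  by (induction n) auto

lemma not_odd2_iff: "\<not> odd2 a \<longleftrightarrow> (\<exists>b. a = 2 * b)"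
  using pow2_dvd_z2_iff[of 1 a] Rep_z2_less[of a 1] Rep_z2_nonneg[of a 1]
  unfolding odd2_def dvd_def by auto

lemma odd2E:
  assumes "odd2 a" obtains b where "a = 1 + 2 * b"
  using assms not_odd2_iff[of "a - 1"] by (auto simp: algebra_simps)

lemma evenE2:
  assumes "\<not> odd2 a" obtains b where "a = 2 * b"
  using assms not_odd2_iff by auto

text \<open>An inverse modulo \<open>2 ^ n\<close> is chosen at every level separately. Inverses
  modulo \<open>2 ^ n\<close> are unique, so the choices are compatible and define a 2-adic
  integer.\<close>

lemma odd2_imp_unit:
  assumes "odd2 a" shows "\<exists>b. a * b = 1"
proof -
  have odd: "odd (Rep_z2 a (Suc n))" for n
    using assms Rep_z2_mod[of a 1 n] unfolding odd2_altdef by (simp add: odd_iff_mod_2_eq_one)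
  have cop: "coprime (Rep_z2 a n) (2 ^ n)" for n
    using odd[of "n - 1"] by (cases n) auto
  have "\<exists>y. y mod 2 ^ n = y \<and> Rep_z2 a n * y mod 2 ^ n = 1 mod 2 ^ n" for n
  proof -
    obtain y where "[Rep_z2 a n * y = 1] (mod 2 ^ n)"
      using cop[of n] cong_solve_coprime_int by blast
    then show ?thesis by (intro exI[of _ "y mod 2 ^ n"]) (simp add: cong_def mod_simps)
  qed
  then have "\<exists>b. \<forall>n. b n mod 2 ^ n = b n \<and> Rep_z2 a n * b n mod 2 ^ n = 1 mod 2 ^ n"
    by (intro choice allI)
  then obtain b where b: "\<And>n. b n mod 2 ^ n = b n" "\<And>n. Rep_z2 a n * b n mod 2 ^ n = 1 mod 2 ^ n"
    by blast
  have "b (Suc n) mod 2 ^ n = b n" for n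
  proof -
    have "Rep_z2 a (Suc n) * b (Suc n) mod 2 ^ n = 1 mod 2 ^ n"
      using arg_cong[OF b(2)[of "Suc n"], of "\<lambda>x. x mod 2 ^ n"] by (simp only: mod_pow2_Suc)
    then have "[Rep_z2 a n * b (Suc n) = Rep_z2 a n * b n] (mod 2 ^ n)"
      unfolding cong_def b(2) by (metis Rep_z2_Suc_mod mod_mult_left_eq)
    then have "[b (Suc n) = b n] (mod 2 ^ n)"
      using cop cong_mult_lcancel by blast
    then show ?thesis using b(1) by (simp add: cong_def)
  qed
  then have "a * Abs_z2 b = 1"
    using b by (intro Rep_z2_inject[THEN iffD1]) (auto simp: times_z2.rep_eq one_z2.rep_eq Abs_z2_inverse)
  then show ?thesis by blast
qed

lemma odd2_iff_unit: "odd2 a \<longleftrightarrow> (\<exists>b. a * b = 1)"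
  using odd2_imp_unit odd2_simps by metis

text \<open>Without such a factorization the quotient of \<open>a\<close> by any power of 2 would
  again be even, and all residues of \<open>a\<close> would vanish.\<close>

lemma z2_pow2_unit:
  assumes "a \<noteq> 0" obtains n u where "odd2 u" "a = 2 ^ n * u"
proof -
  obtain m where m: "Rep_z2 a m \<noteq> 0"
    using assms by (metis Rep_z2_inject zero_z2.rep_eq ext)
  have "\<exists>n u. odd2 u \<and> a = 2 ^ n * u"
  proof (rule ccontr)
    assume *: "\<not> ?thesis"
    have "2 ^ k dvd a" for k
    proof (induction k)
      case (Suc k)
      then obtain u where u: "a = 2 ^ k * u" by auto
      with * obtain v where "u = 2 * v" using not_odd2_iff by blast
      with u show ?case by simp
    qed auto
    then show False using m pow2_dvd_z2_iff by blast
  qed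
  then show thesis using that by blast
qed

lemma two_neq_0_z2 [simp]: "(2 :: z2) \<noteq> 0"
proof
  assume "(2 :: z2) = 0"
  then have "Rep_z2 2 2 = Rep_z2 0 2" by simp
  then show False by (simp add: Rep_z2_numeral zero_z2.rep_eq)
qed

section \<open>The embedding of the 2-adic integers into the 2-adic numbers\<close>

definition emb :: "z2 \<Rightarrow> q2" where "emb a = Fract a 1"

lemma emb_simps:
  "emb (a + b) = emb a + emb b" "emb (a - b) = emb a - emb b" "emb (a * b) = emb a * emb b"
  "emb (- a) = - emb a" "emb 0 = 0" "emb 1 = 1"
  by (simp_all add: emb_def Zero_fract_def One_fract_def)

lemma emb_numeral: "emb (numeral k) = numeral k"
  by (metis emb_def of_nat_fract of_nat_numeral)

lemma emb_power: "emb (a ^ n) = emb a ^ n"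
  by (induction n) (simp_all add: emb_simps)

lemma emb_eq_iff [simp]: "emb a = emb b \<longleftrightarrow> a = b"
  by (simp add: emb_def eq_fract)

lemma two_neq_0_q2 [simp]: "(2 :: q2) \<noteq> 0"
  using emb_eq_iff[of 2 0] by (simp only: emb_numeral emb_simps) simp

lemma q2_pow2_unit:
  assumes "(x :: q2) \<noteq> 0" obtains n u where "odd2 u" "x = 2 powi n * emb u"
proof -
  obtain a b where x: "x = Fract a b" "b \<noteq> 0" by (cases x)
  with assms have "a \<noteq> 0" by (auto simp: Zero_fract_def eq_fract)
  obtain n u where u: "odd2 u" "a = 2 ^ n * u" using z2_pow2_unit \<open>a \<noteq> 0\<close> .
  obtain m v where v: "odd2 v" "b = 2 ^ m * v" using z2_pow2_unit \<open>b \<noteq> 0\<close> .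
  obtain v' where v': "v * v' = 1" using odd2_imp_unit v(1) by blast
  have "odd2 (u * v')" using u v' odd2_simps by metis
  moreover have "x = 2 powi (int n - int m) * emb (u * v')"
  proof -
    have vv: "emb v * emb v' = 1" using arg_cong[OF v', of emb] by (simp only: emb_simps)
    then have nz: "emb v \<noteq> 0" by (metis mult_zero_left zero_neq_one)
    have "x = (2 ^ n * emb u) / (2 ^ m * emb v)"
      using x by (simp add: u v emb_simps(3)[symmetric] emb_power[symmetric] emb_numeral[symmetric]) (simp add: emb_def)
    also have "\<dots> = 2 ^ n / 2 ^ m * (emb u * emb v')"
      using inverse_unique[OF vv] nz by (simp add: divide_inverse ac_simps)
    also have "\<dots> = 2 powi (int n - int m) * emb (u * v')"
      by (simp only: emb_simps power_int_diff[OF disjI1[OF two_neq_0_q2]] power_int_of_nat)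
    finally show ?thesis .
  qed
  ultimately show thesis using that by blast
qed

section \<open>Topology and the group \<open>K0 4\<close>\<close>

lemma open_fract_ball:
  assumes "r \<noteq> 0" shows "open (range (\<lambda>a. x + Fract (r * a) 1))"
  unfolding open_fract_def
proof safe
  fix a
  have "x + Fract (r * a) 1 + Fract (r * b) 1 = x + Fract (r * (a + b)) 1" for b
    by (simp add: distrib_left add.assoc)
  then show "\<exists>s. s \<noteq> 0 \<and> (\<forall>b. x + Fract (r * a) 1 + Fract (s * b) 1 \<in> range (\<lambda>a. x + Fract (r * a) 1))"
    using assms by (intro exI[of _ r]) auto
qed

lemma Fract_mult_add: "Fract (r * (a + b)) 1 = Fract (r * a) 1 + (Fract (r * b) 1 :: 'a :: idom fract)"
  by (simp add: distrib_left)

lemma eventually_nhds_fract: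
  assumes "r \<noteq> 0" shows "eventually (\<lambda>y. \<exists>a. y = x + Fract (r * a) 1) (nhds x)"
  unfolding eventually_nhds
proof (rule exI[of _ "range (\<lambda>a. x + Fract (r * a) 1)"], intro conjI ballI)
  show "open (range (\<lambda>a. x + Fract (r * a) 1))" using assms by (rule open_fract_ball)
  show "x \<in> range (\<lambda>a. x + Fract (r * a) 1)"
    by (rule image_eqI[of _ _ 0]) (simp_all flip: Zero_fract_def)
qed auto

instance fract :: (idom) topological_monoid_add
proof
  fix a b :: "'a fract"
  show "LIM x nhds a \<times>\<^sub>F nhds b. fst x + snd x :> nhds (a + b)"
  proof (rule topological_tendstoI)
    fix S :: "'a fract set" assume "open S" "a + b \<in> S"
    then obtain r where r: "r \<noteq> 0" "\<And>c. a + b + Fract (r * c) 1 \<in> S"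
      unfolding open_fract_def by blast
    have "eventually (\<lambda>x. (\<exists>c. fst x = a + Fract (r * c) 1) \<and> (\<exists>c. snd x = b + Fract (r * c) 1))
      (nhds a \<times>\<^sub>F nhds b)"
      by (intro eventually_prodI eventually_nhds_fract r)
    then show "\<forall>\<^sub>F x in nhds a \<times>\<^sub>F nhds b. fst x + snd x \<in> S"
    proof (rule eventually_mono, clarsimp)
      fix c d
      have "a + Fract (r * c) 1 + (b + Fract (r * d) 1) = a + b + Fract (r * (c + d)) 1"
        unfolding Fract_mult_add by (simp only: ac_simps)
      then show "a + Fract (r * c) 1 + (b + Fract (r * d) 1) \<in> S" using r by metis
    qed
  qed
qed

instance fract :: (idom) topological_comm_monoid_add ..

instance fract :: (idom) topological_semigroup_mult
proof
  fix a b :: "'a fract"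
  show "LIM x nhds a \<times>\<^sub>F nhds b. fst x * snd x :> nhds (a * b)"
  proof (rule topological_tendstoI)
    fix S :: "'a fract set" assume "open S" "a * b \<in> S"
    then obtain r where r: "r \<noteq> 0" "\<And>c. a * b + Fract (r * c) 1 \<in> S"
      unfolding open_fract_def by blast
    obtain p q where a: "a = Fract p q" "q \<noteq> 0" by (cases a)
    obtain p' q' where b: "b = Fract p' q'" "q' \<noteq> 0" by (cases b)
    \<comment> \<open>The radii compensate the denominators: changing \<open>a\<close> by a multiple
      of \<open>r * q'\<close> changes its product with \<open>b\<close>, whose denominator is
      \<open>q'\<close>, by a multiple of \<open>r\<close>, and symmetrically.\<close>
    have "eventually (\<lambda>x. (\<exists>c. fst x = a + Fract (r * q' * c) 1) \<and> (\<exists>c. snd x = b + Fract (r * q * c) 1))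
      (nhds a \<times>\<^sub>F nhds b)"
      using r a b by (intro eventually_prodI eventually_nhds_fract) simp_all
    then show "\<forall>\<^sub>F x in nhds a \<times>\<^sub>F nhds b. fst x * snd x \<in> S"
    proof (rule eventually_mono, clarsimp)
      fix c d
      have "a * Fract (r * q * d) 1 = Fract (r * (p * d)) 1" "Fract (r * q' * c) 1 * b = Fract (r * (p' * c)) 1"
        using a b by (simp_all add: eq_fract)
      then have "(a + Fract (r * q' * c) 1) * (b + Fract (r * q * d) 1)
        = a * b + Fract (r * (p * d)) 1 + Fract (r * (p' * c)) 1 + Fract (r * (q' * c * r * q * d)) 1"
        unfolding distrib_left distrib_right by (simp add: ac_simps del: add_fract)
      also have "\<dots> = a * b + Fract (r * (p * d + p' * c + q' * c * r * q * d)) 1"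
        unfolding Fract_mult_add by (simp only: add.assoc)
      finally show "(a + Fract (r * q' * c) 1) * (b + Fract (r * q * d) 1) \<in> S" using r by metis
    qed
  qed
qed

lemma open_emb_image:
  assumes "\<And>a b. a \<in> A \<Longrightarrow> a + r * b \<in> A" "r \<noteq> 0"
  shows "open (emb ` A)"
  unfolding open_fract_def
proof safe
  fix a assume "a \<in> A"
  then show "\<exists>s. s \<noteq> 0 \<and> (\<forall>b. emb a + Fract (s * b) 1 \<in> emb ` A)"
    using assms by (intro exI[of _ r]) (auto simp flip: emb_def emb_simps)
qed

(* Koenig's lemma on the binary tree of residues. *)
lemma compact_range_emb: "compact (range emb)"
proof (rule compactI)
  fix \<C> assume op: "\<forall>S\<in>\<C>. open S" and cover: "range emb \<subseteq> \<Union>\<C>"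
  define good where "good n c \<longleftrightarrow> (\<exists>\<F>\<subseteq>\<C>. finite \<F> \<and> (\<forall>b. emb (c + 2 ^ n * b) \<in> \<Union>\<F>))" for n :: nat and c
  have step: "good n c" if "good (Suc n) c" "good (Suc n) (c + 2 ^ n)" for n c
  proof -
    from that obtain \<F> \<G> where FG: "\<F> \<subseteq> \<C>" "\<G> \<subseteq> \<C>" "finite \<F>" "finite \<G>"
      "\<And>b. emb (c + 2 ^ Suc n * b) \<in> \<Union>\<F>" "\<And>b. emb (c + 2 ^ n + 2 ^ Suc n * b) \<in> \<Union>\<G>"
      unfolding good_def by (elim exE conjE) metis
    have "emb (c + 2 ^ n * b) \<in> \<Union>(\<F> \<union> \<G>)" for b
    proof (cases "odd2 b")
      case True
      then obtain d where "b = 1 + 2 * d" by (rule odd2E)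
      with FG(6)[of d] show ?thesis by (auto simp: algebra_simps)
    next
      case False
      then obtain d where "b = 2 * d" by (rule evenE2)
      with FG(5)[of d] show ?thesis by (auto simp: algebra_simps)
    qed
    with FG show ?thesis unfolding good_def
      by (intro exI[of _ "\<F> \<union> \<G>"] conjI allI) simp_all
  qed
  show "\<exists>\<F>\<subseteq>\<C>. finite \<F> \<and> range emb \<subseteq> \<Union>\<F>"
  proof (rule ccontr)
    assume "\<not> ?thesis"
    then have bad0: "\<not> good 0 0" unfolding good_def by (simp add: image_subset_iff)
    \<comment> \<open>A branch of the tree that stays bad: the half of the current ball centred at
      \<open>c n\<close> is kept when it is bad, and otherwise \<open>step\<close> forces the other
      half, centred at \<open>c n + 2 ^ n\<close>, to be bad.\<close>
    define c where "c = rec_nat (0 :: z2) (\<lambda>n x. if good (Suc n) x then x + 2 ^ n else x)"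
    have c0: "c 0 = 0" and cS: "c (Suc n) = (if good (Suc n) (c n) then c n + 2 ^ n else c n)" for n
      by (simp_all add: c_def)
    have bad: "\<not> good n (c n)" for n
      using bad0 step by (induction n) (auto simp: c0 cS)
    have Rc: "Rep_z2 (c (Suc n)) n = Rep_z2 (c n) n" for n
      by (auto simp: cS plus_z2.rep_eq Rep_z2_pow2)
    have compat: "\<forall>n. Rep_z2 (c n) n mod 2 ^ n = Rep_z2 (c n) n
        \<and> Rep_z2 (c (Suc n)) (Suc n) mod 2 ^ n = Rep_z2 (c n) n"
      by (simp add: Rep_z2_Suc_mod Rc)
    then have Rl: "Rep_z2 (Abs_z2 (\<lambda>n. Rep_z2 (c n) n)) n = Rep_z2 (c n) n" for n
      by (subst Abs_z2_inverse) simp_all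
    \<comment> \<open>From stage \<open>n\<close> on, the centre changes by multiples of
      \<open>2 ^ n\<close> only, so the diagonal residues are compatible and \<open>l\<close> is the
      limit of the centres.\<close>
    define l where "l = Abs_z2 (\<lambda>n. Rep_z2 (c n) n)"
    obtain S where S: "S \<in> \<C>" "emb l \<in> S" using cover by blast
    then obtain r where r: "r \<noteq> 0" "\<And>b. emb l + Fract (r * b) 1 \<in> S"
      using op unfolding open_fract_def by blast
    obtain n u where u: "odd2 u" "r = 2 ^ n * u" using z2_pow2_unit r(1) .
    obtain v where v: "u * v = 1" using odd2_imp_unit u(1) by blast
    have "2 ^ n dvd c n - l"
      unfolding pow2_dvd_z2_iff minus_z2.rep_eq l_def Rl by simp
    then obtain d where d: "c n = l + 2 ^ n * d" by (auto simp: algebra_simps elim: dvdE)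
    have "emb (c n + 2 ^ n * b) \<in> S" for b
    proof -
      have "c n + 2 ^ n * b = l + 2 ^ n * (u * v) * (d + b)" unfolding d v by (simp add: algebra_simps)
      also have "\<dots> = l + r * (v * (d + b))" by (simp add: u ac_simps)
      finally show ?thesis using r(2)[of "v * (d + b)"] by (simp add: emb_simps flip: emb_def)
    qed
    then have "good n (c n)" unfolding good_def using S by (intro exI[of _ "{S}"]) auto
    then show False using bad by simp
  qed
qed

section \<open>2 by 2 matrices in coordinates\<close>

abbreviation entry :: "'a ^ 2 ^ 2 \<Rightarrow> 2 \<Rightarrow> 2 \<Rightarrow> 'a" where
  "entry A i j \<equiv> vec_nth (vec_nth A i) j"

definition mat2 :: "'a \<Rightarrow> 'a \<Rightarrow> 'a \<Rightarrow> 'a \<Rightarrow> 'a :: zero ^ 2 ^ 2" where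
  "mat2 a b c d = vector [vector [a, b], vector [c, d]]"

lemma mat2_nth [simp]:
  "entry (mat2 a b c d) 1 1 = a" "entry (mat2 a b c d) 1 2 = b"
  "entry (mat2 a b c d) 2 1 = c" "entry (mat2 a b c d) 2 2 = d"
  by (simp_all add: mat2_def)

lemma mat2_eqI:
  "entry A 1 1 = entry B 1 1 \<Longrightarrow> entry A 1 2 = entry B 1 2 \<Longrightarrow> entry A 2 1 = entry B 2 1 \<Longrightarrow> entry A 2 2 = entry B 2 2
    \<Longrightarrow> A = (B :: 'a ^ 2 ^ 2)"
  unfolding vec_eq_iff forall_2 by blast

lemma mat2_cases: obtains a b c d where "A = mat2 a b c d"
  by (rule that[of "entry A 1 1" "entry A 1 2" "entry A 2 1" "entry A 2 2"]) (rule mat2_eqI, simp_all)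

lemma mat2_eq_iff [simp]:
  "mat2 a b c d = mat2 a' b' c' d' \<longleftrightarrow> a = a' \<and> b = b' \<and> c = c' \<and> d = d'"
  by (metis mat2_nth)

lemma mat2_mult [simp]:
  "mat2 a b c d ** mat2 a' b' c' d'
    = mat2 (a * a' + b * c') (a * b' + b * d') (c * a' + d * c') (c * b' + d * d')"
  by (rule mat2_eqI) (simp_all add: matrix_matrix_mult_def sum_2)

lemma mat_1_eq_mat2: "mat 1 = mat2 1 0 0 1"
  by (rule mat2_eqI) (simp_all add: mat_def)

lemma det_mat2 [simp]: "det (mat2 a b c d) = a * d - b * c"
  by (simp add: det_2)

lemma GL2_iff: "g \<in> GL2 \<longleftrightarrow> det g \<noteq> 0"
  by (simp add: GL2_def invertible_det_nz)

lemma GL2_mult [simp, intro]: "g \<in> GL2 \<Longrightarrow> h \<in> GL2 \<Longrightarrow> g ** h \<in> GL2"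
  by (simp add: GL2_iff det_mul)

lemma GL2_one [simp, intro]: "mat 1 \<in> GL2"
  by (simp add: GL2_iff)

lemma GL2_inv [simp]:
  assumes "g \<in> GL2"
  shows "matrix_inv g ** g = mat 1" "g ** matrix_inv g = mat 1" "matrix_inv g \<in> GL2"
    "matrix_inv g ** (g ** h) = h" "g ** (matrix_inv g ** h) = h"
    "h ** g ** matrix_inv g = h" "h ** matrix_inv g ** g = h"
proof -
  show 1: "matrix_inv g ** g = mat 1" "g ** matrix_inv g = mat 1"
    using assms unfolding GL2_def invertible_def matrix_inv_def
    by (metis (mono_tags, lifting) mem_Collect_eq someI_ex)+
  then show "matrix_inv g \<in> GL2" using GL2_def invertible_def by blast
  show "matrix_inv g ** (g ** h) = h" "g ** (matrix_inv g ** h) = h"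
    using 1 by (simp_all add: matrix_mul_assoc)
  show "h ** g ** matrix_inv g = h" "h ** matrix_inv g ** g = h"
    using 1 by (simp_all flip: matrix_mul_assoc)
qed

lemma matrix_inv_eqI:
  assumes "g ** h = mat 1" "g \<in> GL2" shows "matrix_inv g = (h :: q2mat)"
  using arg_cong[OF assms(1), of "(**) (matrix_inv g)"] assms(2) by simp

lemma matrix_inv_mult:
  "g \<in> GL2 \<Longrightarrow> h \<in> GL2 \<Longrightarrow> matrix_inv (g ** h) = matrix_inv h ** matrix_inv g"
  by (rule matrix_inv_eqI) (simp_all add: matrix_mul_assoc)

lemma matrix_inv_inv [simp]: "g \<in> GL2 \<Longrightarrow> matrix_inv (matrix_inv g) = g"
  by (rule matrix_inv_eqI) simp_all

lemma matrix_inv_one [simp]: "matrix_inv (mat 1 :: q2mat) = mat 1"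
  by (rule matrix_inv_eqI) simp_all

lemma emb_unit: "odd2 u \<Longrightarrow> \<exists>v. odd2 v \<and> emb u * emb v = 1"
  using odd2_imp_unit[of u] odd2_iff_unit[of u] by (metis emb_simps(3,6) mult.commute odd2_iff_unit)

lemma emb_odd2_nonzero [simp]: "odd2 u \<Longrightarrow> emb u \<noteq> 0"
  using emb_eq_iff[of u 0] by (auto simp: emb_simps)

lemma invertible_z2_iff: "invertible (A :: z2 ^ 2 ^ 2) \<longleftrightarrow> odd2 (det A)"
proof
  assume "invertible A"
  then obtain B where "A ** B = mat 1" unfolding invertible_def by blast
  then have "det A * det B = 1" by (metis det_I det_mul)
  then show "odd2 (det A)" using odd2_iff_unit by blast
next
  assume "odd2 (det A)"
  then obtain v where v: "det A * v = 1" using odd2_imp_unit by blast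
  obtain a b c d where A: "A = mat2 a b c d" by (rule mat2_cases)
  have "A ** mat2 (v * d) (- v * b) (- v * c) (v * a) = mat 1"
    "mat2 (v * d) (- v * b) (- v * c) (v * a) ** A = mat 1"
    using v unfolding A mat_1_eq_mat2 by (simp_all add: algebra_simps)
  then show "invertible A" unfolding invertible_def by blast
qed

section \<open>The group \<open>K0 4\<close>: explicit form, compactness, openness\<close>

abbreviation K :: "q2mat set" where "K \<equiv> K0 4"

text \<open>As the lower left entry is even, the determinant is a unit exactly when both diagonal
  entries are odd. Two parity conditions thus replace the invertibility over the 2-adic
  integers.\<close>

lemma K_eq: "K = {mat2 (emb a) (emb b) (4 * emb c) (emb d) | a b c d. odd2 a \<and> odd2 d}"
proof (intro equalityI subsetI)
  fix x assume "x \<in> K"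
  then obtain A :: "z2 ^ 2 ^ 2" where A: "x = map_matrix emb A" "odd2 (det A)" "4 dvd entry A 2 1"
    unfolding K0_def invertible_z2_iff emb_def[abs_def] by blast
  obtain a b c d where abcd: "A = mat2 a b c d" by (rule mat2_cases)
  with A obtain e where e: "c = 4 * e" by auto
  have "x = mat2 (emb a) (emb b) (4 * emb e) (emb d)"
    unfolding A abcd by (rule mat2_eqI) (simp_all add: map_matrix_def e emb_simps emb_numeral)
  then show "x \<in> {mat2 (emb a) (emb b) (4 * emb c) (emb d) | a b c d. odd2 a \<and> odd2 d}"
    using A(2) by (auto simp: abcd e)
next
  fix x assume "x \<in> {mat2 (emb a) (emb b) (4 * emb c) (emb d) | a b c d. odd2 a \<and> odd2 d}"
  then obtain a b c d where x: "x = mat2 (emb a) (emb b) (4 * emb c) (emb d)" "odd2 a" "odd2 d" by auto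
  have "x = map_matrix emb (mat2 a b (4 * c) d)"
    unfolding x by (rule mat2_eqI) (simp_all add: map_matrix_def emb_simps emb_numeral)
  moreover have "odd2 (det (mat2 a b (4 * c) d))" using x by simp
  ultimately show "x \<in> K"
    unfolding K0_def invertible_z2_iff emb_def[abs_def] by (auto intro!: exI[of _ "mat2 a b (4 * c) d"])
qed

lemma K_cases:
  assumes "k \<in> K"
  obtains a b c d where "k = mat2 (emb a) (emb b) (4 * emb c) (emb d)" "odd2 a" "odd2 d"
  using assms unfolding K_eq by blast

lemma K_I: "odd2 a \<Longrightarrow> odd2 d \<Longrightarrow> p = emb a \<Longrightarrow> q = emb b \<Longrightarrow> r = 4 * emb c \<Longrightarrow> s = emb d
    \<Longrightarrow> mat2 p q r s \<in> K"
  unfolding K_eq by blast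

lemma K_det:
  assumes "k \<in> K" obtains u where "odd2 u" "det k = emb u"
  using assms
proof (rule K_cases)
  fix a b c d assume "k = mat2 (emb a) (emb b) (4 * emb c) (emb d)" "odd2 a" "odd2 d"
  then show thesis
    by (intro that[of "a * d - b * (4 * c)"]) (simp_all add: emb_simps emb_numeral)
qed

lemma K_subset_GL2: "k \<in> K \<Longrightarrow> k \<in> GL2"
  by (erule K_det) (simp add: GL2_iff)

lemma K_one [simp]: "mat 1 \<in> K"
  unfolding mat_1_eq_mat2 by (rule K_I[of 1 1 _ _ 0 _ 0]) (simp_all add: emb_simps)

lemma K_mult [simp]: assumes "k \<in> K" "l \<in> K" shows "k ** l \<in> K"
  using assms(1)
proof (rule K_cases)
  fix a b c d assume k: "k = mat2 (emb a) (emb b) (4 * emb c) (emb d)" "odd2 a" "odd2 d"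
  from assms(2) show ?thesis
  proof (rule K_cases)
    fix a' b' c' d' assume l: "l = mat2 (emb a') (emb b') (4 * emb c') (emb d')" "odd2 a'" "odd2 d'"
    show ?thesis unfolding k l mat2_mult using k l
      by (intro K_I[of "a * a' + b * (4 * c')" "4 * c * b' + d * d'" _ _ "a * b' + b * d'" _ "c * a' + d * c'"])
        (simp_all add: emb_simps emb_numeral algebra_simps)
  qed
qed

lemma K_inv [simp]: assumes "k \<in> K" shows "matrix_inv k \<in> K"
  using assms
proof (rule K_cases)
  fix a b c d assume k: "k = mat2 (emb a) (emb b) (4 * emb c) (emb d)" "odd2 a" "odd2 d"
  have "odd2 (a * d - b * (4 * c))" using k by simp
  then obtain v where v: "odd2 v" "emb (a * d - b * (4 * c)) * emb v = 1" using emb_unit by blast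
  have "matrix_inv k = mat2 (emb (v * d)) (emb (- v * b)) (4 * emb (- v * c)) (emb (v * a))"
  proof (rule matrix_inv_eqI)
    show "k ** mat2 (emb (v * d)) (emb (- v * b)) (4 * emb (- v * c)) (emb (v * a)) = mat 1"
      unfolding k mat2_mult mat_1_eq_mat2 using v(2)
      by (simp add: emb_simps emb_numeral algebra_simps)
  qed (use assms K_subset_GL2 in blast)
  then show ?thesis using K_I k v by simp
qed

lemma continuous_on_matrix_mult_left: "continuous_on S ((**) (A :: q2mat))"
  unfolding matrix_matrix_mult_def by (intro continuous_intros)

lemma continuous_on_matrix_mult_right: "continuous_on S (\<lambda>x. x ** (A :: q2mat))"
  unfolding matrix_matrix_mult_def by (intro continuous_intros)

lemma compact_K: "compact K"
proof -
  \<comment> \<open>Writing the odd diagonal entries as 1 plus twice an integer removes the parity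
    condition and makes \<open>K\<close> a continuous image of four copies of the compact
    ring.\<close>
  define f :: "q2 \<times> q2 \<times> q2 \<times> q2 \<Rightarrow> q2mat" where
    "f = (\<lambda>p. \<chi> i j. if i = 1 then if j = 1 then 1 + 2 * fst p else fst (snd p)
       else if j = 1 then 4 * fst (snd (snd p)) else 1 + 2 * snd (snd (snd p)))"
  have cont: "continuous_on S f" for S
    unfolding f_def
  proof (intro continuous_on_vec_lambda)
    fix i j :: 2
    show "continuous_on S (\<lambda>x. if i = 1 then if j = 1 then 1 + 2 * fst x else fst (snd x)
       else if j = 1 then 4 * fst (snd (snd x)) else 1 + 2 * snd (snd (snd x)) :: q2)"
      by (cases "i = 1"; cases "j = 1"; simp; intro continuous_intros)
  qed
  have f: "f (emb a, emb b, emb c, emb d) = mat2 (emb (1 + 2 * a)) (emb b) (4 * emb c) (emb (1 + 2 * d))"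
    for a b c d
    by (rule mat2_eqI) (simp_all add: f_def emb_simps emb_numeral)
  have "K = f ` (range emb \<times> range emb \<times> range emb \<times> range emb)"
  proof (intro equalityI subsetI)
    fix x assume "x \<in> K"
    then obtain a b c d where x: "x = mat2 (emb a) (emb b) (4 * emb c) (emb d)" "odd2 a" "odd2 d"
      by (rule K_cases)
    obtain a' d' where "a = 1 + 2 * a'" "d = 1 + 2 * d'" using x(2,3) by (elim odd2E)
    then have "x = f (emb a', emb b, emb c, emb d')" unfolding f x by simp
    then show "x \<in> f ` (range emb \<times> range emb \<times> range emb \<times> range emb)" by blast
  next
    fix x assume "x \<in> f ` (range emb \<times> range emb \<times> range emb \<times> range emb)"
    then obtain a b c d where "x = f (emb a, emb b, emb c, emb d)" by blast
    then show "x \<in> K" unfolding f by (auto intro!: K_I)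
  qed
  moreover have "compact (f ` (range emb \<times> range emb \<times> range emb \<times> range emb))"
    by (intro compact_continuous_image cont compact_Times compact_range_emb)
  ultimately show ?thesis by simp
qed

lemma open_K: "open K"
proof -
  have 1: "open (emb ` {a. odd2 a})" by (rule open_emb_image[of _ 2]) auto
  have 2: "open (range emb)" by (rule open_emb_image[of _ 1]) auto
  have 3: "open (emb ` range ((*) 4))"
  proof (rule open_emb_image[of _ 4], safe)
    fix a b :: z2 show "4 * a + 4 * b \<in> range ((*) 4)" by (metis distrib_left rangeI)
    assume "(4 :: z2) = 0"
    moreover have "(4 :: z2) = 2 * 2" by simp
    ultimately show False by (metis mult_eq_0_iff two_neq_0_z2)
  qed
  have "K = ((\<lambda>x. vec_nth x 1) -` (\<lambda>x. vec_nth x 1) -` (emb ` {a. odd2 a}))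
    \<inter> ((\<lambda>x. vec_nth x 1) -` (\<lambda>x. vec_nth x 2) -` range emb)
    \<inter> ((\<lambda>x. vec_nth x 2) -` (\<lambda>x. vec_nth x 1) -` (emb ` range ((*) 4)))
    \<inter> ((\<lambda>x. vec_nth x 2) -` (\<lambda>x. vec_nth x 2) -` (emb ` {a. odd2 a}))" (is "_ = ?R")
  proof (intro equalityI subsetI)
    fix x assume "x \<in> K" then show "x \<in> ?R"
      by (rule K_cases) (auto simp: image_iff emb_simps emb_numeral)
  next
    fix x assume x: "x \<in> ?R"
    obtain p q r s where pqrs: "x = mat2 p q r s" by (rule mat2_cases)
    show "x \<in> K"
    proof -
      from x obtain a b c d where "odd2 a" "odd2 d" "p = emb a" "q = emb b" "r = emb (4 * c)" "s = emb d"
        unfolding pqrs by auto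
      then show ?thesis unfolding pqrs by (intro K_I[of a d p q b r c s]) (simp_all add: emb_simps emb_numeral)
    qed
  qed
  then show ?thesis by (simp only:) (intro open_Int open_vimage_vec_nth 1 2 3)
qed

section \<open>The Hecke algebra as a ring\<close>

definition coset :: "q2mat \<Rightarrow> q2mat set" where "coset g = (**) g ` K"

lemma coset_iff: "g \<in> GL2 \<Longrightarrow> x \<in> coset g \<longleftrightarrow> matrix_inv g ** x \<in> K"
  unfolding coset_def by (metis GL2_inv(4,5) image_iff)

lemma coset_GL2: "g \<in> GL2 \<Longrightarrow> x \<in> coset g \<Longrightarrow> x \<in> GL2"
  unfolding coset_def using K_subset_GL2 by blast

lemma coset_self [simp]: "g \<in> coset g"
  unfolding coset_def using K_one by (metis image_eqI matrix_mul_rid)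

lemma coset_eq:
  assumes "g \<in> GL2" "x \<in> coset g" shows "coset x = coset g"
proof -
  obtain k where k: "k \<in> K" "x = g ** k" using assms(2) unfolding coset_def by blast
  have "y \<in> coset x \<longleftrightarrow> y \<in> coset g" for y
  proof -
    have "matrix_inv k ** (matrix_inv g ** y) \<in> K \<longleftrightarrow> matrix_inv g ** y \<in> K"
      using k K_mult K_inv by (metis GL2_inv(5) K_subset_GL2)
    then show ?thesis
      using k assms(1) K_subset_GL2 by (simp add: coset_iff matrix_inv_mult matrix_mul_assoc)
  qed
  then show ?thesis by blast
qed

lemma coset_mult_iff:
  "g \<in> GL2 \<Longrightarrow> h \<in> GL2 \<Longrightarrow> g ** x \<in> coset (g ** h) \<longleftrightarrow> x \<in> coset h"
  unfolding coset_def by (force simp flip: matrix_mul_assoc dest: arg_cong[of _ _ "(**) (matrix_inv g)"])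

lemma compact_coset: "compact (coset g)"
  unfolding coset_def by (intro compact_continuous_image continuous_on_matrix_mult_left compact_K)

lemma open_coset:
  assumes "g \<in> GL2" shows "open (coset g)"
proof -
  have "coset g = (**) (matrix_inv g) -` K"
    using coset_iff[OF assms] by auto
  then show ?thesis
    using open_vimage[OF open_K continuous_on_matrix_mult_left] by simp
qed

text \<open>Cosets are open, so a compact support meets the situation of a finite cover. From here
  on compactness is replaced by finitely many cosets, and integrals become finite sums.\<close>

lemma compact_coset_cover:
  assumes "compact C" "C \<subseteq> GL2"
  obtains S where "finite S" "S \<subseteq> GL2" "C \<subseteq> \<Union>(coset ` S)"
proof -
  have "\<exists>S\<subseteq>C. finite S \<and> C \<subseteq> (\<Union>g\<in>S. coset g)"
  proof (rule compactE_image[OF assms(1), of C coset])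
    show "\<And>g. g \<in> C \<Longrightarrow> open (coset g)" using assms(2) open_coset by blast
    show "C \<subseteq> \<Union> (coset ` C)" by auto
  qed blast
  then show thesis using that assms(2) by (metis order_trans)
qed

text \<open>The element is chosen from the set \<open>coset g\<close> and so depends on the coset
  alone: equal cosets get equal representatives.\<close>

definition coset_rep :: "q2mat \<Rightarrow> q2mat" where "coset_rep g = (SOME x. x \<in> coset g)"

lemma coset_rep: "coset_rep g \<in> coset g"
  unfolding coset_rep_def using coset_self by (rule someI)

definition right_inv :: "(q2mat \<Rightarrow> complex) \<Rightarrow> bool" where
  "right_inv f \<longleftrightarrow> (\<forall>x. x \<notin> GL2 \<longrightarrow> f x = 0) \<and> (\<forall>x\<in>GL2. \<forall>k\<in>K. f (x ** k) = f x)"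

text \<open>Points where \<open>f\<close> vanishes are allowed among the representatives. One
  transversal of \<open>f\<close> then also serves every function of smaller support, such as the
  integrand of a convolution.\<close>

definition transversal :: "(q2mat \<Rightarrow> complex) \<Rightarrow> q2mat set \<Rightarrow> bool" where
  "transversal f S \<longleftrightarrow> finite S \<and> S \<subseteq> GL2 \<and> (\<forall>s\<in>S. \<forall>t\<in>S. t \<in> coset s \<longrightarrow> s = t)
     \<and> (\<forall>x. f x \<noteq> 0 \<longrightarrow> (\<exists>s\<in>S. x \<in> coset s))"

lemma transversal_exists:
  assumes "finite S" "S \<subseteq> GL2" "\<And>x. f x \<noteq> 0 \<Longrightarrow> \<exists>s\<in>S. x \<in> coset s"
  shows "\<exists>T. transversal f T"
proof -
  have eq: "coset (coset_rep s) = coset s" if "s \<in> S" for s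
    using coset_eq coset_rep assms(2) that by blast
  have "transversal f (coset_rep ` S)"
    unfolding transversal_def
  proof (intro conjI ballI impI allI)
    show "finite (coset_rep ` S)" using assms(1) by simp
    show "coset_rep ` S \<subseteq> GL2" using assms(2) coset_GL2 coset_rep by blast
    fix s t assume "s \<in> coset_rep ` S" "t \<in> coset_rep ` S" "t \<in> coset s"
    then obtain s' t' where st: "s' \<in> S" "t' \<in> S" "s = coset_rep s'" "t = coset_rep t'" by blast
    have "s \<in> GL2" using st coset_GL2 coset_rep assms(2) by blast
    then have "coset t = coset s" using coset_eq \<open>t \<in> coset s\<close> by blast
    then have "coset t' = coset s'" using eq st by simp
    then show "s = t" unfolding st coset_rep_def by simp
  next
    fix x assume "f x \<noteq> 0"
    then show "\<exists>s\<in>coset_rep ` S. x \<in> coset s" using assms(3) eq by blast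
  qed
  then show ?thesis by blast
qed

lemma transversal_expand:
  assumes "right_inv f" "transversal f S"
  shows "f x = (\<Sum>s\<in>S. f s * indicator (coset s) x)"
proof (cases "\<exists>s\<in>S. x \<in> coset s")
  case True
  then obtain s where s: "s \<in> S" "x \<in> coset s" by blast
  have "s \<in> GL2" using s assms(2) unfolding transversal_def by blast
  have "x \<notin> coset t" if "t \<in> S" "t \<noteq> s" for t
  proof
    assume "x \<in> coset t"
    have "t \<in> GL2" using that assms(2) unfolding transversal_def by blast
    then have "coset t = coset s"
      using coset_eq[OF \<open>s \<in> GL2\<close> s(2)] coset_eq[OF _ \<open>x \<in> coset t\<close>] by simp
    then have "t \<in> coset s" using coset_self by blast
    then show False using assms(2) that s(1) unfolding transversal_def by blast
  qed
  then have "(\<Sum>t\<in>S. f t * indicator (coset t) x) = (\<Sum>t\<in>{s}. f t * indicator (coset t) x)"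
    using s assms(2) by (intro sum.mono_neutral_right) (auto simp: transversal_def)
  also have "\<dots> = f s" using s by simp
  also have "\<dots> = f x"
    using s assms(1) \<open>s \<in> GL2\<close> unfolding right_inv_def coset_def by auto
  finally show ?thesis by simp
next
  case False
  then have "f x = 0" using assms(2) unfolding transversal_def by blast
  moreover have "(\<Sum>s\<in>S. f s * indicator (coset s) x) = 0"
    using False by (intro sum.neutral) auto
  ultimately show ?thesis by simp
qed

lemma hecke_carrierI:
  assumes "\<And>x. x \<notin> GL2 \<Longrightarrow> f x = 0" "finite S" "S \<subseteq> GL2" "\<And>x. f x \<noteq> 0 \<Longrightarrow> \<exists>s\<in>S. x \<in> coset s"
    "\<And>k x. k \<in> K \<Longrightarrow> x \<in> GL2 \<Longrightarrow> f (k ** x) = f x" "\<And>k x. k \<in> K \<Longrightarrow> x \<in> GL2 \<Longrightarrow> f (x ** k) = f x"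
  shows "f \<in> hecke_carrier K"
  unfolding hecke_carrier_def
proof (intro CollectI conjI allI impI ballI)
  show "f (k ** x ** l) = f x" if "k \<in> K" "l \<in> K" "x \<in> GL2" for k l x
    using assms(5,6) that K_subset_GL2 by simp
  show "\<exists>C. compact C \<and> C \<subseteq> GL2 \<and> (\<forall>x. f x \<noteq> 0 \<longrightarrow> x \<in> C)"
  proof (intro exI conjI allI impI)
    show "compact (\<Union>s\<in>S. coset s)" using assms(2) compact_coset by (intro compact_UN) auto
    show "(\<Union>s\<in>S. coset s) \<subseteq> GL2" using assms(3) coset_GL2 by blast
  qed (use assms(4) in blast)
qed (use assms(1) in blast)

lemma hecke_carrierD:
  assumes "f \<in> hecke_carrier K"
  shows "x \<notin> GL2 \<Longrightarrow> f x = 0" "k \<in> K \<Longrightarrow> x \<in> GL2 \<Longrightarrow> f (k ** x) = f x"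
    "k \<in> K \<Longrightarrow> x \<in> GL2 \<Longrightarrow> f (x ** k) = f x" "right_inv f" "\<exists>S. transversal f S"
proof -
  have biinv: "f (k ** x ** l) = f x" if "k \<in> K" "l \<in> K" "x \<in> GL2" for k l x
    using assms that unfolding hecke_carrier_def by blast
  show 1: "x \<notin> GL2 \<Longrightarrow> f x = 0" for x using assms unfolding hecke_carrier_def by blast
  show "k \<in> K \<Longrightarrow> x \<in> GL2 \<Longrightarrow> f (k ** x) = f x" using biinv[of k "mat 1" x] by simp
  show 2: "k \<in> K \<Longrightarrow> x \<in> GL2 \<Longrightarrow> f (x ** k) = f x" for k x using biinv[of "mat 1" k x] by simp
  show "right_inv f" unfolding right_inv_def using 1 2 by blast
  obtain C where C: "compact C" "C \<subseteq> GL2" "\<And>x. f x \<noteq> 0 \<Longrightarrow> x \<in> C"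
    using assms unfolding hecke_carrier_def by blast
  obtain S where "finite S" "S \<subseteq> GL2" "C \<subseteq> \<Union>(coset ` S)" using compact_coset_cover C(1,2) .
  then show "\<exists>S. transversal f S" by (intro transversal_exists) (blast dest: C(3))+
qed

lemma hecke_cover:
  assumes "f \<in> hecke_carrier K"
  shows "\<exists>S. finite S \<and> S \<subseteq> GL2 \<and> (\<forall>x. f x \<noteq> 0 \<longrightarrow> (\<exists>s\<in>S. x \<in> coset s))"
  using hecke_carrierD(5)[OF assms] unfolding transversal_def by blast

lemma hecke_zero [simp]: "(\<lambda>x. 0) \<in> hecke_carrier K"
  by (rule hecke_carrierI[of _ "{}"]) auto

lemma hecke_add [simp]:
  assumes "f \<in> hecke_carrier K" "g \<in> hecke_carrier K"
  shows "(\<lambda>x. f x + g x) \<in> hecke_carrier K"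
proof -
  obtain S where S: "finite S" "S \<subseteq> GL2" "\<And>x. f x \<noteq> 0 \<Longrightarrow> \<exists>s\<in>S. x \<in> coset s"
    using hecke_cover[OF assms(1)] by blast
  obtain T where T: "finite T" "T \<subseteq> GL2" "\<And>x. g x \<noteq> 0 \<Longrightarrow> \<exists>s\<in>T. x \<in> coset s"
    using hecke_cover[OF assms(2)] by blast
  show ?thesis
  proof (rule hecke_carrierI[of _ "S \<union> T"])
    show "\<exists>s\<in>S \<union> T. x \<in> coset s" if "f x + g x \<noteq> 0" for x
    proof -
      have "f x \<noteq> 0 \<or> g x \<noteq> 0" using that by auto
      then show ?thesis using S(3) T(3) by blast
    qed
  qed (use S T assms in \<open>auto simp: hecke_carrierD\<close>)
qed

lemma hecke_smult [simp]:
  assumes "f \<in> hecke_carrier K" shows "(\<lambda>x. c * f x) \<in> hecke_carrier K"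
proof -
  obtain S where S: "finite S" "S \<subseteq> GL2" "\<And>x. f x \<noteq> 0 \<Longrightarrow> \<exists>s\<in>S. x \<in> coset s"
    using hecke_cover[OF assms] by blast
  show ?thesis
    by (rule hecke_carrierI[of _ S]) (use S assms in \<open>auto simp: hecke_carrierD\<close>)
qed

lemma double_coset_iff:
  "x \<in> double_coset K g \<longleftrightarrow> (\<exists>k\<in>K. \<exists>l\<in>K. x = k ** g ** l)"
  unfolding double_coset_def by blast

lemma double_coset_mult:
  assumes "k \<in> K" "l \<in> K" shows "k ** x ** l \<in> double_coset K g \<longleftrightarrow> x \<in> double_coset K g"
proof
  assume "k ** x ** l \<in> double_coset K g"
  then obtain a b where ab: "a \<in> K" "b \<in> K" "k ** x ** l = a ** g ** b"
    unfolding double_coset_iff by blast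
  have "x = matrix_inv k ** (k ** x ** l) ** matrix_inv l"
    using assms K_subset_GL2 by (simp flip: matrix_mul_assoc)
  also have "\<dots> = (matrix_inv k ** a) ** g ** (b ** matrix_inv l)"
    unfolding ab by (simp add: matrix_mul_assoc)
  finally show "x \<in> double_coset K g"
    unfolding double_coset_iff using assms ab K_mult K_inv by blast
next
  assume "x \<in> double_coset K g"
  then obtain a b where ab: "a \<in> K" "b \<in> K" "x = a ** g ** b"
    unfolding double_coset_iff by blast
  then have "k ** x ** l = (k ** a) ** g ** (b ** l)" by (simp add: matrix_mul_assoc)
  then show "k ** x ** l \<in> double_coset K g"
    unfolding double_coset_iff using assms ab K_mult by blast
qed

lemma double_coset_self [simp]: "g \<in> double_coset K g"
  unfolding double_coset_iff by (metis K_one matrix_mul_lid matrix_mul_rid)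

lemma double_coset_eq: "h \<in> double_coset K g \<Longrightarrow> double_coset K h = double_coset K g"
proof -
  assume "h \<in> double_coset K g"
  then obtain a b where ab: "a \<in> K" "b \<in> K" "h = a ** g ** b"
    unfolding double_coset_iff by blast
  then have "g = matrix_inv a ** h ** matrix_inv b"
    using K_subset_GL2 by (simp add: matrix_mul_assoc)
  moreover have "x \<in> double_coset K h" if "x \<in> double_coset K g" "g \<in> double_coset K h" for x g h
  proof -
    from that(1) obtain k l where "k \<in> K" "l \<in> K" "x = k ** g ** l" unfolding double_coset_iff by blast
    then show ?thesis using double_coset_mult that(2) by blast
  qed
  ultimately show ?thesis
    using ab unfolding set_eq_iff by (metis K_inv double_coset_iff)
qed

lemma double_coset_GL2: "g \<in> GL2 \<Longrightarrow> x \<in> double_coset K g \<Longrightarrow> x \<in> GL2"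
  unfolding double_coset_iff using K_subset_GL2 by auto

lemma char_fun_hecke [simp]:
  assumes "g \<in> GL2" shows "char_fun K g \<in> hecke_carrier K"
proof -
  have "compact ((\<lambda>x. x ** g) ` K)"
    by (intro compact_continuous_image continuous_on_matrix_mult_right compact_K)
  moreover have "(\<lambda>x. x ** g) ` K \<subseteq> GL2" using assms K_subset_GL2 by auto
  ultimately obtain S where S: "finite S" "S \<subseteq> GL2" "(\<lambda>x. x ** g) ` K \<subseteq> \<Union>(coset ` S)"
    using compact_coset_cover by metis
  show ?thesis
  proof (rule hecke_carrierI[OF _ S(1,2)])
    fix x assume "char_fun K g x \<noteq> 0"
    then obtain k l where kl: "k \<in> K" "l \<in> K" "x = k ** g ** l"
      by (auto simp: char_fun_def indicator_def double_coset_iff)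
    obtain s where s: "s \<in> S" "k ** g \<in> coset s" using S(3) kl(1) by blast
    then have "x \<in> coset s"
      using kl coset_eq S(2) unfolding kl(3) by (metis coset_def image_eqI subsetD)
    then show "\<exists>s\<in>S. x \<in> coset s" using s by blast
  next
    fix x assume "x \<notin> GL2" then show "char_fun K g x = 0"
      using double_coset_GL2[OF assms] by (auto simp: char_fun_def indicator_def)
  next
    fix k x assume "k \<in> K"
    then show "char_fun K g (k ** x) = char_fun K g x" "char_fun K g (x ** k) = char_fun K g x"
      using double_coset_mult[of k "mat 1" x g] double_coset_mult[of "mat 1" k x g]
      by (simp_all add: char_fun_def indicator_def)
  qed
qed

section \<open>Elements that normalize \<open>K\<close>\<close>

definition normalizer :: "q2mat set" where
  "normalizer = {n \<in> GL2. \<forall>k\<in>K. matrix_inv n ** k ** n \<in> K \<and> n ** k ** matrix_inv n \<in> K}"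

lemma char_fun_normalizer:
  assumes "n \<in> normalizer"
  shows "char_fun K n = indicator (coset n)"
proof -
  have "double_coset K n = coset n"
  proof (intro equalityI subsetI)
    fix x assume "x \<in> double_coset K n"
    then obtain k l where kl: "k \<in> K" "l \<in> K" "x = k ** n ** l" unfolding double_coset_iff by blast
    have "x = n ** ((matrix_inv n ** k ** n) ** l)"
      using assms unfolding kl normalizer_def by (simp add: matrix_mul_assoc)
    then show "x \<in> coset n" unfolding coset_def using assms kl K_mult unfolding normalizer_def by blast
  next
    fix x assume "x \<in> coset n"
    then show "x \<in> double_coset K n"
      unfolding coset_def double_coset_iff by (metis K_one imageE matrix_mul_lid)
  qed
  then show ?thesis by (simp add: char_fun_def)
qed

section \<open>Integration over cosets and the convolution product\<close>

locale hecke =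
  fixes \<mu> :: "q2mat measure"
  assumes haar: "haar_measure \<mu>" and vol_K: "emeasure \<mu> K = 1"
begin

lemma emeasure_coset:
  assumes "g \<in> GL2" shows "coset g \<in> sets \<mu>" "emeasure \<mu> (coset g) = 1"
proof -
  have *: "coset h \<in> sets \<mu>" if "h \<in> GL2" for h
  proof -
    have "coset h \<in> sets borel" using open_coset[OF that] by simp
    moreover have "coset h \<subseteq> GL2" using coset_GL2[OF that] by blast
    ultimately have "coset h \<in> sets (restrict_space borel GL2)"
      unfolding sets_restrict_space by blast
    then show ?thesis using haar unfolding haar_measure_def by simp
  qed
  then show "coset g \<in> sets \<mu>" using assms .
  have "coset (mat 1) = K" unfolding coset_def by simp
  then have "K \<in> sets \<mu>" using *[of "mat 1"] by simp
  then show "emeasure \<mu> (coset g) = 1"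
    using haar vol_K assms unfolding haar_measure_def coset_def by metis
qed

text \<open>Every coset has volume 1, so the integral is the plain sum over representatives, without
  weights.\<close>

lemma integral_transversal:
  assumes "right_inv f" "transversal f S"
  shows "integrable \<mu> f" "(\<integral>y. f y \<partial>\<mu>) = (\<Sum>s\<in>S. f s)"
proof -
  have S: "S \<subseteq> GL2" using assms(2) unfolding transversal_def by blast
  have "has_bochner_integral \<mu> (\<lambda>x. \<Sum>s\<in>S. indicator (coset s) x *\<^sub>R f s) (\<Sum>s\<in>S. measure \<mu> (coset s) *\<^sub>R f s)"
    using S by (intro has_bochner_integral_sum has_bochner_integral_indicator) (auto simp: emeasure_coset)
  moreover have "(\<lambda>x. \<Sum>s\<in>S. indicator (coset s) x *\<^sub>R f s) = f"
  proof
    fix x show "(\<Sum>s\<in>S. indicator (coset s) x *\<^sub>R f s) = f x"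
      unfolding transversal_expand[OF assms, of x] by (intro sum.cong) (auto simp: indicator_def)
  qed
  moreover have "(\<Sum>s\<in>S. measure \<mu> (coset s) *\<^sub>R f s) = (\<Sum>s\<in>S. f s)"
    using S by (intro sum.cong) (auto simp: measure_def emeasure_coset)
  ultimately have "has_bochner_integral \<mu> f (\<Sum>s\<in>S. f s)" by simp
  then show "integrable \<mu> f" "(\<integral>y. f y \<partial>\<mu>) = (\<Sum>s\<in>S. f s)"
    using has_bochner_integral_integral_eq integrable.intros by auto
qed

text \<open>Left translation permutes the left cosets. The translated transversal fits the
  translated function and carries the same values, so invariance of the integral is a reindexing of
  a finite sum.\<close>

lemma integral_left_mult:
  assumes "right_inv f" "transversal f S" "g \<in> GL2"
  shows "integrable \<mu> (\<lambda>y. f (g ** y))" "(\<integral>y. f (g ** y) \<partial>\<mu>) = (\<integral>y. f y \<partial>\<mu>)"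
proof -
  let ?f = "\<lambda>y. f (g ** y)" and ?i = "(**) (matrix_inv g)"
  have mem: "g ** y \<in> GL2 \<longleftrightarrow> y \<in> GL2" for y
    using assms(3) by (auto simp: GL2_iff det_mul)
  have 1: "right_inv ?f"
    using assms(1,3) unfolding right_inv_def by (auto simp: mem matrix_mul_assoc)
  have S: "finite S" "S \<subseteq> GL2" using assms(2) unfolding transversal_def by auto
  have inj: "inj_on ?i S" by (rule inj_on_inverseI[of _ "(**) g"]) (simp add: assms(3))
  have 2: "transversal ?f (?i ` S)"
    unfolding transversal_def
  proof (intro conjI allI impI ballI)
    show "finite (?i ` S)" "?i ` S \<subseteq> GL2" using S assms(3) by auto
    fix s t assume "s \<in> ?i ` S" "t \<in> ?i ` S" "t \<in> coset s"
    then obtain s' t' where st: "s' \<in> S" "t' \<in> S" "s = ?i s'" "t = ?i t'" by blast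
    then have "t' \<in> coset s'"
      using \<open>t \<in> coset s\<close> S(2) assms(3) by (simp add: coset_mult_iff subset_iff)
    then show "s = t" using assms(2) st unfolding transversal_def by blast
  next
    fix x assume "f (g ** x) \<noteq> 0"
    then obtain s where s: "s \<in> S" "g ** x \<in> coset s"
      using assms(2) unfolding transversal_def by blast
    then have "?i (g ** x) \<in> coset (?i s)"
      using assms(3) S(2) by (subst coset_mult_iff) auto
    then have "x \<in> coset (?i s)" using assms(3) by simp
    then show "\<exists>s\<in>?i ` S. x \<in> coset s" using s by blast
  qed
  show "integrable \<mu> (\<lambda>y. f (g ** y))" by (rule integral_transversal(1)[OF 1 2])
  have "(\<integral>y. f (g ** y) \<partial>\<mu>) = (\<Sum>s\<in>?i ` S. ?f s)" by (rule integral_transversal(2)[OF 1 2])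
  also have "\<dots> = (\<Sum>s\<in>S. f s)" using inj assms(3) by (simp add: sum.reindex)
  also have "\<dots> = (\<integral>y. f y \<partial>\<mu>)" by (rule integral_transversal(2)[OF assms(1,2), symmetric])
  finally show "(\<integral>y. f (g ** y) \<partial>\<mu>) = (\<integral>y. f y \<partial>\<mu>)" .
qed

lemma integrand:
  assumes "f \<in> hecke_carrier K" "g \<in> hecke_carrier K" "x \<in> GL2"
  shows "right_inv (\<lambda>y. f y * g (matrix_inv y ** x))"
    "transversal f S \<Longrightarrow> transversal (\<lambda>y. f y * g (matrix_inv y ** x)) S"
proof -
  show "right_inv (\<lambda>y. f y * g (matrix_inv y ** x))"
    unfolding right_inv_def using hecke_carrierD[OF assms(1)] hecke_carrierD[OF assms(2)] assms(3) K_subset_GL2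
    by (auto simp: matrix_inv_mult simp flip: matrix_mul_assoc)
  show "transversal (\<lambda>y. f y * g (matrix_inv y ** x)) S" if "transversal f S"
    using that unfolding transversal_def by auto
qed

lemma integrable_convolution:
  assumes "f \<in> hecke_carrier K" "g \<in> hecke_carrier K" "x \<in> GL2"
  shows "integrable \<mu> (\<lambda>y. f y * g (matrix_inv y ** x))"
  using integral_transversal(1)[OF integrand[OF assms]] hecke_carrierD(5)[OF assms(1)] by blast

lemma convolution_eq_sum:
  assumes "f \<in> hecke_carrier K" "g \<in> hecke_carrier K" "x \<in> GL2" "transversal f S"
  shows "convolution \<mu> f g x = (\<Sum>s\<in>S. f s * g (matrix_inv s ** x))"
  unfolding convolution_def if_P[OF assms(3)]
  by (rule integral_transversal(2)[OF integrand(1)[OF assms(1-3)] integrand(2)[OF assms]])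

lemma convolution_hecke [simp]:
  assumes f: "f \<in> hecke_carrier K" and g: "g \<in> hecke_carrier K"
  shows "convolution \<mu> f g \<in> hecke_carrier K"
proof -
  obtain S where S: "transversal f S" using hecke_carrierD(5)[OF f] by blast
  then have S': "finite S" "S \<subseteq> GL2" unfolding transversal_def by auto
  obtain U where U: "finite U" "U \<subseteq> GL2" "\<And>x. g x \<noteq> 0 \<Longrightarrow> \<exists>s\<in>U. x \<in> coset s"
    using hecke_cover[OF g] by blast
  have eq: "convolution \<mu> f g x = (\<Sum>s\<in>S. f s * g (matrix_inv s ** x))" if "x \<in> GL2" for x
    using convolution_eq_sum f g that S .
  show ?thesis
  proof (rule hecke_carrierI[of _ "(\<lambda>(s, u). s ** u) ` (S \<times> U)"])
    show "(\<lambda>(s, u). s ** u) ` (S \<times> U) \<subseteq> GL2" using S'(2) U(2) by auto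
    fix x assume nz: "convolution \<mu> f g x \<noteq> 0"
    then have x: "x \<in> GL2" unfolding convolution_def by (auto split: if_splits)
    obtain s where s: "s \<in> S" "f s * g (matrix_inv s ** x) \<noteq> 0"
      using nz unfolding eq[OF x] by (rule sum.not_neutral_contains_not_neutral)
    then have "g (matrix_inv s ** x) \<noteq> 0" by auto
    then obtain u where u: "u \<in> U" "matrix_inv s ** x \<in> coset u" using U(3) by blast
    have "s ** (matrix_inv s ** x) \<in> coset (s ** u)"
      using u s(1) S'(2) U(2) coset_mult_iff[of s u "matrix_inv s ** x"] by blast
    moreover have "s ** (matrix_inv s ** x) = x" using s(1) S'(2) by auto
    ultimately have "x \<in> coset (s ** u)" by simp
    then show "\<exists>s\<in>(\<lambda>(s, u). s ** u) ` (S \<times> U). x \<in> coset s"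
      using s u by (intro bexI[of _ "s ** u"]) auto
  next
    fix k x assume kx: "k \<in> K" "x \<in> GL2"
    have k: "k \<in> GL2" using kx K_subset_GL2 by blast
    show "convolution \<mu> f g (x ** k) = convolution \<mu> f g x"
    proof -
      have "g (matrix_inv s ** (x ** k)) = g (matrix_inv s ** x)" if "s \<in> S" for s
      proof -
        have "matrix_inv s ** x \<in> GL2" using that S'(2) kx by auto
        then show ?thesis using hecke_carrierD(3)[OF g kx(1)] by (simp add: matrix_mul_assoc)
      qed
      then show ?thesis using kx k by (simp add: eq)
    qed
    \<comment> \<open>Left invariance: substitute \<open>k ** y\<close> for \<open>y\<close>. The
      two factors \<open>k\<close> in the argument of \<open>g\<close> cancel, and the one in the
      argument of \<open>f\<close> is absorbed by left invariance of \<open>f\<close>.\<close>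
    have "(\<integral>y. f y * g (matrix_inv y ** (k ** x)) \<partial>\<mu>)
      = (\<integral>y. f (k ** y) * g (matrix_inv (k ** y) ** (k ** x)) \<partial>\<mu>)"
      using k kx S by (intro integral_left_mult(2)[symmetric, OF integrand[OF f g]]) auto
    also have "\<dots> = (\<integral>y. f y * g (matrix_inv y ** x) \<partial>\<mu>)"
    proof (rule Bochner_Integration.integral_cong[OF refl])
      fix y assume "y \<in> space \<mu>"
      then have y: "y \<in> GL2" using haar unfolding haar_measure_def by simp
      have "matrix_inv (k ** y) ** (k ** x) = matrix_inv y ** x"
        using k y by (simp add: matrix_inv_mult flip: matrix_mul_assoc)
      then show "f (k ** y) * g (matrix_inv (k ** y) ** (k ** x)) = f y * g (matrix_inv y ** x)"
        using hecke_carrierD(2)[OF f kx(1) y] by simp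
    qed
    finally show "convolution \<mu> f g (k ** x) = convolution \<mu> f g x"
      using kx k by (simp add: convolution_def)
  next
    fix x assume "x \<notin> GL2" then show "convolution \<mu> f g x = 0" by (simp add: convolution_def)
  qed (use S' U in auto)
qed

text \<open>The inner convolution of \<open>f\<close> and \<open>g\<close> is a finite sum over
  representatives, so exchanging it with the outer integral is additivity of the integral rather
  than Fubini's theorem. In each summand the translation by \<open>s\<close> is then removed by
  \<open>integral_left_mult\<close>.\<close>

lemma convolution_assoc:
  assumes f: "f \<in> hecke_carrier K" and g: "g \<in> hecke_carrier K" and h: "h \<in> hecke_carrier K"
  shows "convolution \<mu> (convolution \<mu> f g) h = convolution \<mu> f (convolution \<mu> g h)"
proof
  fix x
  show "convolution \<mu> (convolution \<mu> f g) h x = convolution \<mu> f (convolution \<mu> g h) x"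
  proof (cases "x \<in> GL2")
    case x: True
    obtain S where S: "transversal f S" using hecke_carrierD(5)[OF f] by blast
    then have S': "finite S" "S \<subseteq> GL2" unfolding transversal_def by auto
    obtain U where U: "transversal g U" using hecke_carrierD(5)[OF g] by blast
    define F where "F s t = g (matrix_inv s ** t) * h (matrix_inv t ** x)" for s t
    have F_conv: "integrable \<mu> (F s)" "(\<integral>t. F s t \<partial>\<mu>) = convolution \<mu> g h (matrix_inv s ** x)" if "s \<in> S" for s
    proof -
      have s: "s \<in> GL2" using S' that by blast
      define G where "G r = g r * h (matrix_inv r ** (matrix_inv s ** x))" for r
      have FG: "F s t = G (matrix_inv s ** t)" if "t \<in> space \<mu>" for t
      proof -
        have "t \<in> GL2" using that haar unfolding haar_measure_def by simp
        then show ?thesis unfolding F_def G_def using s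
          by (simp add: matrix_inv_mult flip: matrix_mul_assoc)
      qed
      have G: "right_inv G" "transversal G U"
        unfolding G_def using integrand[OF g h, of "matrix_inv s ** x"] s x U by auto
      have "(\<integral>t. F s t \<partial>\<mu>) = (\<integral>t. G (matrix_inv s ** t) \<partial>\<mu>)"
        by (rule Bochner_Integration.integral_cong[OF refl FG])
      also have "\<dots> = (\<integral>t. G t \<partial>\<mu>)" using integral_left_mult(2)[OF G] s by simp
      also have "\<dots> = convolution \<mu> g h (matrix_inv s ** x)" using s x by (simp add: convolution_def G_def)
      finally show "(\<integral>t. F s t \<partial>\<mu>) = convolution \<mu> g h (matrix_inv s ** x)" .
      show "integrable \<mu> (F s)"
        using integral_left_mult(1)[OF G, of "matrix_inv s"] s
        by (simp add: FG cong: Bochner_Integration.integrable_cong)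
    qed
    have "convolution \<mu> (convolution \<mu> f g) h x
        = (\<integral>t. convolution \<mu> f g t * h (matrix_inv t ** x) \<partial>\<mu>)"
      using x by (simp add: convolution_def)
    also have "\<dots> = (\<integral>t. (\<Sum>s\<in>S. f s * F s t) \<partial>\<mu>)"
    proof (rule Bochner_Integration.integral_cong[OF refl])
      fix t assume "t \<in> space \<mu>"
      then have "t \<in> GL2" using haar unfolding haar_measure_def by simp
      then show "convolution \<mu> f g t * h (matrix_inv t ** x) = (\<Sum>s\<in>S. f s * F s t)"
        by (simp add: convolution_eq_sum[OF f g _ S] F_def sum_distrib_right mult.assoc)
    qed
    also have "\<dots> = (\<Sum>s\<in>S. \<integral>t. f s * F s t \<partial>\<mu>)"
      using F_conv(1) by (intro Bochner_Integration.integral_sum) auto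
    also have "\<dots> = (\<Sum>s\<in>S. f s * convolution \<mu> g h (matrix_inv s ** x))"
      by (intro sum.cong refl) (simp add: F_conv(2))
    also have "\<dots> = convolution \<mu> f (convolution \<mu> g h) x"
      using f g h x S by (intro convolution_eq_sum[symmetric]) auto
    finally show ?thesis .
  next
    case False
    then show ?thesis by (simp add: convolution_def)
  qed
qed

lemma convolution_add_left:
  assumes "f \<in> hecke_carrier K" "g \<in> hecke_carrier K" "h \<in> hecke_carrier K"
  shows "convolution \<mu> (\<lambda>x. f x + g x) h = (\<lambda>x. convolution \<mu> f h x + convolution \<mu> g h x)"
  using assms integrable_convolution
  by (auto simp: convolution_def distrib_right fun_eq_iff)

lemma convolution_add_right:
  assumes "f \<in> hecke_carrier K" "g \<in> hecke_carrier K" "h \<in> hecke_carrier K"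
  shows "convolution \<mu> h (\<lambda>x. f x + g x) = (\<lambda>x. convolution \<mu> h f x + convolution \<mu> h g x)"
  using assms integrable_convolution
  by (auto simp: convolution_def distrib_left fun_eq_iff)

lemma convolution_smult:
  "convolution \<mu> (\<lambda>x. c * f x) g = (\<lambda>x. c * convolution \<mu> f g x)"
  "convolution \<mu> f (\<lambda>x. c * g x) = (\<lambda>x. c * convolution \<mu> f g x)"
  by (auto simp: convolution_def fun_eq_iff mult.assoc mult.left_commute)

lemma convolution_normalizer_left:
  assumes n': "n \<in> normalizer" and f: "f \<in> hecke_carrier K"
  shows "convolution \<mu> (char_fun K n) f = (\<lambda>x. f (matrix_inv n ** x))"
proof
  have n: "n \<in> GL2" "\<And>k. k \<in> K \<Longrightarrow> matrix_inv n ** k ** n \<in> K"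
    "\<And>k. k \<in> K \<Longrightarrow> n ** k ** matrix_inv n \<in> K"
    using n' unfolding normalizer_def by auto
  fix x
  show "convolution \<mu> (char_fun K n) f x = f (matrix_inv n ** x)"
  proof (cases "x \<in> GL2")
    case True
    have "transversal (char_fun K n) {n}"
      using n(1) unfolding transversal_def char_fun_normalizer[OF n'] by (auto simp: indicator_def)
    then show ?thesis
      using convolution_eq_sum[OF char_fun_hecke[OF n(1)] f True]
      by (simp add: char_fun_def)
  next
    case False
    then have "matrix_inv n ** x \<notin> GL2" using GL2_mult[OF n(1)] GL2_inv(5)[OF n(1)] by metis
    then show ?thesis using False hecke_carrierD(1)[OF f] by (simp add: convolution_def)
  qed
qed

text \<open>Unlike on the left, the sum over representatives of \<open>f\<close> does not collapse
  at once. Moving \<open>n\<close> across with the normalizer property rewrites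
  \<open>matrix_inv s ** x \<in> coset n\<close> as \<open>x ** matrix_inv n \<in> coset s\<close>,
  and the sum becomes the expansion of \<open>f\<close> at \<open>x ** matrix_inv n\<close>.\<close>

lemma convolution_normalizer_right:
  assumes n': "n \<in> normalizer" and f: "f \<in> hecke_carrier K"
  shows "convolution \<mu> f (char_fun K n) = (\<lambda>x. f (x ** matrix_inv n))"
proof
  have n: "n \<in> GL2" "\<And>k. k \<in> K \<Longrightarrow> matrix_inv n ** k ** n \<in> K"
    "\<And>k. k \<in> K \<Longrightarrow> n ** k ** matrix_inv n \<in> K"
    using n' unfolding normalizer_def by auto
  fix x
  show "convolution \<mu> f (char_fun K n) x = f (x ** matrix_inv n)"
  proof (cases "x \<in> GL2")
    case True
    obtain S where S: "transversal f S" using hecke_carrierD(5)[OF f] by blast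
    then have S': "S \<subseteq> GL2" unfolding transversal_def by auto
    have mem: "matrix_inv s ** x \<in> coset n \<longleftrightarrow> x ** matrix_inv n \<in> coset s" if "s \<in> S" for s
    proof -
      have s: "s \<in> GL2" using that S' by blast
      have "matrix_inv s ** x \<in> coset n \<longleftrightarrow> matrix_inv n ** (matrix_inv s ** x) \<in> K"
        using n(1) by (simp add: coset_iff)
      also have "\<dots> \<longleftrightarrow> matrix_inv s ** (x ** matrix_inv n) \<in> K"
      proof
        assume "matrix_inv n ** (matrix_inv s ** x) \<in> K"
        from n(3)[OF this] show "matrix_inv s ** (x ** matrix_inv n) \<in> K"
          using n(1) by (simp flip: matrix_mul_assoc)
      next
        assume "matrix_inv s ** (x ** matrix_inv n) \<in> K"
        from n(2)[OF this] show "matrix_inv n ** (matrix_inv s ** x) \<in> K"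
          using n(1) by (simp flip: matrix_mul_assoc)
      qed
      also have "\<dots> \<longleftrightarrow> x ** matrix_inv n \<in> coset s" using s by (simp add: coset_iff)
      finally show ?thesis .
    qed
    have "convolution \<mu> f (char_fun K n) x = (\<Sum>s\<in>S. f s * char_fun K n (matrix_inv s ** x))"
      by (rule convolution_eq_sum[OF f char_fun_hecke[OF n(1)] True S])
    also have "\<dots> = (\<Sum>s\<in>S. f s * indicator (coset s) (x ** matrix_inv n))"
      unfolding char_fun_normalizer[OF n'] using mem by (intro sum.cong) (auto simp: indicator_def)
    also have "\<dots> = f (x ** matrix_inv n)"
      by (rule transversal_expand[symmetric, OF hecke_carrierD(4)[OF f] S])
    finally show ?thesis .
  next
    case False
    then have "x ** matrix_inv n \<notin> GL2" using GL2_mult[OF _ n(1)] GL2_inv(7)[OF n(1)] by metis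
    then show ?thesis using False hecke_carrierD(1)[OF f] by (simp add: convolution_def)
  qed
qed

lemma convolution_one:
  assumes "f \<in> hecke_carrier K"
  shows "convolution \<mu> (char_fun K (mat 1)) f = f" "convolution \<mu> f (char_fun K (mat 1)) = f"
  using convolution_normalizer_left[of "mat 1" f] convolution_normalizer_right[of "mat 1" f] assms
  by (simp_all add: normalizer_def)

text \<open>The hypothesis \<open>mem\<close> says that \<open>K g K h K\<close> is the single
  double coset of \<open>g ** h\<close>, so the product is supported there, and by bi-invariance it
  is constant there. Its value \<open>N\<close> counts representatives, and it is positive because
  the representative of the coset of \<open>g\<close> is counted at \<open>g ** h\<close>.\<close>

lemma convolution_char_fun:
  assumes g: "g \<in> GL2" and h: "h \<in> GL2"
    and mem: "\<And>k. k \<in> K \<Longrightarrow> g ** k ** h \<in> double_coset K (g ** h)"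
  obtains N :: nat where "N > 0"
    "convolution \<mu> (char_fun K g) (char_fun K h) = (\<lambda>x. of_nat N * char_fun K (g ** h) x)"
proof -
  let ?c = "convolution \<mu> (char_fun K g) (char_fun K h)"
  obtain S where S: "transversal (char_fun K g) S"
    using hecke_carrierD(5)[OF char_fun_hecke[OF g]] by blast
  then have S': "finite S" "S \<subseteq> GL2" unfolding transversal_def by auto
  define A where "A x = {s \<in> S. s \<in> double_coset K g \<and> matrix_inv s ** x \<in> double_coset K h}" for x
  have eq: "?c x = of_nat (card (A x))" if x: "x \<in> GL2" for x
  proof -
    have "?c x = (\<Sum>s\<in>S. char_fun K g s * char_fun K h (matrix_inv s ** x))"
      by (rule convolution_eq_sum[OF char_fun_hecke[OF g] char_fun_hecke[OF h] x S])
    also have "\<dots> = (\<Sum>s\<in>A x. 1)"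
      using S'(1) unfolding A_def
      by (intro sum.mono_neutral_cong_right) (auto simp: char_fun_def indicator_def)
    finally show ?thesis by simp
  qed
  define N where "N = card (A (g ** h))"
  have c_hecke: "?c \<in> hecke_carrier K" using g h by simp
  have "?c x = of_nat N * char_fun K (g ** h) x" for x
  proof (cases "x \<in> double_coset K (g ** h)")
    case True
    then obtain k l where kl: "k \<in> K" "l \<in> K" "x = k ** (g ** h) ** l"
      unfolding double_coset_iff by blast
    then have "?c x = ?c (g ** h)"
      using hecke_carrierD(2,3)[OF c_hecke] g h K_subset_GL2 by simp
    moreover have "char_fun K (g ** h) x = 1" using True by (simp add: char_fun_def)
    ultimately show ?thesis using g h by (simp add: eq N_def)
  next
    case False
    have "?c x = 0"
    proof (cases "x \<in> GL2")
      case x: True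
      have "A x = {}"
      proof (rule ccontr)
        assume "A x \<noteq> {}"
        then obtain s where s: "s \<in> S" "s \<in> double_coset K g" "matrix_inv s ** x \<in> double_coset K h"
          unfolding A_def by blast
        then obtain k l k' l' where *: "k \<in> K" "l \<in> K" "s = k ** g ** l"
            "k' \<in> K" "l' \<in> K" "matrix_inv s ** x = k' ** h ** l'"
          unfolding double_coset_iff by blast
        have "x = s ** (matrix_inv s ** x)" using s(1) S'(2) by auto
        also have "\<dots> = k ** (g ** (l ** k') ** h) ** l'"
          unfolding *(6) unfolding *(3) by (simp add: matrix_mul_assoc)
        finally have "x \<in> double_coset K (g ** h)"
          using mem[OF K_mult[OF *(2,4)]] double_coset_mult[OF *(1,5)] by simp
        then show False using False by simp
      qed
      then show ?thesis using eq[OF x] by simp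
    next
      case x: False
      then show ?thesis by (simp add: convolution_def)
    qed
    then show ?thesis using False by (simp add: char_fun_def)
  qed
  moreover have "N > 0"
  proof -
    have "char_fun K g g \<noteq> 0" by (simp add: char_fun_def)
    then obtain s where s: "s \<in> S" "g \<in> coset s" using S unfolding transversal_def by blast
    then obtain k where k: "k \<in> K" "g = s ** k" unfolding coset_def by blast
    have sG: "s \<in> GL2" using s S' by blast
    have "s = mat 1 ** g ** matrix_inv k" using k K_subset_GL2 by simp
    then have "s \<in> double_coset K g"
      using double_coset_mult[OF K_one K_inv[OF k(1)], of g g] by simp
    moreover have "matrix_inv s ** (g ** h) = k ** h ** mat 1"
      unfolding k using sG by (simp flip: matrix_mul_assoc)
    then have "matrix_inv s ** (g ** h) \<in> double_coset K h"
      using double_coset_mult[OF k(1) K_one, of h h] by simp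
    ultimately have "s \<in> A (g ** h)" unfolding A_def using s by blast
    then show ?thesis unfolding N_def using S'(1) by (auto simp: card_gt_0_iff A_def)
  qed
  ultimately show thesis using that by blast
qed

lemma H_alg_simps:
  "carrier (H_alg \<mu>) = hecke_carrier K" "f \<otimes>\<^bsub>H_alg \<mu>\<^esub> g = convolution \<mu> f g"
  "\<one>\<^bsub>H_alg \<mu>\<^esub> = char_fun K (mat 1)" "\<zero>\<^bsub>H_alg \<mu>\<^esub> = (\<lambda>x. 0)"
  "f \<oplus>\<^bsub>H_alg \<mu>\<^esub> g = (\<lambda>x. f x + g x)"
  by (simp_all add: H_alg_def hecke_algebra_def)

lemma ring_H_alg: "ring (H_alg \<mu>)"
proof (rule ringI)
  show "abelian_group (H_alg \<mu>)"
  proof (rule abelian_groupI)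
    fix f assume "f \<in> carrier (H_alg \<mu>)"
    then show "\<exists>g\<in>carrier (H_alg \<mu>). g \<oplus>\<^bsub>H_alg \<mu>\<^esub> f = \<zero>\<^bsub>H_alg \<mu>\<^esub>"
      using hecke_smult[of f "- 1"] by (intro bexI[of _ "\<lambda>x. - 1 * f x"]) (auto simp: H_alg_simps)
  qed (simp_all add: H_alg_simps ac_simps)
  show "Group.monoid (H_alg \<mu>)"
    by (rule monoidI) (simp_all add: H_alg_simps convolution_assoc convolution_one)
qed (simp_all add: H_alg_simps convolution_add_left convolution_add_right)

lemma H_alg_minus:
  assumes "f \<in> hecke_carrier K" "g \<in> hecke_carrier K"
  shows "f \<ominus>\<^bsub>H_alg \<mu>\<^esub> g = (\<lambda>x. f x - g x)"
proof -
  interpret ring "H_alg \<mu>" by (rule ring_H_alg)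
  have "(\<lambda>x. - 1 * g x) \<in> carrier (H_alg \<mu>)" using hecke_smult[of g "- 1"] assms by (simp add: H_alg_simps)
  then have "\<ominus>\<^bsub>H_alg \<mu>\<^esub> g = (\<lambda>x. - 1 * g x)"
    using assms by (intro minus_equality) (simp_all add: H_alg_simps)
  then show ?thesis by (simp add: a_minus_def H_alg_simps)
qed

end

section \<open>Double cosets\<close>

type_synonym parities = "bool \<times> bool \<times> bool \<times> bool"

text \<open>
  The entries \<open>a, b, c, d\<close> are those of the conjugate of \<open>g\<close> by \<open>diag(2, 1)\<close>, divided by
  \<open>2 powi m\<close>; this is where the factors 2 and 1/2 off the diagonal come from.
\<close>

definition shape :: "int \<Rightarrow> nat \<Rightarrow> parities \<Rightarrow> q2mat \<Rightarrow> bool" where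
  "shape m e A g \<longleftrightarrow> (\<exists>a b c d u. A = (odd2 a, odd2 b, odd2 c, odd2 d) \<and> A \<noteq> (False, False, False, False) \<and>
     odd2 u \<and> a * d - b * c = 2 ^ e * u \<and>
     g = mat2 (2 powi m * emb a) (2 powi m * emb b / 2) (2 powi m * 2 * emb c) (2 powi m * emb d))"

lemma shapeI:
  assumes "g = mat2 p q r s" "p = 2 powi m * emb a" "2 * q = 2 powi m * emb b"
    "r = 2 powi m * 2 * emb c" "s = 2 powi m * emb d" "odd2 u" "a * d - b * c = 2 ^ e * u"
    "A = (odd2 a, odd2 b, odd2 c, odd2 d)" "A \<noteq> (False, False, False, False)"
  shows "shape m e A g"
proof -
  have "q = 2 powi m * emb b / 2" using assms(3) by (simp add: field_simps)
  then show ?thesis unfolding shape_def using assms by blast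
qed

lemma shapeE:
  assumes "shape m e A g"
  obtains a b c d u where "A = (odd2 a, odd2 b, odd2 c, odd2 d)" "A \<noteq> (False, False, False, False)"
    "odd2 u" "a * d - b * c = 2 ^ e * u"
    "g = mat2 (2 powi m * emb a) (2 powi m * emb b / 2) (2 powi m * 2 * emb c) (2 powi m * emb d)"
  using assms unfolding shape_def by (elim exE conjE) (rule that)

lemma four_neq_0_q2 [simp]: "(4 :: q2) \<noteq> 0"
proof -
  have "(2 :: q2) * 2 \<noteq> 0" unfolding mult_eq_0_iff by simp
  then show ?thesis by simp
qed

lemma powi_neq_0_q2 [simp]: "(2 :: q2) powi m \<noteq> 0"
  by simp

lemma shape_det:
  assumes "shape m e A g" shows "\<exists>u. odd2 u \<and> det g = 2 powi m * 2 powi m * 2 ^ e * emb u"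
  using assms
proof (rule shapeE)
  fix a b c d u assume *: "odd2 u" "a * d - b * c = 2 ^ e * u"
    "g = mat2 (2 powi m * emb a) (2 powi m * emb b / 2) (2 powi m * 2 * emb c) (2 powi m * emb d)"
  have "det g = 2 powi m * 2 powi m * emb (a * d - b * c)"
    unfolding *(3) by (simp add: emb_simps algebra_simps)
  then show ?thesis using * by (auto simp: emb_simps emb_power emb_numeral)
qed

lemma shape_GL2: "shape m e A g \<Longrightarrow> g \<in> GL2"
  using shape_det[of m e A g] by (auto simp: GL2_iff)

text \<open>After conjugation, \<open>m\<close> is the least valuation among the four entries, since
  the remaining factors are not all even. Once \<open>m\<close> is known, the entries
  \<open>a, b, c, d\<close> themselves are determined, and with them their parities and the
  valuation of their determinant.\<close>

lemma shape_unique: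
  assumes "shape m e A g" "shape m' e' A' g"
  shows "m = m' \<and> e = e' \<and> A = A'"
proof -
  have m_le: "m' \<le> m" if g: "shape m e A g" "shape m' e' A' g" for m m' e e' A A'
  proof (rule ccontr)
    assume "\<not> m' \<le> m"
    define k where "k = nat (m' - m - 1)"
    have m': "m' = m + int (Suc k)" using \<open>\<not> m' \<le> m\<close> by (simp add: k_def)
    have pw: "(2 :: q2) powi m' = 2 powi m * (2 * 2 ^ k)"
      unfolding m' by (simp add: power_int_add)
    obtain a b c d where 1: "A = (odd2 a, odd2 b, odd2 c, odd2 d)" "A \<noteq> (False, False, False, False)"
      "g = mat2 (2 powi m * emb a) (2 powi m * emb b / 2) (2 powi m * 2 * emb c) (2 powi m * emb d)"
      using g(1) by (rule shapeE) blast
    obtain a' b' c' d' where 2: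
      "g = mat2 (2 powi m' * emb a') (2 powi m' * emb b' / 2) (2 powi m' * 2 * emb c') (2 powi m' * emb d')"
      using g(2) by (rule shapeE) blast
    have "emb x = emb (2 * (2 ^ k * y))" if "2 powi m * emb x = 2 powi m' * emb y" for x y
      using that unfolding pw by (simp add: emb_simps emb_numeral emb_power mult.assoc)
    then have "a = 2 * (2 ^ k * a')" "b = 2 * (2 ^ k * b')" "c = 2 * (2 ^ k * c')" "d = 2 * (2 ^ k * d')"
      using 1(3) unfolding 2 by auto
    then show False using 1(1,2) by simp
  qed
  have m: "m = m'" using m_le[OF assms] m_le[OF assms(2,1)] by simp
  obtain a b c d u where 1: "A = (odd2 a, odd2 b, odd2 c, odd2 d)" "odd2 u" "a * d - b * c = 2 ^ e * u"
      "g = mat2 (2 powi m * emb a) (2 powi m * emb b / 2) (2 powi m * 2 * emb c) (2 powi m * emb d)"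
    using assms(1) by (rule shapeE) blast
  obtain a' b' c' d' u' where 2: "A' = (odd2 a', odd2 b', odd2 c', odd2 d')" "odd2 u'" "a' * d' - b' * c' = 2 ^ e' * u'"
      "g = mat2 (2 powi m * emb a') (2 powi m * emb b' / 2) (2 powi m * 2 * emb c') (2 powi m * emb d')"
    using assms(2) unfolding m[symmetric] by (rule shapeE) blast
  have eq: "a = a'" "b = b'" "c = c'" "d = d'" using 1(4) unfolding 2(4) by auto
  then have "2 ^ e * u = 2 ^ e' * u'" using 1(3) 2(3) by simp
  moreover have "e \<le> e'" if "2 ^ e * u = 2 ^ e' * u'" "odd2 u'" for e e' u u'
  proof (rule ccontr)
    assume "\<not> e \<le> e'"
    then obtain k where "e = e' + Suc k" by (metis add_Suc_right less_imp_Suc_add not_le)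
    then have "2 ^ e' * u' = 2 ^ e' * (2 * (2 ^ k * u))" using that(1) by (simp add: power_add mult.assoc)
    then have "u' = 2 * (2 ^ k * u)" by simp
    then have "\<not> odd2 u'" by simp
    then show False using that(2) by simp
  qed
  ultimately have "e = e'" using 1(2) 2(2) by (metis le_antisym)
  then show ?thesis using m eq 1 2 by simp
qed

lemma shape_iff: "shape m e A g \<Longrightarrow> shape m' e' A' g \<longleftrightarrow> m' = m \<and> e' = e \<and> A' = A"
  using shape_unique by metis

lemma shape_exists:
  assumes "g \<in> GL2" shows "\<exists>m e A. shape m e A g"
proof -
  obtain p q r s where g: "g = mat2 p q r s" by (rule mat2_cases)
  \<comment> \<open>The exponent may be enlarged at will, so that one power of 2 clears the
    denominators of all four entries.\<close>
  have int: "\<exists>N. \<forall>n\<ge>N. \<exists>a. x * 2 ^ n = emb a" for x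
  proof (cases "x = 0")
    case True
    then show ?thesis by (intro exI[of _ 0]) (auto simp: emb_simps intro: exI[of _ 0])
  next
    case False
    then obtain n u where u: "x = 2 powi n * emb u" using q2_pow2_unit by metis
    have "\<exists>a. x * 2 ^ k = emb a" if "k \<ge> nat (- n)" for k
    proof -
      have "x * 2 ^ k = 2 powi (n + int k) * emb u"
        unfolding u by (simp add: power_int_add)
      also have "n + int k = int (nat (n + int k))" using that by simp
      also have "2 powi int (nat (n + int k)) * emb u = emb (2 ^ nat (n + int k) * u)"
        by (simp only: power_int_of_nat emb_simps emb_power emb_numeral)
      finally show ?thesis by blast
    qed
    then show ?thesis by blast
  qed
  obtain N1 N2 N3 N4 where N: "\<forall>n\<ge>N1. \<exists>a. p * 2 ^ n = emb a" "\<forall>n\<ge>N2. \<exists>a. (2 * q) * 2 ^ n = emb a"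
    "\<forall>n\<ge>N3. \<exists>a. (r / 2) * 2 ^ n = emb a" "\<forall>n\<ge>N4. \<exists>a. s * 2 ^ n = emb a"
    using int by metis
  define N where "N = N1 + N2 + N3 + N4"
  obtain a b c d where abcd: "p * 2 ^ N = emb a" "(2 * q) * 2 ^ N = emb b" "(r / 2) * 2 ^ N = emb c" "s * 2 ^ N = emb d"
  proof -
    have "N \<ge> N1" "N \<ge> N2" "N \<ge> N3" "N \<ge> N4" by (simp_all add: N_def)
    then show thesis using N that by blast
  qed
  have det: "p * s - q * r \<noteq> 0" using assms unfolding g by (simp add: GL2_iff)
  have "emb (a * d - b * c) = (2 ^ N * 2 ^ N) * (p * s - q * r)"
    unfolding emb_simps abcd[symmetric] by (simp add: algebra_simps)
  then have nz: "a * d - b * c \<noteq> 0" using det emb_simps(5) by auto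
  \<comment> \<open>Splitting off common factors 2 must stop: every common power of 2 of the entries
    divides the determinant, which is nonzero.\<close>
  have "\<exists>j a' b' c' d'. a = 2 ^ j * a' \<and> b = 2 ^ j * b' \<and> c = 2 ^ j * c' \<and> d = 2 ^ j * d' \<and>
      (odd2 a' \<or> odd2 b' \<or> odd2 c' \<or> odd2 d')"
  proof (rule ccontr)
    assume *: "\<not> ?thesis"
    have step: "\<exists>a' b' c' d'. a = 2 ^ j * a' \<and> b = 2 ^ j * b' \<and> c = 2 ^ j * c' \<and> d = 2 ^ j * d'" for j
    proof (induction j)
      case (Suc j)
      then obtain a' b' c' d' where 1: "a = 2 ^ j * a'" "b = 2 ^ j * b'" "c = 2 ^ j * c'" "d = 2 ^ j * d'" by blast
      then have "\<not> odd2 a'" "\<not> odd2 b'" "\<not> odd2 c'" "\<not> odd2 d'" using * by blast+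
      then obtain a'' b'' c'' d'' where "a' = 2 * a''" "b' = 2 * b''" "c' = 2 * c''" "d' = 2 * d''"
        unfolding not_odd2_iff by blast
      with 1 have "a = 2 ^ Suc j * a''" "b = 2 ^ Suc j * b''" "c = 2 ^ Suc j * c''" "d = 2 ^ Suc j * d''"
        by simp_all
      then show ?case by blast
    qed simp
    have dvd: "2 ^ j dvd a * d - b * c" for j
      using step[of j] by (auto simp: mult.assoc)
    obtain n u where "odd2 u" "a * d - b * c = 2 ^ n * u" using z2_pow2_unit nz .
    then have "2 ^ n * 2 dvd 2 ^ n * u" using dvd[of "Suc n"] by (simp add: mult.commute)
    then show False using \<open>odd2 u\<close> by (auto simp: dvd_def)
  qed
  then obtain j a' b' c' d' where abcd': "a = 2 ^ j * a'" "b = 2 ^ j * b'" "c = 2 ^ j * c'" "d = 2 ^ j * d'"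
    "odd2 a' \<or> odd2 b' \<or> odd2 c' \<or> odd2 d'" by blast
  have "a' * d' - b' * c' \<noteq> 0"
  proof
    assume z: "a' * d' - b' * c' = 0"
    have "a * d - b * c = 2 ^ j * 2 ^ j * (a' * d' - b' * c')" unfolding abcd' by (simp add: algebra_simps)
    then show False using nz z by simp
  qed
  then obtain e u where u: "odd2 u" "a' * d' - b' * c' = 2 ^ e * u" using z2_pow2_unit by blast
  have tr: "x = 2 powi (int j - int N) * emb y" if "x * 2 ^ N = emb (2 ^ j * y)" for x y
    using that by (simp add: power_int_diff emb_simps emb_power emb_numeral field_simps)
  have "shape (int j - int N) e (odd2 a', odd2 b', odd2 c', odd2 d') g"
  proof (rule shapeI[OF g])
    show "p = 2 powi (int j - int N) * emb a'" "2 * q = 2 powi (int j - int N) * emb b'"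
      "s = 2 powi (int j - int N) * emb d'"
      using abcd(1,2,4) unfolding abcd' by (auto intro!: tr)
    have "r / 2 = 2 powi (int j - int N) * emb c'" using abcd(3) unfolding abcd' by (rule tr)
    then show "r = 2 powi (int j - int N) * 2 * emb c'" by (simp add: field_simps)
  qed (use u abcd' in auto)
  then show ?thesis by blast
qed

text \<open>Conjugated by \<open>diag(2, 1)\<close>, an element of \<open>K\<close> becomes
  \<open>(p, 2 * q; 2 * r, s)\<close> with \<open>p\<close> and \<open>s\<close> odd. This is
  congruent to the identity modulo 2 and has odd determinant, so neither the parities nor
  \<open>e\<close> can change.\<close>

lemma shape_K_left:
  assumes "shape m e A g" "k \<in> K" shows "shape m e A (k ** g)"
  using assms(1)
proof (rule shapeE)
  fix a b c d u assume 1: "A = (odd2 a, odd2 b, odd2 c, odd2 d)" "A \<noteq> (False, False, False, False)"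
    "odd2 u" "a * d - b * c = 2 ^ e * u"
    "g = mat2 (2 powi m * emb a) (2 powi m * emb b / 2) (2 powi m * 2 * emb c) (2 powi m * emb d)"
  obtain p q r s where k: "k = mat2 (emb p) (emb q) (4 * emb r) (emb s)" "odd2 p" "odd2 s"
    using assms(2) by (rule K_cases)
  show ?thesis
  proof (rule shapeI[OF mat2_mult[of "emb p" "emb q" "4 * emb r" "emb s" "2 powi m * emb a" "2 powi m * emb b / 2"
          "2 powi m * 2 * emb c" "2 powi m * emb d", folded k(1) 1(5)]])
    have "(p * a + 2 * q * c) * (2 * r * b + s * d) - (p * b + 2 * q * d) * (2 * r * a + s * c)
      = (p * s - 4 * q * r) * (a * d - b * c)" by (simp add: algebra_simps)
    then show "(p * a + 2 * q * c) * (2 * r * b + s * d) - (p * b + 2 * q * d) * (2 * r * a + s * c)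
      = 2 ^ e * ((p * s - 4 * q * r) * u)" unfolding 1(4) by simp
  qed (use 1 k in \<open>simp_all add: emb_simps emb_numeral algebra_simps\<close>)
qed

lemma shape_K_right:
  assumes "shape m e A g" "k \<in> K" shows "shape m e A (g ** k)"
  using assms(1)
proof (rule shapeE)
  fix a b c d u assume 1: "A = (odd2 a, odd2 b, odd2 c, odd2 d)" "A \<noteq> (False, False, False, False)"
    "odd2 u" "a * d - b * c = 2 ^ e * u"
    "g = mat2 (2 powi m * emb a) (2 powi m * emb b / 2) (2 powi m * 2 * emb c) (2 powi m * emb d)"
  obtain p q r s where k: "k = mat2 (emb p) (emb q) (4 * emb r) (emb s)" "odd2 p" "odd2 s"
    using assms(2) by (rule K_cases)
  show ?thesis
  proof (rule shapeI[OF mat2_mult[of "2 powi m * emb a" "2 powi m * emb b / 2"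
          "2 powi m * 2 * emb c" "2 powi m * emb d" "emb p" "emb q" "4 * emb r" "emb s", folded k(1) 1(5)]])
    have "(a * p + 2 * b * r) * (2 * c * q + d * s) - (2 * a * q + b * s) * (c * p + 2 * d * r)
      = (p * s - 4 * q * r) * (a * d - b * c)" by (simp add: algebra_simps)
    then show "(a * p + 2 * b * r) * (2 * c * q + d * s) - (2 * a * q + b * s) * (c * p + 2 * d * r)
      = 2 ^ e * ((p * s - 4 * q * r) * u)" unfolding 1(4) by simp
  qed (use 1 k in \<open>simp_all add: emb_simps emb_numeral algebra_simps\<close>)
qed

lemma shape_double_coset:
  "shape m e A g \<Longrightarrow> h \<in> double_coset K g \<Longrightarrow> shape m e A h"
  unfolding double_coset_iff using shape_K_left shape_K_right by blast


text \<open>Conjugation by \<open>diag(2, 1)\<close> takes \<open>w2\<close> to twice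
  \<open>(0, -1; 1, 0)\<close> and \<open>y2\<close> to \<open>(1, 0; 1, 1)\<close>. Modulo 2 these
  give the row operations (multiplication from the left) and column operations (from the right)
  below; the factor 2 of \<open>w2\<close> raises \<open>m\<close> by one.\<close>

fun left_U2 :: "parities \<Rightarrow> parities" where "left_U2 (a, b, c, d) = (c, d, a, b)"
fun right_U2 :: "parities \<Rightarrow> parities" where "right_U2 (a, b, c, d) = (b, a, d, c)"
fun left_V :: "parities \<Rightarrow> parities" where "left_V (a, b, c, d) = (a, b, a \<noteq> c, b \<noteq> d)"
fun right_V :: "parities \<Rightarrow> parities" where "right_V (a, b, c, d) = (a \<noteq> b, b, c \<noteq> d, d)"

abbreviation w1 :: q2mat where "w1 \<equiv> w_mat 2"
abbreviation w2 :: q2mat where "w2 \<equiv> w_mat 4"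
abbreviation y2 :: q2mat where "y2 \<equiv> y_mat 2"

lemma mat_eqs: "w_mat t = mat2 0 (- 1) t 0" "y_mat t = mat2 1 0 t 1" "z_mat t = mat2 t 0 0 t"
  by (simp_all add: w_mat_def y_mat_def z_mat_def mat2_def)

lemma shape_z_mat:
  assumes "shape m e A g" shows "shape (m + j) e A (z_mat (2 powi j) ** g)"
  using assms
proof (rule shapeE)
  fix a b c d u assume 1: "A = (odd2 a, odd2 b, odd2 c, odd2 d)" "A \<noteq> (False, False, False, False)"
    "odd2 u" "a * d - b * c = 2 ^ e * u"
    "g = mat2 (2 powi m * emb a) (2 powi m * emb b / 2) (2 powi m * 2 * emb c) (2 powi m * emb d)"
  show ?thesis
    by (rule shapeI[of _ _ _ _ _ _ a b c d u]) (unfold 1(5) mat_eqs mat2_mult, rule refl,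
        use 1 in \<open>simp_all add: power_int_add\<close>)
qed

lemma shape_w2_left:
  assumes "shape m e A g" shows "shape (m + 1) e (left_U2 A) (w2 ** g)"
  using assms
proof (rule shapeE)
  fix a b c d u assume 1: "A = (odd2 a, odd2 b, odd2 c, odd2 d)" "A \<noteq> (False, False, False, False)"
    "odd2 u" "a * d - b * c = 2 ^ e * u"
    "g = mat2 (2 powi m * emb a) (2 powi m * emb b / 2) (2 powi m * 2 * emb c) (2 powi m * emb d)"
  have "(- c) * b - (- d) * a = 2 ^ e * u" using 1(4) by (simp add: algebra_simps)
  then show ?thesis
    by (intro shapeI[of _ _ _ _ _ _ "- c" "- d" a b u]) (unfold 1(5) mat_eqs mat2_mult, rule refl,
        use 1 in \<open>auto simp: power_int_add emb_simps\<close>)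
qed

lemma shape_w2_right:
  assumes "shape m e A g" shows "shape (m + 1) e (right_U2 A) (g ** w2)"
  using assms
proof (rule shapeE)
  fix a b c d u assume 1: "A = (odd2 a, odd2 b, odd2 c, odd2 d)" "A \<noteq> (False, False, False, False)"
    "odd2 u" "a * d - b * c = 2 ^ e * u"
    "g = mat2 (2 powi m * emb a) (2 powi m * emb b / 2) (2 powi m * 2 * emb c) (2 powi m * emb d)"
  have "b * (- c) - (- a) * d = 2 ^ e * u" using 1(4) by (simp add: algebra_simps)
  then show ?thesis
    by (intro shapeI[of _ _ _ _ _ _ b "- a" d "- c" u]) (unfold 1(5) mat_eqs mat2_mult, rule refl,
        use 1 in \<open>auto simp: power_int_add emb_simps\<close>)
qed

lemma shape_y_left:
  assumes "shape m e A g" "odd2 r" shows "shape m e (left_V A) (y_mat (2 * emb r) ** g)"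
  using assms(1)
proof (rule shapeE)
  fix a b c d u assume 1: "A = (odd2 a, odd2 b, odd2 c, odd2 d)" "A \<noteq> (False, False, False, False)"
    "odd2 u" "a * d - b * c = 2 ^ e * u"
    "g = mat2 (2 powi m * emb a) (2 powi m * emb b / 2) (2 powi m * 2 * emb c) (2 powi m * emb d)"
  have "a * (r * b + d) - b * (r * a + c) = 2 ^ e * u" using 1(4) by (simp add: algebra_simps)
  then show ?thesis
    by (intro shapeI[of _ _ _ _ _ _ a b "r * a + c" "r * b + d" u]) (unfold 1(5) mat_eqs mat2_mult, rule refl,
        use 1 assms(2) in \<open>auto simp: emb_simps algebra_simps\<close>)
qed

lemma shape_y_right:
  assumes "shape m e A g" "odd2 r" shows "shape m e (right_V A) (g ** y_mat (2 * emb r))"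
  using assms(1)
proof (rule shapeE)
  fix a b c d u assume 1: "A = (odd2 a, odd2 b, odd2 c, odd2 d)" "A \<noteq> (False, False, False, False)"
    "odd2 u" "a * d - b * c = 2 ^ e * u"
    "g = mat2 (2 powi m * emb a) (2 powi m * emb b / 2) (2 powi m * 2 * emb c) (2 powi m * emb d)"
  have "(a + r * b) * d - b * (c + r * d) = 2 ^ e * u" using 1(4) by (simp add: algebra_simps)
  then show ?thesis
    by (intro shapeI[of _ _ _ _ _ _ "a + r * b" b "c + r * d" d u]) (unfold 1(5) mat_eqs mat2_mult, rule refl,
        use 1 assms(2) in \<open>auto simp: emb_simps algebra_simps\<close>)
qed

text \<open>The conjugate of \<open>w1\<close> is \<open>(0, -2; 1, 0)\<close>: the upper row moves
  down, and the lower row moves up with a factor \<open>- 2\<close>. As long as the upper row is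
  nonzero modulo 2 the result is still primitive, so no power of 2 splits off and \<open>e\<close>
  takes the whole factor 2 of the determinant.\<close>

lemma shape_w1_left:
  assumes "shape m e (p, q, r, s) g" "p \<or> q" shows "shape m (Suc e) (False, False, p, q) (w1 ** g)"
  using assms(1)
proof (rule shapeE)
  fix a b c d u assume 1: "(p, q, r, s) = (odd2 a, odd2 b, odd2 c, odd2 d)"
    "odd2 u" "a * d - b * c = 2 ^ e * u"
    "g = mat2 (2 powi m * emb a) (2 powi m * emb b / 2) (2 powi m * 2 * emb c) (2 powi m * emb d)"
  have "(- 2 * c) * b - (- 2 * d) * a = 2 * (a * d - b * c)" by (simp add: algebra_simps)
  then have "(- 2 * c) * b - (- 2 * d) * a = 2 ^ Suc e * u" using 1(3) by simp
  then show ?thesis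
    by (intro shapeI[of _ _ _ _ _ _ "- 2 * c" "- 2 * d" a b u]) (unfold 1(4) mat_eqs mat2_mult, rule refl,
        use 1 assms(2) in \<open>auto simp: emb_simps emb_numeral\<close>)
qed

lemma shape_one: "shape 0 0 (True, False, False, True) (mat 1)"
  by (rule shapeI[of _ 1 0 0 1 _ 1 0 0 1 1]) (simp_all add: emb_simps mat_1_eq_mat2)

abbreviation E21 :: parities where "E21 \<equiv> (False, False, True, False)"

text \<open>Elementary divisors with restricted operations. The odd entry is the pivot, and since
  the other entries are even, the diagonal can be cleared by operations congruent to the identity
  modulo 2, which is what \<open>K\<close> offers after conjugation.\<close>

lemma E21_normal_form:
  assumes "shape m (Suc k) E21 g"
  shows "g \<in> double_coset K (mat2 0 (2 powi m * 2 ^ k) (2 powi m * 2) 0)"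
  using assms
proof (rule shapeE)
  fix a' b' c d' u assume 1: "E21 = (odd2 a', odd2 b', odd2 c, odd2 d')"
    "odd2 u" "a' * d' - b' * c = 2 ^ Suc k * u"
    "g = mat2 (2 powi m * emb a') (2 powi m * emb b' / 2) (2 powi m * 2 * emb c) (2 powi m * emb d')"
  obtain a b d where abd: "a' = 2 * a" "b' = 2 * b" "d' = 2 * d" using 1(1) not_odd2_iff by auto
  obtain v where v: "c * v = 1" using 1(1) odd2_imp_unit by auto
  have odd: "odd2 c" "odd2 v" using 1(1) v odd2_iff_unit by (auto simp: mult.commute)
  have "2 * (2 * a * d - b * c) = 2 * (2 ^ k * u)" using 1(3) unfolding abd by (simp add: algebra_simps)
  then have det: "2 * a * d - b * c = 2 ^ k * u"
    by (rule mult_left_cancel[OF two_neq_0_z2, THEN iffD1])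
  have "v * (2 * a * d - 2 ^ k * u) = v * (b * c)" unfolding det[symmetric] by simp
  also have "\<dots> = b" using v by (simp add: mult.left_commute mult.commute)
  finally have b: "emb b = emb v * (2 * emb a * emb d - 2 ^ k * emb u)"
    by (metis emb_simps(2,3) emb_power emb_numeral)
  have cv: "emb c * emb v = 1" using arg_cong[OF v, of emb] by (simp add: emb_simps)
  \<comment> \<open>\<open>k1\<close> and \<open>k3\<close> recover the entries \<open>a'\<close>
    and \<open>d'\<close> from the pivot \<open>c\<close>, while the diagonal matrix
    \<open>k2\<close> carries the units: \<open>c\<close>, and \<open>- u\<close> times the inverse
    \<open>v\<close> of \<open>c\<close>.\<close>
  define k1 where "k1 = mat2 1 (emb (a * v)) (4 * emb 0) 1"
  define k2 where "k2 = mat2 (emb (- u * v)) 0 (4 * emb 0) (emb c)"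
  define k3 where "k3 = mat2 1 (emb (d * v)) (4 * emb 0) 1"
  have K: "k1 ** k2 \<in> K" "k3 \<in> K"
    unfolding k1_def k2_def k3_def using 1(2) odd
    by (intro K_mult K_I[of 1 1 1 "emb (a * v)" "a * v" "4 * emb 0" 0 1]
          K_I[of "- u * v" c _ 0 0 "4 * emb 0" 0 "emb c"] K_I[of 1 1 1 "emb (d * v)" "d * v" "4 * emb 0" 0 1];
        simp add: emb_simps)+
  have "g = (k1 ** k2) ** mat2 0 (2 powi m * 2 ^ k) (2 powi m * 2) 0 ** k3"
    unfolding 1(4) abd k1_def k2_def k3_def mat2_mult mat2_eq_iff
  proof (intro conjI)
  qed (use cv in \<open>simp_all add: b emb_simps emb_numeral emb_power algebra_simps diff_divide_distrib\<close>)
  then show ?thesis unfolding double_coset_iff using K by blast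
qed

lemma E21_double_coset:
  assumes "shape m (Suc k) E21 g" "shape m (Suc k) E21 h"
  shows "h \<in> double_coset K g"
  using E21_normal_form[OF assms(2)] double_coset_eq[OF E21_normal_form[OF assms(1)]] by simp

text \<open>The parities force an odd determinant, hence \<open>e = 0\<close>. After removing the
  power of 2 and, if the lower left parity is odd, one factor \<open>y2\<close>, the conjugated
  matrix is congruent to the identity modulo 2, so the matrix itself lies in
  \<open>K\<close>.\<close>

lemma shape_unipotent:
  assumes "shape m e (True, False, q, True) g"
  shows "e = 0" "\<exists>k\<in>K. g = z_mat (2 powi m) ** (if q then y2 ** k else k)"
proof -
  obtain a b' c d u where 1: "(True, False, q, True) = (odd2 a, odd2 b', odd2 c, odd2 d)"
    "a * d - b' * c = 2 ^ e * u"
    "g = mat2 (2 powi m * emb a) (2 powi m * emb b' / 2) (2 powi m * 2 * emb c) (2 powi m * emb d)"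
    using assms by (rule shapeE) blast
  have "odd2 (a * d - b' * c)" using 1(1) by auto
  then show "e = 0" unfolding 1(2) by simp
  obtain b where b: "b' = 2 * b" using 1(1) not_odd2_iff by auto
  show "\<exists>k\<in>K. g = z_mat (2 powi m) ** (if q then y2 ** k else k)"
  proof (cases q)
    case True
    then have "\<not> odd2 (c - a)" using 1(1) by simp
    then obtain e where "c - a = 2 * e" unfolding not_odd2_iff by blast
    then have c: "c = a + 2 * e" by (simp add: algebra_simps)
    have "mat2 (emb a) (emb b) (4 * emb e) (emb (d - 2 * b)) \<in> K"
      using 1(1) by (intro K_I) auto
    moreover have "g = z_mat (2 powi m) ** (y2 ** mat2 (emb a) (emb b) (4 * emb e) (emb (d - 2 * b)))"
      unfolding 1(3) b c mat_eqs mat2_mult by (simp add: emb_simps emb_numeral algebra_simps)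
    ultimately show ?thesis using True by auto
  next
    case False
    then obtain e where c: "c = 2 * e" using 1(1) not_odd2_iff by auto
    have "mat2 (emb a) (emb b) (4 * emb e) (emb d) \<in> K"
      using 1(1) by (intro K_I) auto
    moreover have "g = z_mat (2 powi m) ** mat2 (emb a) (emb b) (4 * emb e) (emb d)"
      unfolding 1(3) b c mat_eqs mat2_mult by (simp add: emb_simps emb_numeral algebra_simps)
    ultimately show ?thesis using False by auto
  qed
qed

text \<open>The case excluded from \<open>shape_w1_left\<close>: the upper row is even, all entries
  become even, and a factor 2 splits off. Valuation 1 of the determinant makes half of the upper
  right entry odd. The parity \<open>q\<close> of half of the upper left entry is not visible in the
  shape of \<open>g\<close>; its two values account for the two cosets in the double coset of
  \<open>w1\<close>.\<close>

lemma shape_w1_left_E21: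
  assumes "shape m (Suc 0) E21 g" shows "\<exists>q. shape (m + 1) 0 (True, False, q, True) (w1 ** g)"
  using assms
proof (rule shapeE)
  fix a' b' c d' u assume 1: "E21 = (odd2 a', odd2 b', odd2 c, odd2 d')"
    "odd2 u" "a' * d' - b' * c = 2 ^ Suc 0 * u"
    "g = mat2 (2 powi m * emb a') (2 powi m * emb b' / 2) (2 powi m * 2 * emb c) (2 powi m * emb d')"
  obtain a b d where abd: "a' = 2 * a" "b' = 2 * b" "d' = 2 * d" using 1(1) not_odd2_iff by auto
  have "2 * (2 * a * d - b * c) = 2 * u" using 1(3) unfolding abd by (simp add: algebra_simps)
  then have det: "2 * a * d - b * c = u" by (rule mult_left_cancel[OF two_neq_0_z2, THEN iffD1])
  then have "odd2 (2 * a * d - b * c)" using 1(2) by simp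
  then have "odd2 b" by simp
  have "shape (m + 1) 0 (True, False, odd2 a, True) (w1 ** g)"
    by (rule shapeI[of _ _ _ _ _ _ "- c" "- 2 * d" a b u]) (unfold 1(4) abd mat_eqs mat2_mult, rule refl,
        use 1 det \<open>odd2 b\<close> in \<open>auto simp: power_int_add emb_simps emb_numeral algebra_simps\<close>)
  then show ?thesis by blast
qed

section \<open>Scalars, inverses and normalizing elements\<close>

lemma mats_GL2 [simp]: "t \<noteq> 0 \<Longrightarrow> w_mat t \<in> GL2" "y_mat r \<in> GL2" "t \<noteq> 0 \<Longrightarrow> z_mat t \<in> GL2"
  unfolding mat_eqs by (simp_all add: GL2_iff)

lemma matrix_inv_z_mat: "t \<noteq> 0 \<Longrightarrow> matrix_inv (z_mat t) = z_mat (1 / t)"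
  by (rule matrix_inv_eqI) (simp_all add: mat_eqs mat_1_eq_mat2 GL2_iff)

lemma z_mat_mult: "z_mat s ** z_mat t = z_mat (s * t)"
  by (simp add: mat_eqs)

lemma z_mat_commute: "z_mat t ** x = x ** z_mat t"
proof -
  obtain p q r s where "x = mat2 p q r s" by (rule mat2_cases)
  then show ?thesis by (simp add: mat_eqs mult.commute)
qed

lemma matrix_inv_y_mat: "matrix_inv (y_mat r) = y_mat (- r)"
  by (rule matrix_inv_eqI) (simp_all add: mat_eqs mat_1_eq_mat2 GL2_iff)

lemma matrix_inv_w1: "matrix_inv w1 = z_mat (- 1 / 2) ** w1"
  by (rule matrix_inv_eqI) (simp_all add: mat_eqs mat_1_eq_mat2 GL2_iff)

lemma matrix_inv_w2: "matrix_inv w2 = z_mat (- 1 / 4) ** w2"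
  by (rule matrix_inv_eqI) (simp_all add: mat_eqs mat_1_eq_mat2 GL2_iff)

lemma normalizer_mult: "m \<in> normalizer \<Longrightarrow> n \<in> normalizer \<Longrightarrow> m ** n \<in> normalizer"
  unfolding normalizer_def
proof safe
  fix k assume *: "m \<in> GL2" "n \<in> GL2" "k \<in> K"
    "\<forall>k\<in>K. matrix_inv m ** k ** m \<in> K \<and> m ** k ** matrix_inv m \<in> K"
    "\<forall>k\<in>K. matrix_inv n ** k ** n \<in> K \<and> n ** k ** matrix_inv n \<in> K"
  then have "matrix_inv n ** (matrix_inv m ** k ** m) ** n \<in> K" "m ** (n ** k ** matrix_inv n) ** matrix_inv m \<in> K"
    by blast+
  then show "matrix_inv (m ** n) ** k ** (m ** n) \<in> K" "m ** n ** k ** matrix_inv (m ** n) \<in> K"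
    using * by (simp_all add: matrix_inv_mult matrix_mul_assoc)
qed auto

lemma normalizer_K: "k \<in> K \<Longrightarrow> k \<in> normalizer"
  unfolding normalizer_def by (simp add: K_subset_GL2)

lemma normalizer_z_mat: "t \<noteq> 0 \<Longrightarrow> z_mat t \<in> normalizer"
  unfolding normalizer_def
proof safe
  fix k assume "t \<noteq> 0" "k \<in> K"
  have "matrix_inv (z_mat t) ** k ** z_mat t = matrix_inv (z_mat t) ** (z_mat t ** k)"
    unfolding z_mat_commute[of t k] by (rule matrix_mul_assoc[symmetric])
  then show "matrix_inv (z_mat t) ** k ** z_mat t \<in> K" using \<open>t \<noteq> 0\<close> \<open>k \<in> K\<close> by simp
  show "z_mat t ** k ** matrix_inv (z_mat t) \<in> K"
    unfolding z_mat_commute[of t k] using \<open>t \<noteq> 0\<close> \<open>k \<in> K\<close> by (subst GL2_inv(6)) auto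
qed simp

lemma normalizer_w2: "w2 \<in> normalizer"
  unfolding normalizer_def
proof (safe, simp)
  fix k assume "k \<in> K"
  then obtain a b c d where k: "k = mat2 (emb a) (emb b) (4 * emb c) (emb d)" "odd2 a" "odd2 d" by (rule K_cases)
  show "matrix_inv w2 ** k ** w2 \<in> K" "w2 ** k ** matrix_inv w2 \<in> K"
    unfolding matrix_inv_w2 unfolding k mat_eqs mat2_mult using k(2,3)
    by (intro K_I[of d a _ _ "- c" _ "- b"]; simp add: emb_simps)+
qed

lemma normalizer_y2: "y2 \<in> normalizer"
  unfolding normalizer_def
proof (safe, simp)
  fix k assume "k \<in> K"
  then obtain a b c d where k: "k = mat2 (emb a) (emb b) (4 * emb c) (emb d)" "odd2 a" "odd2 d" by (rule K_cases)
  \<comment> \<open>Conjugation by \<open>y2\<close> changes the lower left entry by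
    \<open>2 * (d - a)\<close>, up to sign and multiples of 4. Two odd numbers differ by an even
    one, so divisibility by 4 survives.\<close>
  then have "\<not> odd2 (d - a)" by simp
  then obtain e where "d - a = 2 * e" unfolding not_odd2_iff by blast
  then have d: "d = a + 2 * e" by (simp add: algebra_simps)
  show "matrix_inv y2 ** k ** y2 \<in> K"
    unfolding matrix_inv_y_mat unfolding k mat_eqs mat2_mult using k(2,3) unfolding d
    by (intro K_I[of "a + 2 * b" "d - 2 * b" _ _ b _ "c - b + e"]; simp add: emb_simps emb_numeral algebra_simps d)
  show "y2 ** k ** matrix_inv y2 \<in> K"
    unfolding matrix_inv_y_mat unfolding k mat_eqs mat2_mult using k(2,3) unfolding d
    by (intro K_I[of "a - 2 * b" "d + 2 * b" _ _ b _ "c - b - e"]; simp add: emb_simps emb_numeral algebra_simps d)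
qed

lemma char_fun_K [simp]:
  assumes "k \<in> K" shows "char_fun K (g ** k) = char_fun K g" "char_fun K (k ** g) = char_fun K g"
proof -
  have "g ** k \<in> double_coset K g" "k ** g \<in> double_coset K g"
    using double_coset_mult[OF K_one assms, of g g] double_coset_mult[OF assms K_one, of g g] by simp_all
  then show "char_fun K (g ** k) = char_fun K g" "char_fun K (k ** g) = char_fun K g"
    unfolding char_fun_def by (simp_all only: double_coset_eq)
qed

lemma char_fun_neg: "char_fun K (z_mat (- t) ** g) = char_fun K (z_mat t ** g)"
proof -
  have "z_mat (- 1) \<in> K" unfolding mat_eqs by (rule K_I[of "- 1" "- 1" _ _ 0 _ 0]) (simp_all add: emb_simps)
  moreover have "z_mat (- t) ** g = z_mat (- 1) ** (z_mat t ** g)"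
    by (simp add: matrix_mul_assoc z_mat_mult)
  ultimately show ?thesis by simp
qed

text \<open>The invariants of \<open>w1\<close> single out its double coset, so questions of
  membership become computations with parities.\<close>

lemma double_coset_w1: "x \<in> double_coset K w1 \<longleftrightarrow> shape 0 (Suc 0) E21 x"
proof -
  have "shape 0 (Suc 0) E21 w1"
    using shape_w1_left[OF shape_one] by simp
  then show ?thesis using E21_double_coset shape_double_coset by blast
qed

section \<open>Relations in the Hecke algebra\<close>

lemma z_mat_left_commute: "x ** (z_mat t ** y) = z_mat t ** (x ** y)"
proof -
  have "x ** (z_mat t ** y) = (x ** z_mat t) ** y" by (rule matrix_mul_assoc)
  also have "\<dots> = (z_mat t ** x) ** y" by (simp only: z_mat_commute)
  also have "\<dots> = z_mat t ** (x ** y)" by (rule matrix_mul_assoc[symmetric])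
  finally show ?thesis .
qed

lemma z_mat_mult_assoc: "z_mat s ** (z_mat t ** x) = z_mat (s * t) ** x"
  by (simp add: matrix_mul_assoc z_mat_mult)

context hecke
begin

lemma char_fun_normalizer_left:
  assumes n: "n \<in> normalizer" and g: "g \<in> GL2"
  shows "convolution \<mu> (char_fun K n) (char_fun K g) = char_fun K (n ** g)"
proof -
  have nG: "n \<in> GL2" and 1: "\<And>k. k \<in> K \<Longrightarrow> matrix_inv n ** k ** n \<in> K" "\<And>k. k \<in> K \<Longrightarrow> n ** k ** matrix_inv n \<in> K"
    using n unfolding normalizer_def by auto
  have "matrix_inv n ** x \<in> double_coset K g \<longleftrightarrow> x \<in> double_coset K (n ** g)" for x
  proof
    assume "matrix_inv n ** x \<in> double_coset K g"
    then obtain k l where kl: "k \<in> K" "l \<in> K" "matrix_inv n ** x = k ** g ** l" unfolding double_coset_iff by blast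
    have "x = n ** (matrix_inv n ** x)" using nG by simp
    also have "\<dots> = (n ** k ** matrix_inv n) ** (n ** g) ** l"
      unfolding kl using nG by (simp add: matrix_mul_assoc)
    finally show "x \<in> double_coset K (n ** g)" using 1(2)[OF kl(1)] kl(2) unfolding double_coset_iff by blast
  next
    assume "x \<in> double_coset K (n ** g)"
    then obtain k l where kl: "k \<in> K" "l \<in> K" "x = k ** (n ** g) ** l" unfolding double_coset_iff by blast
    have "matrix_inv n ** x = (matrix_inv n ** k ** n) ** g ** l" unfolding kl by (simp add: matrix_mul_assoc)
    then show "matrix_inv n ** x \<in> double_coset K g" using 1(1)[OF kl(1)] kl(2) unfolding double_coset_iff by blast
  qed
  then show ?thesis
    unfolding convolution_normalizer_left[OF n char_fun_hecke[OF g]]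
    by (simp add: char_fun_def indicator_def fun_eq_iff)
qed

lemma char_fun_normalizer_right:
  assumes n: "n \<in> normalizer" and g: "g \<in> GL2"
  shows "convolution \<mu> (char_fun K g) (char_fun K n) = char_fun K (g ** n)"
proof -
  have nG: "n \<in> GL2" and 1: "\<And>k. k \<in> K \<Longrightarrow> matrix_inv n ** k ** n \<in> K" "\<And>k. k \<in> K \<Longrightarrow> n ** k ** matrix_inv n \<in> K"
    using n unfolding normalizer_def by auto
  have "x ** matrix_inv n \<in> double_coset K g \<longleftrightarrow> x \<in> double_coset K (g ** n)" for x
  proof
    assume "x ** matrix_inv n \<in> double_coset K g"
    then obtain k l where kl: "k \<in> K" "l \<in> K" "x ** matrix_inv n = k ** g ** l" unfolding double_coset_iff by blast
    have "x = (x ** matrix_inv n) ** n" using nG by simp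
    also have "\<dots> = k ** (g ** n) ** (matrix_inv n ** l ** n)"
      unfolding kl using nG by (simp add: matrix_mul_assoc)
    finally show "x \<in> double_coset K (g ** n)" using 1(1)[OF kl(2)] kl(1) unfolding double_coset_iff by blast
  next
    assume "x \<in> double_coset K (g ** n)"
    then obtain k l where kl: "k \<in> K" "l \<in> K" "x = k ** (g ** n) ** l" unfolding double_coset_iff by blast
    have "x ** matrix_inv n = k ** g ** (n ** l ** matrix_inv n)" unfolding kl by (simp add: matrix_mul_assoc)
    then show "x ** matrix_inv n \<in> double_coset K g" using 1(2)[OF kl(2)] kl(1) unfolding double_coset_iff by blast
  qed
  then show ?thesis
    unfolding convolution_normalizer_right[OF n char_fun_hecke[OF g]]
    by (simp add: char_fun_def indicator_def fun_eq_iff)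
qed

lemma hecke_eqs: "hecke_U 1 = char_fun K w1" "hecke_U 2 = char_fun K w2" "hecke_V = char_fun K y2"
    "hecke_Z = char_fun K (z_mat 2)"
  by (simp_all add: hecke_U_def hecke_V_def hecke_Z_def)

lemma hecke_gens [simp]: "hecke_U 1 \<in> hecke_carrier K" "hecke_U 2 \<in> hecke_carrier K"
  "hecke_V \<in> hecke_carrier K" "hecke_Z \<in> hecke_carrier K"
  unfolding hecke_eqs by (rule char_fun_hecke, simp)+

lemma hecke_Z_left:
  "f \<in> hecke_carrier K \<Longrightarrow> convolution \<mu> hecke_Z f = (\<lambda>x. f (z_mat (1 / 2) ** x))"
  unfolding hecke_eqs using convolution_normalizer_left[OF normalizer_z_mat, of 2 f]
  by (simp add: matrix_inv_z_mat)

lemma hecke_Z_central: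
  "f \<in> hecke_carrier K \<Longrightarrow> convolution \<mu> f hecke_Z = convolution \<mu> hecke_Z f"
  using hecke_Z_left convolution_normalizer_right[OF normalizer_z_mat, of 2 f]
  by (simp add: hecke_eqs matrix_inv_z_mat z_mat_commute)

lemma hecke_Z_char_fun: "g \<in> GL2 \<Longrightarrow> convolution \<mu> hecke_Z (char_fun K g) = char_fun K (z_mat 2 ** g)"
  unfolding hecke_eqs by (intro char_fun_normalizer_left normalizer_z_mat) auto

section \<open>The ideal generated by \<open>Z - 1\<close>\<close>

definition Z_multiples :: "(q2mat \<Rightarrow> complex) set" where
  "Z_multiples = {\<lambda>x. f x - convolution \<mu> hecke_Z f x | f. f \<in> hecke_carrier K}"

lemma Z_multiples_I: "f \<in> hecke_carrier K \<Longrightarrow> (\<lambda>x. f x - convolution \<mu> hecke_Z f x) \<in> Z_multiples"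
  unfolding Z_multiples_def by blast

lemma hecke_diff [simp]:
  assumes "f \<in> hecke_carrier K" "g \<in> hecke_carrier K"
  shows "(\<lambda>x. f x - g x) \<in> hecke_carrier K"
  using hecke_add[OF assms(1) hecke_smult[OF assms(2), of "- 1"]] by simp

lemma convolution_diff_right:
  assumes "f \<in> hecke_carrier K" "g \<in> hecke_carrier K" "h \<in> hecke_carrier K"
  shows "convolution \<mu> h (\<lambda>x. f x - g x) = (\<lambda>x. convolution \<mu> h f x - convolution \<mu> h g x)"
  using convolution_add_right[of f "\<lambda>x. - 1 * g x" h] assms hecke_smult[of g "- 1"]
    convolution_smult(2)[of h "- 1" g] by simp

lemma convolution_diff_left:
  assumes "f \<in> hecke_carrier K" "g \<in> hecke_carrier K" "h \<in> hecke_carrier K"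
  shows "convolution \<mu> (\<lambda>x. f x - g x) h = (\<lambda>x. convolution \<mu> f h x - convolution \<mu> g h x)"
  using convolution_add_left[of f "\<lambda>x. - 1 * g x" h] assms hecke_smult[of g "- 1"]
    convolution_smult(1)[of "- 1" g h] by simp

lemma Z_multiples_subset: "f \<in> Z_multiples \<Longrightarrow> f \<in> hecke_carrier K"
  unfolding Z_multiples_def by auto

lemma Z_multiples_add: assumes "f \<in> Z_multiples" "g \<in> Z_multiples" shows "(\<lambda>x. f x + g x) \<in> Z_multiples"
proof -
  obtain a b where ab: "a \<in> hecke_carrier K" "b \<in> hecke_carrier K"
    "f = (\<lambda>x. a x - convolution \<mu> hecke_Z a x)" "g = (\<lambda>x. b x - convolution \<mu> hecke_Z b x)"
    using assms unfolding Z_multiples_def by blast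
  show ?thesis using Z_multiples_I[of "\<lambda>x. a x + b x"] ab
    by (simp add: convolution_add_right algebra_simps)
qed

lemma Z_multiples_smult: assumes "f \<in> Z_multiples" shows "(\<lambda>x. c * f x) \<in> Z_multiples"
proof -
  obtain a where a: "a \<in> hecke_carrier K" "f = (\<lambda>x. a x - convolution \<mu> hecke_Z a x)"
    using assms unfolding Z_multiples_def by blast
  show ?thesis using Z_multiples_I[of "\<lambda>x. c * a x"] a
    by (simp add: convolution_smult algebra_simps)
qed

lemma Z_multiples_zero: "(\<lambda>x. 0) \<in> Z_multiples"
  using Z_multiples_smult[OF Z_multiples_I[OF hecke_zero], of 0] by simp

lemma Z_multiples_diff: assumes "f \<in> Z_multiples" "g \<in> Z_multiples" shows "(\<lambda>x. f x - g x) \<in> Z_multiples"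
  using Z_multiples_add[OF assms(1) Z_multiples_smult[OF assms(2), of "- 1"]] by simp

lemma Z_multiples_left: assumes "f \<in> Z_multiples" "h \<in> hecke_carrier K" shows "convolution \<mu> h f \<in> Z_multiples"
proof -
  obtain a where a: "a \<in> hecke_carrier K" "f = (\<lambda>x. a x - convolution \<mu> hecke_Z a x)"
    using assms unfolding Z_multiples_def by blast
  have "convolution \<mu> h (convolution \<mu> hecke_Z a) = convolution \<mu> hecke_Z (convolution \<mu> h a)"
    using a(1) assms(2) by (simp add: hecke_Z_central flip: convolution_assoc)
  then show ?thesis using Z_multiples_I[of "convolution \<mu> h a"] a assms(2)
    by (simp add: convolution_diff_right)
qed

lemma Z_multiples_right: assumes "f \<in> Z_multiples" "h \<in> hecke_carrier K" shows "convolution \<mu> f h \<in> Z_multiples"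
proof -
  obtain a where a: "a \<in> hecke_carrier K" "f = (\<lambda>x. a x - convolution \<mu> hecke_Z a x)"
    using assms unfolding Z_multiples_def by blast
  then show ?thesis using Z_multiples_I[of "convolution \<mu> a h"] assms(2)
    by (simp add: convolution_diff_left convolution_assoc)
qed

text \<open>Because \<open>hecke_Z\<close> is central, the multiples of \<open>1 - Z\<close> already
  form a two-sided ideal. This explicit form, one function minus its translate, is what the
  independence argument works with.\<close>

lemma Z_ideal_eq: "Z_ideal \<mu> = Z_multiples"
proof
  interpret R: ring "H_alg \<mu>" by (rule ring_H_alg)
  let ?one = "char_fun K (mat 1)"
  have one: "?one \<in> hecke_carrier K" by simp
  have gen: "hecke_Z \<ominus>\<^bsub>H_alg \<mu>\<^esub> \<one>\<^bsub>H_alg \<mu>\<^esub> = (\<lambda>x. hecke_Z x - ?one x)"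
    using H_alg_minus[OF hecke_gens(4) one] by (simp add: H_alg_simps)
  have "ideal Z_multiples (H_alg \<mu>)"
  proof (rule idealI[OF ring_H_alg])
    show "subgroup Z_multiples (add_monoid (H_alg \<mu>))"
    proof (rule R.add.subgroupI)
      show "Z_multiples \<subseteq> carrier (H_alg \<mu>)" using Z_multiples_subset by (auto simp: H_alg_simps)
      show "Z_multiples \<noteq> {}" using Z_multiples_zero by blast
      fix f assume f: "f \<in> Z_multiples"
      have "\<ominus>\<^bsub>H_alg \<mu>\<^esub> f = (\<lambda>x. - 1 * f x)"
        using H_alg_minus[OF hecke_zero Z_multiples_subset[OF f]] Z_multiples_subset[OF f] R.minus_eq[of "\<zero>\<^bsub>H_alg \<mu>\<^esub>" f]
        by (simp add: H_alg_simps)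
      then show "\<ominus>\<^bsub>H_alg \<mu>\<^esub> f \<in> Z_multiples" using Z_multiples_smult[OF f, of "- 1"] by simp
    qed (use Z_multiples_add in \<open>auto simp: H_alg_simps\<close>)
  qed (use Z_multiples_left Z_multiples_right in \<open>auto simp: H_alg_simps\<close>)
  moreover have "(\<lambda>x. hecke_Z x - ?one x) \<in> Z_multiples"
    using Z_multiples_smult[OF Z_multiples_I[OF one], of "- 1"] by (simp add: convolution_one algebra_simps)
  ultimately show "Z_ideal \<mu> \<subseteq> Z_multiples"
    unfolding Z_ideal_def gen by (intro R.genideal_minimal) auto
  show "Z_multiples \<subseteq> Z_ideal \<mu>"
  proof
    fix f assume "f \<in> Z_multiples"
    then obtain a where a: "a \<in> hecke_carrier K" "f = (\<lambda>x. a x - convolution \<mu> hecke_Z a x)"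
      unfolding Z_multiples_def by blast
    have sub: "{\<lambda>x. hecke_Z x - ?one x} \<subseteq> carrier (H_alg \<mu>)" by (simp add: H_alg_simps)
    interpret I: ideal "Z_ideal \<mu>" "H_alg \<mu>"
      unfolding Z_ideal_def gen by (rule R.genideal_ideal[OF sub])
    have "(\<lambda>x. hecke_Z x - ?one x) \<in> Z_ideal \<mu>"
      unfolding Z_ideal_def gen by (rule R.genideal_self'[of "\<lambda>x. hecke_Z x - ?one x"]) (use sub in auto)
    then have "(\<lambda>x. hecke_Z x - ?one x) \<otimes>\<^bsub>H_alg \<mu>\<^esub> (\<lambda>x. - 1 * a x) \<in> Z_ideal \<mu>"
      using a hecke_smult[of a "- 1"] by (intro I.I_r_closed) (auto simp: H_alg_simps)
    moreover have "(\<lambda>x. hecke_Z x - ?one x) \<otimes>\<^bsub>H_alg \<mu>\<^esub> (\<lambda>x. - 1 * a x) = f"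
      unfolding H_alg_simps convolution_smult using a
      by (simp add: convolution_diff_left convolution_one)
    ultimately show "f \<in> Z_ideal \<mu>" by simp
  qed
qed

section \<open>The four relations\<close>

lemma y2_notin_K: "y2 \<notin> K"
proof
  assume "y2 \<in> K"
  then obtain c where "(2 :: q2) = 4 * emb c" unfolding mat_eqs by (rule K_cases) auto
  then have "2 * emb 1 = 2 * emb (2 * c)" by (simp add: emb_simps emb_numeral)
  then have "1 = 2 * c" by (simp only: mult_cancel_left emb_eq_iff) simp
  then have "odd2 (2 * c)" by (metis odd2_simps(6))
  then show False by simp
qed

text \<open>In other words, the double coset of \<open>w1\<close> is the union of the left cosets of
  \<open>w1\<close> and \<open>w1 ** y2\<close>. The square of \<open>w1\<close> is the scalar
  \<open>- 2\<close>, so a second factor \<open>w1\<close> turns the problem into one about matrices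
  invertible modulo 2, where \<open>shape_unipotent\<close> lists the possibilities.\<close>

lemma double_coset_w1_iff: "w1 ** z \<in> double_coset K w1 \<longleftrightarrow> z \<in> K \<or> z \<in> coset y2"
proof
  assume "w1 ** z \<in> double_coset K w1"
  then have "shape 0 (Suc 0) E21 (w1 ** z)" by (simp add: double_coset_w1)
  then obtain q where "shape (0 + 1) 0 (True, False, q, True) (w1 ** (w1 ** z))"
    using shape_w1_left_E21 by blast
  then obtain k where k: "k \<in> K" "w1 ** (w1 ** z) = z_mat (2 powi 1) ** (if q then y2 ** k else k)"
    using shape_unipotent by fastforce
  have "matrix_inv w1 ** (matrix_inv w1 ** (w1 ** (w1 ** z))) = z" by simp
  then have "z = matrix_inv w1 ** matrix_inv w1 ** z_mat 2 ** (if q then y2 ** k else k)"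
    unfolding k(2) by (simp add: matrix_mul_assoc)
  also have "matrix_inv w1 ** matrix_inv w1 ** z_mat 2 = z_mat (- 1)"
    unfolding matrix_inv_w1 unfolding mat_eqs mat2_mult by simp
  finally have z: "z = (if q then y2 ** k else k) ** z_mat (- 1)" by (simp only: z_mat_commute)
  have "z_mat (- 1) \<in> K" unfolding mat_eqs by (rule K_I[of "- 1" "- 1" _ _ 0 _ 0]) (simp_all add: emb_simps)
  then have "k ** z_mat (- 1) \<in> K" using k by simp
  then show "z \<in> K \<or> z \<in> coset y2" unfolding z coset_def by (auto simp flip: matrix_mul_assoc)
next
  assume "z \<in> K \<or> z \<in> coset y2"
  then obtain q k where k: "k \<in> K" "z = (if q then y2 else mat 1) ** k"
  proof
    assume "z \<in> K" then show thesis by (intro that[of z False]) simp_all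
  next
    assume "z \<in> coset y2"
    then obtain k where "k \<in> K" "z = y2 ** k" unfolding coset_def by blast
    then show thesis by (intro that[of k True]) simp_all
  qed
  have "shape 0 0 (left_V (True, False, False, True)) (y_mat (2 * emb 1) ** mat 1)"
    by (rule shape_y_left[OF shape_one]) simp
  then have "shape 0 0 (True, False, q, True) (if q then y2 else mat 1)"
    using shape_one by (cases q) (auto simp: emb_simps)
  then have "shape 0 0 (True, False, q, True) z" unfolding k(2) using shape_K_right k(1) by blast
  then show "w1 ** z \<in> double_coset K w1"
    unfolding double_coset_w1 using shape_w1_left by blast
qed

text \<open>The matrix unit \<open>E21\<close> has zero upper row and zero second column, so adding
  the upper row to the lower, or the second column to the first, fixes it; as both operations are
  bijective, nothing else is sent to it. The unit \<open>r\<close> is general so that the inverse of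
  \<open>y2\<close> is covered as well.\<close>

lemma double_coset_w1_y:
  assumes "odd2 r" "x \<in> GL2"
  shows "y_mat (2 * emb r) ** x \<in> double_coset K w1 \<longleftrightarrow> x \<in> double_coset K w1"
    "x ** y_mat (2 * emb r) \<in> double_coset K w1 \<longleftrightarrow> x \<in> double_coset K w1"
proof -
  obtain m e A where A: "shape m e A x" using shape_exists[OF assms(2)] by blast
  obtain a b c d where abcd: "A = (a, b, c, d)" by (metis prod_cases4)
  have 1: "x \<in> double_coset K w1 \<longleftrightarrow> 0 = m \<and> Suc 0 = e \<and> E21 = A"
    unfolding double_coset_w1 by (rule shape_iff[OF A])
  have 2: "y_mat (2 * emb r) ** x \<in> double_coset K w1 \<longleftrightarrow> 0 = m \<and> Suc 0 = e \<and> E21 = left_V A"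
    unfolding double_coset_w1 by (rule shape_iff[OF shape_y_left[OF A assms(1)]])
  have 3: "x ** y_mat (2 * emb r) \<in> double_coset K w1 \<longleftrightarrow> 0 = m \<and> Suc 0 = e \<and> E21 = right_V A"
    unfolding double_coset_w1 by (rule shape_iff[OF shape_y_right[OF A assms(1)]])
  show "y_mat (2 * emb r) ** x \<in> double_coset K w1 \<longleftrightarrow> x \<in> double_coset K w1"
    unfolding 1 2 abcd by auto
  show "x ** y_mat (2 * emb r) \<in> double_coset K w1 \<longleftrightarrow> x \<in> double_coset K w1"
    unfolding 1 3 abcd by auto
qed

lemma y2_eqs: "y2 = y_mat (2 * emb 1)" "matrix_inv y2 = y_mat (2 * emb (- 1))"
  by (simp_all add: emb_simps matrix_inv_y_mat)

lemma U1_y2_left: "x \<in> GL2 \<Longrightarrow> hecke_U 1 (matrix_inv y2 ** x) = hecke_U 1 x"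
  unfolding hecke_eqs char_fun_def indicator_def y2_eqs(2) by (subst double_coset_w1_y(1)) auto

lemma U1_V: "convolution \<mu> (hecke_U 1) hecke_V = hecke_U 1"
proof -
  have "hecke_U 1 (x ** matrix_inv y2) = hecke_U 1 x" for x
  proof (cases "x \<in> GL2")
    case True
    then show ?thesis
      unfolding hecke_eqs char_fun_def indicator_def y2_eqs(2) by (subst double_coset_w1_y(2)) auto
  next
    case False
    then have "x ** matrix_inv y2 \<notin> GL2" by (simp add: GL2_iff det_mul)
    then show ?thesis using False hecke_carrierD(1)[OF hecke_gens(1)] by simp
  qed
  then show ?thesis
    using convolution_normalizer_right[OF normalizer_y2 hecke_gens(1)] by (simp add: hecke_eqs)
qed

lemma V_U1: "convolution \<mu> hecke_V (hecke_U 1) = hecke_U 1"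
proof -
  have "hecke_U 1 (matrix_inv y2 ** x) = hecke_U 1 x" for x
  proof (cases "x \<in> GL2")
    case False
    then have "matrix_inv y2 ** x \<notin> GL2" by (simp add: GL2_iff det_mul)
    then show ?thesis using False hecke_carrierD(1)[OF hecke_gens(1)] by simp
  qed (rule U1_y2_left)
  then show ?thesis
    using convolution_normalizer_left[OF normalizer_y2 hecke_gens(1)] by (simp add: hecke_eqs)
qed

text \<open>The sum over the representatives \<open>w1\<close> and \<open>w1 ** y2\<close> has two
  equal terms because \<open>U1\<close> is invariant under \<open>y2\<close>; this is the factor 2.
  The common term is 1 exactly when half of \<open>x\<close> lies in \<open>K\<close> or in
  \<open>y2 K\<close>, which gives the two summands, each carrying one factor
  \<open>Z\<close>.\<close>

lemma U1_U1:
  "convolution \<mu> (hecke_U 1) (hecke_U 1) = (\<lambda>x. 2 * (hecke_Z x + convolution \<mu> hecke_Z hecke_V x))"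
proof
  fix x
  show "convolution \<mu> (hecke_U 1) (hecke_U 1) x = 2 * (hecke_Z x + convolution \<mu> hecke_Z hecke_V x)"
  proof (cases "x \<in> GL2")
    case True
    have ne: "w1 \<noteq> w1 ** y2"
    proof
      assume "w1 = w1 ** y2"
      then have "matrix_inv w1 ** w1 = matrix_inv w1 ** (w1 ** y2)" by (rule arg_cong)
      then show False using y2_notin_K K_one by simp
    qed
    have y2_inv: "matrix_inv y2 \<notin> K" using K_inv[of "matrix_inv y2"] y2_notin_K by auto
    have "transversal (hecke_U 1) {w1, w1 ** y2}"
      unfolding transversal_def
    proof (intro conjI ballI allI impI)
      fix s t assume "s \<in> {w1, w1 ** y2}" "t \<in> {w1, w1 ** y2}" "t \<in> coset s"
      then show "s = t" using y2_notin_K y2_inv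
        by (auto simp: coset_iff matrix_inv_mult simp flip: matrix_mul_assoc)
    next
      fix z assume "hecke_U 1 z \<noteq> 0"
      then have "z \<in> double_coset K w1" unfolding hecke_eqs char_fun_def by (auto simp: indicator_def split: if_splits)
      then have "w1 ** (matrix_inv w1 ** z) \<in> double_coset K w1" by simp
      then have "matrix_inv w1 ** z \<in> K \<or> matrix_inv w1 ** z \<in> coset y2" by (simp only: double_coset_w1_iff)
      then show "\<exists>s\<in>{w1, w1 ** y2}. z \<in> coset s"
        by (auto simp: coset_iff matrix_inv_mult matrix_mul_assoc)
    qed auto
    then have "convolution \<mu> (hecke_U 1) (hecke_U 1) x
        = (\<Sum>s\<in>{w1, w1 ** y2}. hecke_U 1 s * hecke_U 1 (matrix_inv s ** x))"
      by (intro convolution_eq_sum hecke_gens True)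
    also have "\<dots> = hecke_U 1 (matrix_inv w1 ** x) + hecke_U 1 (matrix_inv y2 ** (matrix_inv w1 ** x))"
    proof -
      have "w1 ** y2 \<in> double_coset K w1" "w1 \<in> double_coset K w1"
        by (simp_all only: double_coset_w1_iff coset_self simp_thms double_coset_self)
      then have "hecke_U 1 w1 = 1" "hecke_U 1 (w1 ** y2) = 1"
        by (simp_all only: hecke_eqs char_fun_def indicator_simps)
      then show ?thesis using ne by (simp add: matrix_inv_mult matrix_mul_assoc)
    qed
    also have "\<dots> = 2 * hecke_U 1 (matrix_inv w1 ** x)" using True by (subst U1_y2_left) auto
    also have "hecke_U 1 (matrix_inv w1 ** x) = hecke_Z x + convolution \<mu> hecke_Z hecke_V x"
    proof -
      define z where "z = z_mat (1 / 2) ** x"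
      have "matrix_inv w1 ** x = z_mat (- 1) ** (w1 ** z)"
        unfolding matrix_inv_w1 z_def
        by (simp add: z_mat_left_commute[of w1] z_mat_mult_assoc flip: matrix_mul_assoc)
      moreover have "z_mat (- 1) \<in> K" unfolding mat_eqs
        by (rule K_I[of "- 1" "- 1" _ _ 0 _ 0]) (simp_all add: emb_simps)
      then have "hecke_U 1 (z_mat (- 1) ** (w1 ** z)) = hecke_U 1 (w1 ** z)"
        using True unfolding z_def by (intro hecke_carrierD(2) hecke_gens) auto
      ultimately have 1: "hecke_U 1 (matrix_inv w1 ** x) = hecke_U 1 (w1 ** z)" by simp
      have 2: "hecke_Z x = indicator K z"
        using fun_cong[OF hecke_Z_left[OF char_fun_hecke[OF GL2_one]], of x]
        unfolding convolution_one(2)[OF hecke_gens(4)] z_def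
        by (simp add: char_fun_normalizer[OF normalizer_K[OF K_one]] coset_def)
      have 3: "convolution \<mu> hecke_Z hecke_V x = indicator (coset y2) z"
        unfolding hecke_Z_left[OF hecke_gens(3)] z_def unfolding hecke_eqs
        by (simp add: char_fun_normalizer[OF normalizer_y2])
      \<comment> \<open>Disjointness of the two cosets makes the indicator of their union the sum of
        the indicators.\<close>
      have "\<not> (z \<in> K \<and> z \<in> coset y2)"
      proof
        assume "z \<in> K \<and> z \<in> coset y2"
        then obtain k where k: "k \<in> K" "y2 ** k \<in> K" unfolding coset_def by blast
        have "(y2 ** k) ** matrix_inv k \<in> K" by (rule K_mult[OF k(2) K_inv[OF k(1)]])
        then show False using y2_notin_K k(1) K_subset_GL2 by simp
      qed
      then show ?thesis unfolding 1 2 3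
        unfolding hecke_eqs char_fun_def indicator_def double_coset_w1_iff by auto
    qed
    finally show ?thesis by simp
  next
    case False
    have "convolution \<mu> f g x = 0" for f g using False by (simp add: convolution_def)
    moreover have "hecke_Z x = 0" using False by (rule hecke_carrierD(1)[OF hecke_gens(4)])
    ultimately show ?thesis by simp
  qed
qed

lemma U2_U2: "convolution \<mu> (hecke_U 2) (hecke_U 2) = convolution \<mu> hecke_Z hecke_Z"
proof -
  have "w2 ** w2 = z_mat (- 4) ** mat 1" "z_mat 2 ** z_mat 2 = z_mat 4 ** mat 1"
    by (simp_all add: mat_eqs mat_1_eq_mat2)
  then have eq: "char_fun K (w2 ** w2) = char_fun K (z_mat 2 ** z_mat 2)"
    by (simp only: char_fun_neg)
  have "w2 \<in> GL2" "z_mat 2 \<in> GL2" by simp_all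
  then show ?thesis unfolding hecke_eqs
    using char_fun_normalizer_left[OF normalizer_w2] char_fun_normalizer_left[OF normalizer_z_mat[OF two_neq_0_q2]]
      eq by simp
qed

lemma U2_V_U2:
  "convolution \<mu> (convolution \<mu> (hecke_U 2) hecke_V) (hecke_U 2)
    = convolution \<mu> hecke_Z (convolution \<mu> (convolution \<mu> hecke_V (hecke_U 2)) hecke_V)"
proof -
  \<comment> \<open>After conjugation and division of each \<open>w2\<close> by 2, both sides of the
    braid relation are integral matrices that agree modulo 2; the quotient is the explicit element
    of \<open>K\<close>. The left side contains \<open>w2\<close> twice and the right side once,
    whence the extra scalar 2.\<close>
  have "w2 ** y2 ** w2 = (z_mat 2 ** (y2 ** w2 ** y2)) ** mat2 (emb 1) (emb (- 1)) (4 * emb 0) (emb 1)"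
    by (simp add: mat_eqs emb_simps)
  moreover have "mat2 (emb 1) (emb (- 1)) (4 * emb 0) (emb 1) \<in> K" by (rule K_I) auto
  ultimately have "char_fun K (w2 ** y2 ** w2) = char_fun K (z_mat 2 ** (y2 ** w2 ** y2))"
    by (simp only: char_fun_K)
  moreover have "w2 \<in> GL2" by simp
  ultimately show ?thesis unfolding hecke_eqs
    by (simp only: char_fun_normalizer_left char_fun_normalizer_right normalizer_w2 normalizer_y2 normalizer_z_mat two_neq_0_q2
        not_False_eq_True mats_GL2 GL2_mult)
qed

end

section \<open>Words modulo the relations\<close>

lemma ring_ring_of_type_algebra: "ring (ring_of_type_algebra :: 'a :: ring_1 ring)"
proof -
  have "\<exists>y. x + y = 0" for x :: 'a using add.right_inverse by blast
  then show ?thesis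
    unfolding ring_of_type_algebra_def using add.right_inverse
    by unfold_locales (auto simp: algebra_simps Units_def)
qed

lemma free_alg_simps:
  "carrier free_alg = UNIV" "x \<otimes>\<^bsub>free_alg\<^esub> y = x * y" "\<one>\<^bsub>free_alg\<^esub> = 1" "\<zero>\<^bsub>free_alg\<^esub> = 0"
  "x \<oplus>\<^bsub>free_alg\<^esub> y = x + y"
  by (simp_all add: free_alg_def ring_of_type_algebra_def)

lemma ring_free_alg: "ring free_alg"
  unfolding free_alg_def by (rule ring_ring_of_type_algebra)

lemma ideal_rel_ideal: "ideal rel_ideal free_alg"
  unfolding rel_ideal_def by (rule ring.genideal_ideal[OF ring_free_alg]) (simp add: free_alg_simps)

lemma rel_ideal_closed:
  "x \<in> rel_ideal \<Longrightarrow> y \<in> rel_ideal \<Longrightarrow> x + y \<in> rel_ideal"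
  "x \<in> rel_ideal \<Longrightarrow> p * x \<in> rel_ideal" "x \<in> rel_ideal \<Longrightarrow> x * p \<in> rel_ideal"
  "0 \<in> rel_ideal" "x \<in> rel_ideal \<Longrightarrow> - x \<in> rel_ideal"
proof -
  interpret I: ideal rel_ideal free_alg by (rule ideal_rel_ideal)
  show "x \<in> rel_ideal \<Longrightarrow> y \<in> rel_ideal \<Longrightarrow> x + y \<in> rel_ideal"
    using additive_subgroup.a_closed[OF ideal.axioms(1)[OF ideal_rel_ideal], of x y] by (simp add: free_alg_simps)
  show l: "x \<in> rel_ideal \<Longrightarrow> p * x \<in> rel_ideal" for p
    using I.I_l_closed[of x p] by (simp add: free_alg_simps)
  show "x \<in> rel_ideal \<Longrightarrow> x * p \<in> rel_ideal"
    using I.I_r_closed[of x p] by (simp add: free_alg_simps)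
  show "0 \<in> rel_ideal" using additive_subgroup.zero_closed[OF ideal.axioms(1)[OF ideal_rel_ideal]] by (simp add: free_alg_simps)
  show "x \<in> rel_ideal \<Longrightarrow> - x \<in> rel_ideal" using l[of "- 1"] by simp
qed

lemma relators_in_rel_ideal: "x \<in> relators \<Longrightarrow> x \<in> rel_ideal"
  unfolding rel_ideal_def using ring.genideal_self[OF ring_free_alg, of relators] by (auto simp: free_alg_simps)

definition rel_cong :: "gen free_algebra \<Rightarrow> gen free_algebra \<Rightarrow> bool" where
  "rel_cong p q \<longleftrightarrow> p - q \<in> rel_ideal"

lemma rel_cong_refl [simp]: "rel_cong p p"
  by (simp add: rel_cong_def rel_ideal_closed)

lemma rel_cong_sym: "rel_cong p q \<Longrightarrow> rel_cong q p"
  unfolding rel_cong_def using rel_ideal_closed(5)[of "p - q"] by simp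

lemma rel_cong_trans [trans]: "rel_cong p q \<Longrightarrow> rel_cong q r \<Longrightarrow> rel_cong p r"
  unfolding rel_cong_def using rel_ideal_closed(1)[of "p - q" "q - r"] by simp

lemma rel_cong_add: "rel_cong p q \<Longrightarrow> rel_cong r s \<Longrightarrow> rel_cong (p + r) (q + s)"
  unfolding rel_cong_def using rel_ideal_closed(1)[of "p - q" "r - s"] by (simp add: algebra_simps)

lemma rel_cong_mult:
  assumes "rel_cong p q" shows "rel_cong (r * p * s) (r * q * s)"
proof -
  have "r * (p - q) * s \<in> rel_ideal" using assms rel_ideal_closed(2,3) unfolding rel_cong_def by blast
  then show ?thesis by (simp add: rel_cong_def algebra_simps)
qed

definition wmon :: "gen list \<Rightarrow> gen free_algebra" where
  "wmon w = Poly_Mapping.single (Word w) 1"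

lemma wmon_Nil: "wmon [] = 1"
  by (simp add: wmon_def flip: zero_word_def)

lemma wmon_append: "wmon (v @ w) = wmon v * wmon w"
  by (simp add: wmon_def mult_single plus_word_def)

lemma wmon_Cons: "wmon (a # w) = free_var a * wmon w"
  using wmon_append[of "[a]" w] by (simp add: wmon_def free_var_def)

lemma single_eq_wmon: "Poly_Mapping.single (Word w) c = free_scalar c * wmon w"
  by (simp add: wmon_def free_scalar_def mult_single)


lemma poly_mapping_sum_single:
  fixes p :: "'a \<Rightarrow>\<^sub>0 'b :: comm_monoid_add"
  shows "(\<Sum>w\<in>Poly_Mapping.keys p. Poly_Mapping.single w (Poly_Mapping.lookup p w)) = p"
  by (rule poly_mapping_eqI) (simp add: lookup_sum lookup_single when_def in_keys_iff)

lemma free_algebra_induct [case_names zero add]: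
  fixes p :: "gen free_algebra"
  assumes "P 0" "\<And>w c p. P p \<Longrightarrow> P (free_scalar c * wmon w + p)"
  shows "P p"
proof -
  have "P (\<Sum>w\<in>A. Poly_Mapping.single w (f w))" if "finite A" for A and f :: "gen word \<Rightarrow> complex"
    using that
  proof induction
    case (insert w A)
    have "Poly_Mapping.single w (f w) = free_scalar (f w) * wmon (letters w)"
      by (simp flip: single_eq_wmon)
    with insert assms(2) show ?case by simp
  qed (simp add: assms(1))
  from this[of "Poly_Mapping.keys p" "Poly_Mapping.lookup p"] show ?thesis
    by (simp add: poly_mapping_sum_single)
qed

definition wcong :: "gen list \<Rightarrow> gen list \<Rightarrow> bool" where
  "wcong v w \<longleftrightarrow> rel_cong (wmon v) (wmon w)"

text \<open>The last congruence is not among the relators. From \<open>u1 v = u1\<close> follows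
  \<open>u1 u1 v = u1 u1\<close>, so relation (1) gives \<open>2 (1 + v) v = 2 (1 + v)\<close>, and
  dividing by 2 over the complex numbers leaves \<open>v v = 1\<close>.\<close>

lemma relations:
  "rel_cong (wmon [GU1, GU1]) (2 * (1 + wmon [GV]))" "wcong [GU2, GU2] []" "wcong [GU1, GV] [GU1]"
  "wcong [GV, GU1] [GU1]" "wcong [GU2, GV, GU2] [GV, GU2, GV]" "wcong [GV, GV] []"
proof -
  let ?u1 = "free_var GU1" and ?u2 = "free_var GU2" and ?v = "free_var GV"
  have rel: "?u1 ^ 2 - 2 * (1 + ?v) \<in> rel_ideal" "?u2 ^ 2 - 1 \<in> rel_ideal" "?u1 * ?v - ?v * ?u1 \<in> rel_ideal"
    "?v * ?u1 - ?u1 \<in> rel_ideal" "?u2 * ?v * ?u2 - ?v * ?u2 * ?v \<in> rel_ideal"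
    by (rule relators_in_rel_ideal; simp add: relators_def Let_def)+
  note m = wmon_Cons wmon_Nil mult_1_right
  show 1: "rel_cong (wmon [GU1, GU1]) (2 * (1 + wmon [GV]))" "wcong [GU2, GU2] []"
    "wcong [GV, GU1] [GU1]" "wcong [GU2, GV, GU2] [GV, GU2, GV]"
    using rel unfolding wcong_def rel_cong_def m by (simp_all add: power2_eq_square mult.assoc)
  have "?u1 * ?v - ?v * ?u1 + (?v * ?u1 - ?u1) \<in> rel_ideal" using rel by (intro rel_ideal_closed)
  then show 2: "wcong [GU1, GV] [GU1]"
    unfolding wcong_def rel_cong_def m by simp
  have "rel_cong (?u1 * ?u1 * ?v) (?u1 * ?u1)"
    using rel_cong_mult[OF 2[unfolded wcong_def], of ?u1 1] unfolding m by (simp add: mult.assoc)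
  moreover have "rel_cong (2 * (1 + ?v) * ?v) (?u1 * ?u1 * ?v)"
    using rel_cong_mult[OF rel_cong_sym[OF 1(1)], of 1 ?v] unfolding m by (simp add: mult.assoc)
  ultimately have "rel_cong (2 * (1 + ?v) * ?v) (?u1 * ?u1)"
    by (rule rel_cong_trans[rotated])
  also have "rel_cong (?u1 * ?u1) (2 * (1 + ?v))"
    using 1(1) unfolding m .
  finally have "rel_cong (2 * (1 + ?v) * ?v) (2 * (1 + ?v))" .
  from rel_cong_mult[OF this, of "free_scalar (1/2)" 1]
  have "free_scalar (1/2) * (2 * (?v * ?v - 1)) \<in> rel_ideal"
    unfolding rel_cong_def by (simp only: right_diff_distrib distrib_left distrib_right
        mult_1_left mult_1_right mult.assoc) simp
  moreover have "free_scalar (1/2) * 2 = (1 :: gen free_algebra)"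
    using mult_single[of "0 :: gen word" "1/2 :: complex" 0 2] by (simp add: free_scalar_def)
  ultimately have "?v * ?v - 1 \<in> rel_ideal" by (simp only: mult.assoc[symmetric] mult_1_left)
  then show "wcong [GV, GV] []" unfolding wcong_def rel_cong_def m .
qed

section \<open>Standard words and the reduction to them\<close>

definition mid :: "nat \<Rightarrow> gen list" where
  "mid k = GU1 # concat (replicate k [GU2, GU1])"

lemma mid_Suc: "mid (Suc k) = GU1 # GU2 # mid k"
  by (simp add: mid_def)

text \<open>The first six words represent the group generated by two involutions
  \<open>u2, v\<close> with the braid relation. Since \<open>u1\<close> absorbs \<open>v\<close> on
  both sides, only cosets of that group modulo \<open>v\<close> matter next to it: \<open>s\<close>
  runs through representatives of the left cosets and \<open>t\<close> of the right cosets.\<close>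

definition std_words :: "gen list set" where
  "std_words = {[], [GV], [GU2], [GU2, GV], [GV, GU2], [GU2, GV, GU2]}
     \<union> {s @ mid k @ t | s k t. s \<in> {[], [GU2], [GV, GU2]} \<and> t \<in> {[], [GU2], [GU2, GV]}}"

definition std_span :: "gen free_algebra set" where
  "std_span = {p. \<exists>q. Poly_Mapping.keys q \<subseteq> Word ` std_words \<and> rel_cong p q}"

lemma std_span_cong: "rel_cong p q \<Longrightarrow> q \<in> std_span \<Longrightarrow> p \<in> std_span"
  unfolding std_span_def by (auto dest: rel_cong_trans)

lemma std_span_wmon: "w \<in> std_words \<Longrightarrow> wmon w \<in> std_span"
  unfolding std_span_def wmon_def by (auto intro!: exI[of _ "Poly_Mapping.single (Word w) 1"])

lemma std_span_zero: "0 \<in> std_span"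
  unfolding std_span_def by (auto intro!: exI[of _ 0])

lemma std_span_add: "p \<in> std_span \<Longrightarrow> q \<in> std_span \<Longrightarrow> p + q \<in> std_span"
  unfolding std_span_def
proof safe
  fix p' q' assume "Poly_Mapping.keys p' \<subseteq> Word ` std_words" "Poly_Mapping.keys q' \<subseteq> Word ` std_words" "rel_cong p p'" "rel_cong q q'"
  then show "\<exists>r. Poly_Mapping.keys r \<subseteq> Word ` std_words \<and> rel_cong (p + q) r"
    using Poly_Mapping.keys_add[of p' q'] by (intro exI[of _ "p' + q'"] conjI rel_cong_add) (simp_all, meson Un_least order_trans)
qed

lemma lookup_scalar_mult:
  fixes p :: "gen free_algebra"
  shows "Poly_Mapping.lookup (free_scalar c * p) w = c * Poly_Mapping.lookup p w"
proof (induction p rule: free_algebra_induct)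
  case (add v d p)
  have "free_scalar c * (free_scalar d * wmon v + p) = Poly_Mapping.single (Word v) (c * d) + free_scalar c * p"
    by (simp add: distrib_left free_scalar_def wmon_def mult_single)
  moreover have "free_scalar d * wmon v + p = Poly_Mapping.single (Word v) d + p"
    by (simp add: free_scalar_def wmon_def mult_single)
  ultimately show ?case
    using add by (simp only: lookup_add lookup_single distrib_left) (simp add: when_def)
qed simp

lemma std_span_scalar: "p \<in> std_span \<Longrightarrow> free_scalar c * p \<in> std_span"
  unfolding std_span_def
proof safe
  fix q assume "Poly_Mapping.keys q \<subseteq> Word ` std_words" "rel_cong p q"
  then show "\<exists>r. Poly_Mapping.keys r \<subseteq> Word ` std_words \<and> rel_cong (free_scalar c * p) r"
    using rel_cong_mult[of p q "free_scalar c" 1]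
    by (intro exI[of _ "free_scalar c * q"]) (auto simp: in_keys_iff lookup_scalar_mult)
qed

lemma std_span_context:
  assumes "wcong v w" "wmon (s @ w @ t) \<in> std_span" shows "wmon (s @ v @ t) \<in> std_span"
  using rel_cong_mult[OF assms(1)[unfolded wcong_def], of "wmon s" "wmon t"]
  by (intro std_span_cong[OF _ assms(2)]) (simp add: wmon_append mult.assoc)

lemma std_words_mid:
  "s \<in> {[], [GU2], [GV, GU2]} \<Longrightarrow> t \<in> {[], [GU2], [GU2, GV]} \<Longrightarrow> s @ mid k @ t \<in> std_words"
  unfolding std_words_def by (intro UnI2 CollectI exI[of _ s] exI[of _ k] exI[of _ t] conjI refl)

lemma std_words_cases:
  assumes "w \<in> std_words"
  obtains (finite) "w \<in> {[], [GV], [GU2], [GU2, GV], [GV, GU2], [GU2, GV, GU2]}"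
    | (mid) s k t where "w = s @ mid k @ t" "s \<in> {[], [GU2], [GV, GU2]}" "t \<in> {[], [GU2], [GU2, GV]}"
proof -
  from assms consider "w \<in> {[], [GV], [GU2], [GU2, GV], [GV, GU2], [GU2, GV, GU2]}"
    | "w \<in> {s @ mid k @ t | s k t. s \<in> {[], [GU2], [GV, GU2]} \<and> t \<in> {[], [GU2], [GU2, GV]}}"
    unfolding std_words_def by (rule UnE)
  then show thesis
  proof cases
    case 2
    then show thesis by (elim CollectE exE conjE) (rule mid)
  qed (rule finite)
qed

text \<open>The six words are closed under left multiplication by \<open>v\<close>, as for a group.
  In front of \<open>u1\<close>, the letter \<open>v\<close> disappears for \<open>s = []\<close>
  and exchanges the other two prefixes.\<close>

lemma std_span_V:
  assumes "w \<in> std_words" shows "wmon (GV # w) \<in> std_span"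
  using assms
proof (cases rule: std_words_cases)
  case finite
  have "wmon ([] @ [GV, GV] @ t) \<in> std_span" if "wmon ([] @ [] @ t) \<in> std_span" for t
    using std_span_context[OF relations(6) that] .
  moreover have "wmon ([] @ [GV, GU2, GV] @ []) \<in> std_span"
    by (rule std_span_cong[OF _ std_span_wmon[of "[GU2, GV, GU2]"]])
      (use relations(5) rel_cong_sym in \<open>auto simp: wcong_def std_words_def\<close>)
  \<comment> \<open>The longest word absorbs the new letter:
    \<open>v u2 v u2 = u2 v u2 u2 = u2 v\<close>.\<close>
  moreover have "wmon ([] @ [GV, GU2, GV] @ [GU2]) \<in> std_span"
    by (rule std_span_cong[of _ "wmon ([GU2, GV] @ [GU2, GU2] @ [])"])
      (use rel_cong_mult[OF rel_cong_sym[OF relations(5)[unfolded wcong_def]], of 1 "wmon [GU2]"]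
        std_span_context[OF relations(2), of "[GU2, GV]" "[]"] std_span_wmon[of "[GU2, GV]"]
       in \<open>auto simp: std_words_def simp flip: wmon_append\<close>)
  ultimately show ?thesis using finite std_span_wmon by (auto simp: std_words_def)
next
  case (mid s k t)
  consider "s = []" | "s = [GU2]" | "s = [GV, GU2]" using mid(2) by blast
  then show ?thesis
  proof cases
    case 1
    have "wmon ([] @ [GU1] @ (concat (replicate k [GU2, GU1]) @ t)) \<in> std_span"
      using std_span_wmon[OF std_words_mid[of "[]" t k]] mid(3) by (simp add: mid_def)
    from std_span_context[OF relations(4) this] show ?thesis by (simp add: mid(1) 1 mid_def)
  next
    case 2
    then show ?thesis using std_span_wmon[OF std_words_mid[of "[GV, GU2]" t k]] mid by simp
  next
    case 3
    have "wmon ([] @ [] @ ([GU2] @ mid k @ t)) \<in> std_span"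
      using std_span_wmon[OF std_words_mid[of "[GU2]" t k]] mid(3) by simp
    from std_span_context[OF relations(6) this] show ?thesis by (simp add: mid(1) 3)
  qed
qed

text \<open>The prefix that falls outside the list is \<open>u2 v u2\<close> in front of
  \<open>u1\<close>; the braid relation and absorption of \<open>v\<close> give
  \<open>u2 v u2 u1 = v u2 v u1 = v u2 u1\<close>.\<close>

lemma std_span_U2:
  assumes "w \<in> std_words" shows "wmon (GU2 # w) \<in> std_span"
  using assms
proof (cases rule: std_words_cases)
  case finite
  have "wmon ([] @ [GU2, GU2] @ t) \<in> std_span" if "wmon ([] @ [] @ t) \<in> std_span" for t
    using std_span_context[OF relations(2) that] .
  then show ?thesis using finite std_span_wmon by (auto simp: std_words_def)
next
  case (mid s k t)
  consider "s = []" | "s = [GU2]" | "s = [GV, GU2]" using mid(2) by blast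
  then show ?thesis
  proof cases
    case 1
    then show ?thesis using std_span_wmon[OF std_words_mid[of "[GU2]" t k]] mid by simp
  next
    case 2
    have "wmon ([] @ [] @ (mid k @ t)) \<in> std_span"
      using std_span_wmon[OF std_words_mid[of "[]" t k]] mid(3) by simp
    from std_span_context[OF relations(2) this] show ?thesis by (simp add: mid(1) 2)
  next
    case 3
    have "wmon ([GV, GU2] @ [GU1] @ (concat (replicate k [GU2, GU1]) @ t)) \<in> std_span"
      using std_span_wmon[OF std_words_mid[of "[GV, GU2]" t k]] mid(3) by (simp add: mid_def)
    from std_span_context[OF relations(4) this]
    have "wmon ([] @ [GV, GU2, GV] @ (mid k @ t)) \<in> std_span" by (simp add: mid_def)
    from std_span_context[OF relations(5) this] show ?thesis by (simp add: mid(1) 3)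
  qed
qed

text \<open>For prefixes containing \<open>u2\<close> the middle part grows by one step, after
  \<open>u1\<close> has absorbed a leading \<open>v\<close>. Two adjacent letters \<open>u1\<close>
  call for the quadratic relation: the rest \<open>?r\<close> is again a standard word, and the
  second term \<open>v ?r\<close> is handled by \<open>std_span_V\<close>.\<close>

lemma std_span_U1:
  assumes "w \<in> std_words" shows "wmon (GU1 # w) \<in> std_span"
  using assms
proof (cases rule: std_words_cases)
  case finite
  have m: "wmon (GU1 # t) \<in> std_span" if "t \<in> {[], [GU2], [GU2, GV]}" for t
    using std_span_wmon[OF std_words_mid[of "[]" t 0]] that by (simp add: mid_def)
  have V: "wmon ([] @ [GU1, GV] @ t) \<in> std_span" if "wmon ([] @ [GU1] @ t) \<in> std_span" for t
    using std_span_context[OF relations(3) that] .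
  have "wmon ([GU1] @ [GU2, GV, GU2] @ []) \<in> std_span"
    using V[of "[GU2, GV]"] m by (intro std_span_context[OF relations(5)]) simp
  then show ?thesis using finite m V[of "[]"] V[of "[GU2]"] by auto
next
  case (mid s k t)
  consider "s = []" | "s = [GU2]" | "s = [GV, GU2]" using mid(2) by blast
  then show ?thesis
  proof cases
    case 1
    let ?r = "concat (replicate k [GU2, GU1]) @ t"
    have r: "?r \<in> std_words"
    proof (cases k)
      case 0
      then show ?thesis using mid(3) by (auto simp: std_words_def)
    next
      case (Suc j)
      then show ?thesis using std_words_mid[of "[GU2]" t j] mid(3) by (simp add: mid_def)
    qed
    have "rel_cong (wmon [GU1, GU1] * wmon ?r) (2 * (1 + wmon [GV]) * wmon ?r)"
      using rel_cong_mult[OF relations(1), of 1 "wmon ?r"] by simp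
    also have "wmon [GU1, GU1] * wmon ?r = wmon (GU1 # w)"
      by (simp add: mid(1) 1 mid_def flip: wmon_append)
    also have "2 * (1 + wmon [GV]) * wmon ?r = free_scalar 2 * (wmon ?r + wmon (GV # ?r))"
      by (simp add: wmon_Cons wmon_Nil free_scalar_def single_numeral distrib_right mult.assoc)
    finally show ?thesis
      by (rule std_span_cong) (intro std_span_scalar std_span_add std_span_wmon std_span_V r)
  next
    case 2
    then show ?thesis using std_span_wmon[OF std_words_mid[of "[]" t "Suc k"]] mid by (simp add: mid_Suc)
  next
    case 3
    have "wmon ([] @ [GU1] @ ([GU2] @ mid k @ t)) \<in> std_span"
      using std_span_wmon[OF std_words_mid[of "[]" t "Suc k"]] mid by (simp add: mid_Suc)
    from std_span_context[OF relations(3) this] show ?thesis by (simp add: mid(1) 3)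
  qed
qed

lemma std_span_free_var:
  assumes "p \<in> std_span" shows "free_var a * p \<in> std_span"
proof -
  obtain q where q: "Poly_Mapping.keys q \<subseteq> Word ` std_words" "rel_cong p q" using assms unfolding std_span_def by blast
  have "free_var a * Poly_Mapping.single w c \<in> std_span" if w: "w \<in> Word ` std_words" for w c
  proof -
    obtain v where v: "w = Word v" "v \<in> std_words" using w by (elim imageE)
    have "free_var a * Poly_Mapping.single w c = free_scalar c * wmon (a # v)"
      unfolding v wmon_Cons by (simp add: free_var_def free_scalar_def wmon_def mult_single)
    moreover have "wmon (a # v) \<in> std_span"
      using std_span_U1 std_span_U2 std_span_V v(2) by (cases a) auto
    ultimately show ?thesis using std_span_scalar by simp
  qed
  note single = this
  have "(\<Sum>w\<in>A. free_var a * Poly_Mapping.single w (Poly_Mapping.lookup q w)) \<in> std_span"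
    if "finite A" "A \<subseteq> Poly_Mapping.keys q" for A
    using that by (induction A) (use q(1) in \<open>auto intro!: std_span_zero std_span_add single\<close>)
  from this[of "Poly_Mapping.keys q"] have "free_var a * q \<in> std_span"
    by (simp add: poly_mapping_sum_single flip: sum_distrib_left)
  then show ?thesis using std_span_cong rel_cong_mult[OF q(2), of "free_var a" 1] by simp
qed

lemma std_span_UNIV: "p \<in> std_span"
proof (induction p rule: free_algebra_induct)
  case (add w c p)
  have "wmon w \<in> std_span"
  proof (induction w)
    case Nil
    then show ?case using std_span_wmon[of "[]"] by (simp add: std_words_def)
  qed (simp add: wmon_Cons std_span_free_var)
  then show ?case using add by (intro std_span_add std_span_scalar)
qed (rule std_span_zero)

section \<open>Evaluation of words\<close>

fun gen_mat :: "gen \<Rightarrow> q2mat" where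
  "gen_mat GU1 = w1" | "gen_mat GU2 = w2" | "gen_mat GV = y2"

definition word_mat :: "gen list \<Rightarrow> q2mat" where
  "word_mat w = foldr (\<lambda>a. (**) (gen_mat a)) w (mat 1)"

lemma word_mat_simps [simp]: "word_mat [] = mat 1" "word_mat (a # w) = gen_mat a ** word_mat w"
  by (simp_all add: word_mat_def)

lemma word_mat_append: "word_mat (v @ w) = word_mat v ** word_mat w"
  by (induction v) (simp_all add: matrix_mul_assoc)

lemma gen_mat_GL2 [simp]: "gen_mat a \<in> GL2"
  by (cases a) simp_all

lemma word_mat_GL2 [simp]: "word_mat w \<in> GL2"
  by (induction w) simp_all

lemma word_mat_normalizer: "set w \<subseteq> {GU2, GV} \<Longrightarrow> word_mat w \<in> normalizer"
proof (induction w)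
  case (Cons a w)
  then have "gen_mat a \<in> normalizer" using normalizer_w2 normalizer_y2 by auto
  then show ?case using Cons by (simp add: normalizer_mult)
qed (simp add: normalizer_K)

text \<open>\<open>GU1\<close> gets a default value: the two other generators act on parities by
  bijections, whereas the effect of \<open>w1\<close> depends on the shape.\<close>

fun act_left :: "gen \<Rightarrow> parities \<Rightarrow> parities" where
  "act_left GU2 A = left_U2 A" | "act_left GV A = left_V A" | "act_left GU1 A = A"
fun act_right :: "gen \<Rightarrow> parities \<Rightarrow> parities" where
  "act_right GU2 A = right_U2 A" | "act_right GV A = right_V A" | "act_right GU1 A = A"

lemma shape_y2: "shape m e A g \<Longrightarrow> shape m e (left_V A) (y2 ** g)" "shape m e A g \<Longrightarrow> shape m e (right_V A) (g ** y2)"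
  using shape_y_left[of m e A g 1] shape_y_right[of m e A g 1] by (simp_all add: emb_simps)

lemma shape_gen_left:
  assumes "shape m e A g" "a \<in> {GU2, GV}" shows "\<exists>m. shape m e (act_left a A) (gen_mat a ** g)"
  using assms(2) shape_w2_left[OF assms(1)] shape_y2(1)[OF assms(1)] by auto

lemma shape_gen_right:
  assumes "shape m e A g" "a \<in> {GU2, GV}" shows "\<exists>m. shape m e (act_right a A) (g ** gen_mat a)"
  using assms(2) shape_w2_right[OF assms(1)] shape_y2(2)[OF assms(1)] by auto

lemma shape_word_left:
  assumes "shape m e A g" "set w \<subseteq> {GU2, GV}"
  shows "\<exists>m. shape m e (foldr act_left w A) (word_mat w ** g)"
  using assms(2)
proof (induction w)
  case Nil
  show ?case using assms(1) by auto
next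
  case (Cons a w)
  then obtain m' where "shape m' e (foldr act_left w A) (word_mat w ** g)" by auto
  then show ?case using shape_gen_left[of m' e _ _ a] Cons.prems by (simp flip: matrix_mul_assoc)
qed

lemma shape_word_right:
  assumes "shape m e A g" "set w \<subseteq> {GU2, GV}"
  shows "\<exists>m. shape m e (fold act_right w A) (g ** word_mat w)"
  using assms
proof (induction w arbitrary: m A g)
  case (Cons a w)
  then obtain m' where "shape m' e (act_right a A) (g ** gen_mat a)"
    using shape_gen_right[OF Cons.prems(1), of a] Cons.prems(2) by auto
  then show ?case using Cons by (simp add: matrix_mul_assoc)
qed auto

text \<open>Each further \<open>u2\<close> moves the odd entry of \<open>E21\<close> to the upper
  row and contributes one factor 2 to \<open>m\<close>. The upper row is then nonzero modulo 2, so
  the following \<open>u1\<close> raises \<open>e\<close> by one and returns to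
  \<open>E21\<close>.\<close>

lemma shape_mid: "shape (int k) (Suc k) E21 (word_mat (mid k))"
proof (induction k)
  case 0
  show ?case using shape_w1_left[OF shape_one] by (simp add: mid_def)
next
  case (Suc k)
  show ?case
    using shape_w1_left[of "int k + 1" "Suc k" True False False False] shape_w2_left[OF Suc]
    by (simp add: mid_Suc add.commute)
qed

lemma shape_std_finite:
  assumes "w \<in> {[], [GV], [GU2], [GU2, GV], [GV, GU2], [GU2, GV, GU2]}"
  shows "\<exists>m. shape m 0 (foldr act_left w (True, False, False, True)) (word_mat w)"
proof -
  have "set w \<subseteq> {GU2, GV}" using assms by auto
  from shape_word_left[OF shape_one this] show ?thesis by simp
qed

lemma shape_std_mid:
  assumes "s \<in> {[], [GU2], [GV, GU2]}" "t \<in> {[], [GU2], [GU2, GV]}"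
  shows "\<exists>m. shape m (Suc k) (foldr act_left s (fold act_right t E21)) (word_mat (s @ mid k @ t))"
proof -
  have s: "set s \<subseteq> {GU2, GV}" and t: "set t \<subseteq> {GU2, GV}" using assms by auto
  obtain m where "shape m (Suc k) (fold act_right t E21) (word_mat (mid k) ** word_mat t)"
    using shape_word_right[OF shape_mid t] by blast
  from shape_word_left[OF this s] show ?thesis by (simp add: word_mat_append)
qed

text \<open>The exponents \<open>m\<close> and \<open>m'\<close> may differ, so words are separated
  even modulo powers of \<open>Z\<close>. The value of \<open>e\<close> is 0 for the six words and
  \<open>k + 1\<close> for the others, which fixes \<open>k\<close>; the parities are then six
  distinct invertible matrices or nine distinct matrices of rank one.\<close>

lemma std_words_shape_inj:
  assumes "v \<in> std_words" "w \<in> std_words" "shape m e A (word_mat v)" "shape m' e A (word_mat w)"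
  shows "v = w"
  using assms(1)
proof (cases rule: std_words_cases)
  case v: finite
  obtain n where n: "shape n 0 (foldr act_left v (True, False, False, True)) (word_mat v)"
    using shape_std_finite[OF v] by blast
  from shape_unique[OF assms(3) n] have e: "e = 0" and A: "A = foldr act_left v (True, False, False, True)" by auto
  from assms(2) show ?thesis
  proof (cases rule: std_words_cases)
    case w: finite
    obtain l where l: "shape l 0 (foldr act_left w (True, False, False, True)) (word_mat w)"
      using shape_std_finite[OF w] by blast
    from shape_unique[OF assms(4) l] A
    have "foldr act_left v (True, False, False, True) = foldr act_left w (True, False, False, True)" by simp
    then show ?thesis using v w by (elim insertE) auto
  next
    case w: (mid s k t)
    obtain l where "shape l (Suc k) (foldr act_left s (fold act_right t E21)) (word_mat w)"
      using shape_std_mid[OF w(2,3)] unfolding w(1) by blast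
    from shape_unique[OF assms(4) this] e show ?thesis by simp
  qed
next
  case v: (mid s k t)
  obtain n where n: "shape n (Suc k) (foldr act_left s (fold act_right t E21)) (word_mat v)"
    using shape_std_mid[OF v(2,3)] unfolding v(1) by blast
  from shape_unique[OF assms(3) n] have e: "e = Suc k" and A: "A = foldr act_left s (fold act_right t E21)" by auto
  from assms(2) show ?thesis
  proof (cases rule: std_words_cases)
    case w: finite
    obtain l where l: "shape l 0 (foldr act_left w (True, False, False, True)) (word_mat w)"
      using shape_std_finite[OF w] by blast
    from shape_unique[OF assms(4) l] e show ?thesis by simp
  next
    case w: (mid s' k' t')
    obtain l where "shape l (Suc k') (foldr act_left s' (fold act_right t' E21)) (word_mat w)"
      using shape_std_mid[OF w(2,3)] unfolding w(1) by blast
    from shape_unique[OF assms(4) this] e A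
    have "k = k'" "foldr act_left s (fold act_right t E21) = foldr act_left s' (fold act_right t' E21)" by simp_all
    moreover from this(2) have "s = s' \<and> t = t'" using v(2,3) w(2,3)
      by (elim insertE emptyE) simp_all
    ultimately show ?thesis unfolding v(1) w(1) by simp
  qed
qed

context hecke
begin

fun gen_fun :: "gen \<Rightarrow> q2mat \<Rightarrow> complex" where
  "gen_fun GU1 = hecke_U 1" | "gen_fun GU2 = hecke_U 2" | "gen_fun GV = hecke_V"

lemma gen_fun_eq: "gen_fun a = char_fun K (gen_mat a)"
  by (cases a) (simp_all only: gen_fun.simps gen_mat.simps hecke_eqs)

primrec eval_word :: "gen list \<Rightarrow> q2mat \<Rightarrow> complex" where
  "eval_word [] = char_fun K (mat 1)"
| "eval_word (a # w) = convolution \<mu> (gen_fun a) (eval_word w)"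

lemma gen_fun_hecke [simp]: "gen_fun a \<in> hecke_carrier K"
  unfolding gen_fun_eq by simp

lemma eval_word_hecke [simp]: "eval_word w \<in> hecke_carrier K"
  by (induction w) simp_all

lemma eval_word_append: "eval_word (v @ w) = convolution \<mu> (eval_word v) (eval_word w)"
  by (induction v) (simp_all add: convolution_one convolution_assoc)

lemma eval_word_normalizer: "set w \<subseteq> {GU2, GV} \<Longrightarrow> eval_word w = char_fun K (word_mat w)"
proof (induction w)
  case (Cons a w)
  then have "gen_mat a \<in> normalizer" using normalizer_w2 normalizer_y2 by auto
  then show ?case using Cons by (simp add: gen_fun_eq char_fun_normalizer_left)
qed simp

text \<open>The hypothesis of \<open>convolution_char_fun\<close> holds because an element of
  \<open>K\<close> inserted after the new \<open>w1\<close> does not change the shape of the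
  product, and a shape with parities \<open>E21\<close> belongs to a single double coset. The
  multiplicities of the steps multiply.\<close>

lemma eval_word_mid: "\<exists>N>0. eval_word (mid k) = (\<lambda>x. of_nat N * char_fun K (word_mat (mid k)) x)"
proof (induction k)
  case 0
  have "eval_word (mid 0) = char_fun K w1"
    by (simp add: mid_def convolution_one gen_fun_eq del: gen_fun.simps)
  then show ?case by (intro exI[of _ 1]) (simp add: mid_def)
next
  case (Suc k)
  let ?g = "word_mat (mid k)"
  obtain N where N: "N > 0" "eval_word (mid k) = (\<lambda>x. of_nat N * char_fun K ?g x)" using Suc by blast
  have sh: "shape (int k + 1) (Suc k) (True, False, False, False) (w2 ** ?g)"
    using shape_w2_left[OF shape_mid[of k]] by simp
  have mem: "w1 ** l ** (w2 ** ?g) \<in> double_coset K (w1 ** (w2 ** ?g))" if "l \<in> K" for l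
  proof -
    have "shape (int k + 1) (Suc (Suc k)) E21 (w1 ** (w2 ** ?g))"
      "shape (int k + 1) (Suc (Suc k)) E21 (w1 ** (l ** (w2 ** ?g)))"
      using shape_w1_left[OF sh] shape_w1_left[OF shape_K_left[OF sh that]] by simp_all
    then show ?thesis using E21_double_coset by (simp add: matrix_mul_assoc)
  qed
  obtain M where M: "M > 0" "convolution \<mu> (char_fun K w1) (char_fun K (w2 ** ?g))
      = (\<lambda>x. of_nat M * char_fun K (w1 ** (w2 ** ?g)) x)"
    by (rule convolution_char_fun[OF _ _ mem]) auto
  have "eval_word (mid (Suc k))
      = convolution \<mu> (char_fun K w1) (convolution \<mu> (char_fun K w2) (\<lambda>x. of_nat N * char_fun K ?g x))"
    by (simp add: mid_Suc gen_fun_eq N(2))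
  also have "\<dots> = (\<lambda>x. of_nat (N * M) * char_fun K (word_mat (mid (Suc k))) x)"
    by (simp add: convolution_smult char_fun_normalizer_left normalizer_w2 M(2) mid_Suc mult.assoc)
  finally show ?case using N(1) M(1) by (intro exI[of _ "N * M"]) auto
qed

lemma eval_word_std:
  assumes "w \<in> std_words"
  shows "\<exists>N>0. eval_word w = (\<lambda>x. of_nat N * char_fun K (word_mat w) x)"
  using assms
proof (cases rule: std_words_cases)
  case finite
  then have "set w \<subseteq> {GU2, GV}" by auto
  from eval_word_normalizer[OF this] show ?thesis by (intro exI[of _ 1]) simp
next
  case (mid s k t)
  have s: "set s \<subseteq> {GU2, GV}" and t: "set t \<subseteq> {GU2, GV}" using mid(2,3) by auto
  obtain N where N: "N > 0" "eval_word (mid k) = (\<lambda>x. of_nat N * char_fun K (word_mat (mid k)) x)"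
    using eval_word_mid by blast
  have "eval_word w = (\<lambda>x. of_nat N * char_fun K (word_mat w) x)"
    unfolding mid(1) eval_word_append eval_word_normalizer[OF s] eval_word_normalizer[OF t] N(2)
    by (simp add: convolution_smult char_fun_normalizer_left char_fun_normalizer_right word_mat_normalizer s t word_mat_append)
  then show ?thesis using N(1) by blast
qed

section \<open>The evaluation homomorphism on the free algebra\<close>

definition hecke_eval :: "gen free_algebra \<Rightarrow> q2mat \<Rightarrow> complex" where
  "hecke_eval p = (\<lambda>x. \<Sum>w\<in>Poly_Mapping.keys p. Poly_Mapping.lookup p w * eval_word (letters w) x)"

lemma hecke_eval_superset:
  assumes "finite A" "Poly_Mapping.keys p \<subseteq> A"
  shows "hecke_eval p x = (\<Sum>w\<in>A. Poly_Mapping.lookup p w * eval_word (letters w) x)"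
  unfolding hecke_eval_def using assms by (intro sum.mono_neutral_left) (auto simp: in_keys_iff)

lemma hecke_eval_add: "hecke_eval (p + q) = (\<lambda>x. hecke_eval p x + hecke_eval q x)"
proof
  fix x
  let ?A = "Poly_Mapping.keys p \<union> Poly_Mapping.keys q"
  have "hecke_eval r x = (\<Sum>w\<in>?A. Poly_Mapping.lookup r w * eval_word (letters w) x)" if "r \<in> {p, q, p + q}" for r
    using that Poly_Mapping.keys_add[of p q] by (intro hecke_eval_superset) auto
  then show "hecke_eval (p + q) x = hecke_eval p x + hecke_eval q x"
    by (simp add: lookup_add distrib_right sum.distrib)
qed

lemma hecke_eval_zero: "hecke_eval 0 = (\<lambda>x. 0)"
  by (simp add: hecke_eval_def)

lemma hecke_eval_single: "hecke_eval (Poly_Mapping.single w c) = (\<lambda>x. c * eval_word (letters w) x)"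
  by (cases "c = 0") (simp_all add: hecke_eval_def)

lemma hecke_eval_scalar_wmon: "hecke_eval (free_scalar c * wmon w) = (\<lambda>x. c * eval_word w x)"
  by (simp add: hecke_eval_single flip: single_eq_wmon)

lemma hecke_eval_hecke [simp]: "hecke_eval p \<in> hecke_carrier K"
  by (induction p rule: free_algebra_induct) (simp_all add: hecke_eval_zero hecke_eval_add hecke_eval_scalar_wmon)

lemma hecke_eval_mult: "hecke_eval (p * q) = convolution \<mu> (hecke_eval p) (hecke_eval q)"
proof (induction p rule: free_algebra_induct)
  case zero
  show ?case by (simp add: hecke_eval_zero convolution_def fun_eq_iff)
next
  case (add w c p)
  have "hecke_eval (free_scalar c * wmon w * q) = convolution \<mu> (hecke_eval (free_scalar c * wmon w)) (hecke_eval q)" for q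
  proof (induction q rule: free_algebra_induct)
    case zero
    show ?case by (simp add: hecke_eval_zero convolution_def fun_eq_iff)
  next
    case (add v d q)
    have "free_scalar c * wmon w * (free_scalar d * wmon v) = free_scalar (c * d) * wmon (w @ v)"
      by (simp add: free_scalar_def wmon_def mult_single plus_word_def zero_word_def)
    then show ?case using add
      by (simp add: distrib_left hecke_eval_add hecke_eval_scalar_wmon convolution_add_right convolution_smult eval_word_append mult.assoc)
  qed
  then show ?case using add by (simp add: distrib_right hecke_eval_add convolution_add_left)
qed

lemma hecke_eval_scalar: "hecke_eval (free_scalar c) = (\<lambda>x. c * char_fun K (mat 1) x)"
  using hecke_eval_scalar_wmon[of c "[]"] by (simp add: wmon_Nil)

lemma hecke_eval_var: "hecke_eval (free_var a) = gen_fun a"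
  by (simp add: free_var_def hecke_eval_single convolution_one)

lemma hecke_eval_one: "hecke_eval 1 = char_fun K (mat 1)"
  using hecke_eval_scalar[of 1] by (simp add: free_scalar_def)

lemma hecke_eval_uminus: "hecke_eval (- p) = (\<lambda>x. - hecke_eval p x)"
  using hecke_eval_add[of p "- p"] by (simp add: hecke_eval_zero fun_eq_iff add_eq_0_iff)

lemma hecke_eval_diff: "hecke_eval (p - q) = (\<lambda>x. hecke_eval p x - hecke_eval q x)"
  using hecke_eval_add[of p "- q"] by (simp add: hecke_eval_uminus)

lemma hecke_eval_relators: assumes "r \<in> relators" shows "hecke_eval r \<in> Z_multiples"
proof -
  let ?one = "char_fun K (mat 1)"
  let ?u1 = "free_var GU1" and ?u2 = "free_var GU2" and ?v = "free_var GV"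
  have one: "?one \<in> hecke_carrier K" by simp
  have Z: "convolution \<mu> hecke_Z ?one = hecke_Z" by (simp add: convolution_one)
  \<comment> \<open>In the Hecke algebra the square of \<open>U1\<close> is
    \<open>2 Z (1 + V)\<close>, so the relator evaluates to
    \<open>2 (Z - 1) (1 + V)\<close>.\<close>
  have "(\<lambda>x. (- 2) * ((?one x - convolution \<mu> hecke_Z ?one x) + (hecke_V x - convolution \<mu> hecke_Z hecke_V x))) \<in> Z_multiples"
    by (intro Z_multiples_smult Z_multiples_add Z_multiples_I one hecke_gens)
  moreover have "hecke_eval 2 = (\<lambda>x. 2 * ?one x)"
    using hecke_eval_scalar[of 2] by (simp add: free_scalar_def single_numeral)
  then have "hecke_eval (?u1 ^ 2 - 2 * (1 + ?v))
      = (\<lambda>x. (- 2) * ((?one x - convolution \<mu> hecke_Z ?one x) + (hecke_V x - convolution \<mu> hecke_Z hecke_V x)))"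
    unfolding Z power2_eq_square hecke_eval_diff hecke_eval_mult hecke_eval_add hecke_eval_var hecke_eval_one gen_fun.simps U1_U1
    by (simp add: convolution_smult convolution_one algebra_simps)
  ultimately have 1: "hecke_eval (?u1 ^ 2 - 2 * (1 + ?v)) \<in> Z_multiples" by simp
  \<comment> \<open>The square of \<open>U2\<close> is \<open>Z Z\<close>, and
    \<open>1 - Z Z\<close> telescopes as \<open>(1 - Z) + (Z - Z Z)\<close>.\<close>
  have "(\<lambda>x. (- 1) * ((?one x - convolution \<mu> hecke_Z ?one x) + (hecke_Z x - convolution \<mu> hecke_Z hecke_Z x))) \<in> Z_multiples"
    by (intro Z_multiples_smult Z_multiples_add Z_multiples_I one hecke_gens)
  then have 2: "hecke_eval (?u2 ^ 2 - 1) \<in> Z_multiples"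
    unfolding Z power2_eq_square hecke_eval_diff hecke_eval_mult hecke_eval_var hecke_eval_one gen_fun.simps U2_U2 by simp
  have 3: "hecke_eval (?u1 * ?v - ?v * ?u1) \<in> Z_multiples" "hecke_eval (?v * ?u1 - ?u1) \<in> Z_multiples"
    unfolding hecke_eval_diff hecke_eval_mult hecke_eval_var gen_fun.simps U1_V V_U1 by (simp_all add: Z_multiples_zero)
  let ?w = "convolution \<mu> (convolution \<mu> hecke_V (hecke_U 2)) hecke_V"
  have "(\<lambda>x. (- 1) * (?w x - convolution \<mu> hecke_Z ?w x)) \<in> Z_multiples"
    by (intro Z_multiples_smult Z_multiples_I convolution_hecke hecke_gens)
  then have 4: "hecke_eval (?u2 * ?v * ?u2 - ?v * ?u2 * ?v) \<in> Z_multiples"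
    unfolding hecke_eval_diff hecke_eval_mult hecke_eval_var gen_fun.simps U2_V_U2 by simp
  show ?thesis using assms 1 2 3 4 unfolding relators_def Let_def by blast
qed

lemma hecke_eval_rel_ideal: assumes "p \<in> rel_ideal" shows "hecke_eval p \<in> Z_multiples"
proof -
  interpret F: ring free_alg by (rule ring_free_alg)
  have "ideal {p. hecke_eval p \<in> Z_multiples} free_alg"
  proof (rule idealI[OF ring_free_alg])
    show "subgroup {p. hecke_eval p \<in> Z_multiples} (add_monoid free_alg)"
    proof (rule F.add.subgroupI)
      fix p assume p: "p \<in> {p. hecke_eval p \<in> Z_multiples}"
      have "\<ominus>\<^bsub>free_alg\<^esub> p = - p" by (rule F.minus_equality) (simp_all add: free_alg_simps)
      then show "\<ominus>\<^bsub>free_alg\<^esub> p \<in> {p. hecke_eval p \<in> Z_multiples}" using p Z_multiples_smult[of "hecke_eval p" "- 1"] by (simp add: hecke_eval_uminus)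
    qed (auto simp: free_alg_simps hecke_eval_add Z_multiples_add intro!: exI[of _ 0] simp: hecke_eval_zero Z_multiples_zero)
  qed (auto simp: free_alg_simps hecke_eval_mult Z_multiples_left Z_multiples_right)
  moreover have "relators \<subseteq> {p. hecke_eval p \<in> Z_multiples}" using hecke_eval_relators by blast
  ultimately have "rel_ideal \<subseteq> {p. hecke_eval p \<in> Z_multiples}" unfolding rel_ideal_def by (rule F.genideal_minimal)
  then show ?thesis using assms by blast
qed

end

section \<open>Bijectivity\<close>

context hecke
begin

lemma shape_of_double_coset:
  assumes "shape m e A x" "x \<in> double_coset K g" "g \<in> GL2" shows "shape m e A g"
proof -
  obtain m' e' A' where s: "shape m' e' A' g" using shape_exists[OF assms(3)] by blast
  from shape_unique[OF assms(1) shape_double_coset[OF s assms(2)]] s show ?thesis by simp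
qed

text \<open>Along the orbit the exponent \<open>m + j\<close> takes every value once, while on one
  coset it is constant. Each of the finitely many cosets covering the support therefore meets the
  orbit at most once.\<close>

lemma finite_central_translates:
  assumes "f \<in> hecke_carrier K" "shape m e A g"
  shows "finite {j. f (z_mat (2 powi j) ** g) \<noteq> 0}"
proof -
  obtain S where S: "finite S" "S \<subseteq> GL2" "\<And>x. f x \<noteq> 0 \<Longrightarrow> \<exists>s\<in>S. x \<in> coset s"
    using hecke_cover[OF assms(1)] by blast
  have "finite {j. z_mat (2 powi j) ** g \<in> coset s}" if "s \<in> S" for s
  proof -
    have "s \<in> GL2" using S(2) that by blast
    then obtain n e' A' where s: "shape n e' A' s" using shape_exists by blast
    have "{j. z_mat (2 powi j) ** g \<in> coset s} \<subseteq> {n - m}"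
    proof safe
      fix j assume "z_mat (2 powi j) ** g \<in> coset s"
      then obtain k where "k \<in> K" "z_mat (2 powi j) ** g = s ** k" unfolding coset_def by (elim imageE)
      then have "shape n e' A' (z_mat (2 powi j) ** g)" by (simp only: shape_K_right[OF s])
      from shape_unique[OF this shape_z_mat[OF assms(2)]] show "j = n - m" by simp
    qed
    then show ?thesis by (rule finite_subset) simp
  qed
  then have "finite (\<Union>s\<in>S. {j. z_mat (2 powi j) ** g \<in> coset s})" using S(1) by blast
  then show ?thesis by (rule rev_finite_subset) (use S(3) in blast)
qed

text \<open>Everything is restricted to the orbit \<open>x j\<close> of one word \<open>v\<close>
  occurring in \<open>q\<close>. There the values of \<open>hecke_eval q\<close> are the increments
  of the sequence \<open>f (x j)\<close>. Distinct standard words have disjoint orbits of double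
  cosets, so the increment can be nonzero at \<open>j = 0\<close> only; but a finitely supported
  sequence with one possible jump is zero.\<close>

lemma hecke_eval_std_independent:
  assumes "Poly_Mapping.keys q \<subseteq> Word ` std_words" "hecke_eval q \<in> Z_multiples"
  shows "q = 0"
proof (rule ccontr)
  assume "q \<noteq> 0"
  then obtain v where v: "v \<in> std_words" "Word v \<in> Poly_Mapping.keys q"
    using assms(1) by (metis equals0I imageE keys_eq_empty subsetD)
  obtain f where f: "f \<in> hecke_carrier K" "hecke_eval q = (\<lambda>x. f x - convolution \<mu> hecke_Z f x)"
    using assms(2) unfolding Z_multiples_def by blast
  define x where "x j = z_mat (2 powi j) ** word_mat v" for j
  obtain m e A where g: "shape m e A (word_mat v)" using shape_exists[OF word_mat_GL2] by blast
  have sx: "shape (m + j) e A (x j)" for j unfolding x_def by (rule shape_z_mat[OF g])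
  have zx: "z_mat (1 / 2) ** x j = x (j - 1)" for j
    unfolding x_def by (simp add: z_mat_mult_assoc power_int_diff)
  have rec: "f (x j) = f (x (j - 1)) + hecke_eval q (x j)" for j
    unfolding f(2) hecke_Z_left[OF f(1)] zx by simp
  have ev: "eval_word u (x j) = 0" if u: "u \<in> std_words" and ne: "u \<noteq> v \<or> j \<noteq> 0" for u j
  proof (rule ccontr)
    assume nz: "eval_word u (x j) \<noteq> 0"
    obtain N where N: "eval_word u = (\<lambda>x. of_nat N * char_fun K (word_mat u) x)" using eval_word_std[OF u] by blast
    have "x j \<in> double_coset K (word_mat u)" using nz unfolding N char_fun_def by (auto simp: indicator_def)
    from shape_of_double_coset[OF sx this] have su: "shape (m + j) e A (word_mat u)" by simp
    have "u = v" by (rule std_words_shape_inj[OF u v(1) su g])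
    with su shape_unique[OF g] have "j = 0" by fastforce
    with ne \<open>u = v\<close> show False by simp
  qed
  have "hecke_eval q (x j) = 0" if "j \<noteq> 0" for j
    unfolding hecke_eval_def using assms(1) that by (intro sum.neutral) (auto intro!: ev)
  then have const: "f (x j) = f (x (j - 1))" if "j \<noteq> 0" for j using rec[of j] that by simp
  \<comment> \<open>The jump lies between the indices \<open>- 1\<close> and \<open>0\<close>, so
    the sequence is constant on each of the two half-lines.\<close>
  have "f (x (int n)) = f (x 0)" "f (x (- 1 - int n)) = f (x (- 1))" for n
  proof (induction n)
    case (Suc n)
    { case 1 then show ?case using const[of "int (Suc n)"] Suc by simp }
    { case 2 then show ?case using const[of "- 1 - int n"] Suc by (simp add: algebra_simps) }
  qed simp_all
  note steps = this
  have fin: "finite {j. f (x j) \<noteq> 0}" unfolding x_def by (rule finite_central_translates[OF f(1) g])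
  have "f (x 0) = 0"
  proof (rule ccontr)
    assume "f (x 0) \<noteq> 0"
    then have "range int \<subseteq> {j. f (x j) \<noteq> 0}" using steps(1) by auto
    then have "finite (range int)" using fin finite_subset by blast
    then show False using finite_imageD[of int UNIV] by (simp add: inj_on_def)
  qed
  moreover have "f (x (- 1)) = 0"
  proof (rule ccontr)
    assume "f (x (- 1)) \<noteq> 0"
    then have "range (\<lambda>n. - 1 - int n) \<subseteq> {j. f (x j) \<noteq> 0}" using steps(2) by auto
    then have "finite (range (\<lambda>n. - 1 - int n))" using fin finite_subset by blast
    then show False using finite_imageD[of "\<lambda>n. - 1 - int n" UNIV] by (simp add: inj_on_def)
  qed
  ultimately have "hecke_eval q (x 0) = 0" using rec[of 0] by simp
  moreover have "hecke_eval q (x 0) = Poly_Mapping.lookup q (Word v) * eval_word v (x 0)"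
  proof -
    have "hecke_eval q (x 0) = (\<Sum>w\<in>{Word v}. Poly_Mapping.lookup q w * eval_word (letters w) (x 0))"
      unfolding hecke_eval_def
    proof (rule sum.mono_neutral_right)
      show "\<forall>w\<in>Poly_Mapping.keys q - {Word v}. Poly_Mapping.lookup q w * eval_word (letters w) (x 0) = 0"
      proof
        fix w assume "w \<in> Poly_Mapping.keys q - {Word v}"
        then obtain u where "w = Word u" "u \<in> std_words" "u \<noteq> v" using assms(1) by blast
        then show "Poly_Mapping.lookup q w * eval_word (letters w) (x 0) = 0" using ev[of u 0] by simp
      qed
    qed (use v(2) in auto)
    then show ?thesis by simp
  qed
  moreover obtain N where "N > 0" "eval_word v = (\<lambda>x. of_nat N * char_fun K (word_mat v) x)"
    using eval_word_std[OF v(1)] by blast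
  then have "eval_word v (x 0) \<noteq> 0"
    by (simp add: x_def char_fun_def mat_eqs flip: mat_1_eq_mat2)
  ultimately show False using v(2) by (simp add: in_keys_iff)
qed

text \<open>An element is first reduced to a combination \<open>q\<close> of standard words by the
  relations. If it evaluates into the ideal, then so does \<open>q\<close>, and independence leaves
  only \<open>q = 0\<close>.\<close>

lemma hecke_eval_kernel: "hecke_eval p \<in> Z_multiples \<longleftrightarrow> p \<in> rel_ideal"
proof
  assume Z_multiples: "hecke_eval p \<in> Z_multiples"
  obtain q where q: "Poly_Mapping.keys q \<subseteq> Word ` std_words" "rel_cong p q"
    using std_span_UNIV[of p] unfolding std_span_def by blast
  then have "hecke_eval (p - q) \<in> Z_multiples" unfolding rel_cong_def by (intro hecke_eval_rel_ideal)
  then have "hecke_eval q \<in> Z_multiples" using Z_multiples_diff[OF Z_multiples, of "hecke_eval (p - q)"] by (simp add: hecke_eval_diff)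
  then have "q = 0" by (rule hecke_eval_std_independent[OF q(1)])
  then show "p \<in> rel_ideal" using q(2) by (simp add: rel_cong_def)
qed (rule hecke_eval_rel_ideal)

section \<open>Surjectivity modulo the ideal\<close>

definition eval_image :: "(q2mat \<Rightarrow> complex) set" where
  "eval_image = {f \<in> hecke_carrier K. \<exists>p. (\<lambda>x. f x - hecke_eval p x) \<in> Z_multiples}"

lemma eval_image_hecke_eval: "hecke_eval p \<in> eval_image"
  unfolding eval_image_def using Z_multiples_zero by (auto intro!: exI[of _ p])

lemma eval_image_hecke: "f \<in> eval_image \<Longrightarrow> f \<in> hecke_carrier K"
  unfolding eval_image_def by simp

lemma eval_image_mult:
  assumes "f \<in> eval_image" "g \<in> eval_image" shows "convolution \<mu> f g \<in> eval_image"
proof -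
  obtain p q where fg: "f \<in> hecke_carrier K" "(\<lambda>x. f x - hecke_eval p x) \<in> Z_multiples" "g \<in> hecke_carrier K" "(\<lambda>x. g x - hecke_eval q x) \<in> Z_multiples"
    using assms unfolding eval_image_def by blast
  have "(\<lambda>x. convolution \<mu> f (\<lambda>x. g x - hecke_eval q x) x + convolution \<mu> (\<lambda>x. f x - hecke_eval p x) (hecke_eval q) x) \<in> Z_multiples"
    using fg by (intro Z_multiples_add Z_multiples_left Z_multiples_right) auto
  then have "(\<lambda>x. convolution \<mu> f g x - hecke_eval (p * q) x) \<in> Z_multiples"
    using fg by (simp add: hecke_eval_mult convolution_diff_left convolution_diff_right)
  then show ?thesis unfolding eval_image_def using fg by auto
qed

lemma eval_image_add:
  assumes "f \<in> eval_image" "g \<in> eval_image" shows "(\<lambda>x. f x + g x) \<in> eval_image"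
proof -
  obtain p q where fg: "f \<in> hecke_carrier K" "(\<lambda>x. f x - hecke_eval p x) \<in> Z_multiples" "g \<in> hecke_carrier K" "(\<lambda>x. g x - hecke_eval q x) \<in> Z_multiples"
    using assms unfolding eval_image_def by blast
  have "(\<lambda>x. (f x + g x) - hecke_eval (p + q) x) \<in> Z_multiples"
    using Z_multiples_add[OF fg(2,4)] by (simp add: hecke_eval_add algebra_simps)
  then show ?thesis unfolding eval_image_def using fg by auto
qed

lemma eval_image_smult: assumes "f \<in> eval_image" shows "(\<lambda>x. c * f x) \<in> eval_image"
proof -
  have "(\<lambda>x. c * char_fun K (mat 1) x) \<in> eval_image" using eval_image_hecke_eval[of "free_scalar c"] by (simp add: hecke_eval_scalar)
  from eval_image_mult[OF this assms] eval_image_hecke[OF assms] show ?thesis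
    by (simp add: convolution_smult convolution_one)
qed

lemma eval_image_Z_iff:
  assumes "f \<in> hecke_carrier K" shows "convolution \<mu> hecke_Z f \<in> eval_image \<longleftrightarrow> f \<in> eval_image"
proof -
  let ?g = "convolution \<mu> hecke_Z f"
  have Z_multiples: "(\<lambda>x. f x - ?g x) \<in> Z_multiples" by (rule Z_multiples_I[OF assms])
  have "(\<lambda>x. f x - hecke_eval p x) \<in> Z_multiples \<longleftrightarrow> (\<lambda>x. ?g x - hecke_eval p x) \<in> Z_multiples" for p
    using Z_multiples_add[OF Z_multiples, of "\<lambda>x. ?g x - hecke_eval p x"] Z_multiples_diff[OF _ Z_multiples, of "\<lambda>x. f x - hecke_eval p x"] by auto
  then show ?thesis unfolding eval_image_def using assms by simp
qed

lemma char_fun_image_central_power: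
  assumes "g \<in> GL2" shows "char_fun K (z_mat (2 ^ n) ** g) \<in> eval_image \<longleftrightarrow> char_fun K g \<in> eval_image"
proof (induction n)
  case 0
  have "z_mat (2 ^ 0) = mat 1" by (simp add: mat_eqs mat_1_eq_mat2)
  then show ?case by simp
next
  case (Suc n)
  have G: "z_mat (2 ^ n) ** g \<in> GL2" using assms by simp
  have "z_mat (2 ^ Suc n) ** g = z_mat 2 ** (z_mat (2 ^ n) ** g)" by (simp add: z_mat_mult_assoc)
  then show ?case
    using eval_image_Z_iff[OF char_fun_hecke[OF G]] Suc by (simp add: hecke_Z_char_fun[OF G])
qed

lemma char_fun_image_central:
  assumes "g \<in> GL2" shows "char_fun K (z_mat (2 powi j) ** g) \<in> eval_image \<longleftrightarrow> char_fun K g \<in> eval_image"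
proof (cases "j \<ge> 0")
  case True
  then obtain n where "j = int n" using nonneg_int_cases by blast
  then show ?thesis using char_fun_image_central_power[OF assms] by simp
next
  case False
  then obtain n where j: "j = - int n" by (metis neg_int_cases not_le)
  have G: "z_mat (2 powi j) ** g \<in> GL2" using assms by simp
  have "z_mat (2 ^ n) ** (z_mat (2 powi j) ** g) = g"
  proof -
    have "(2 :: q2) ^ n * 2 powi j = 1" unfolding j power_int_minus power_int_of_nat by simp
    then show ?thesis unfolding z_mat_mult_assoc by (simp add: mat_eqs flip: mat_1_eq_mat2)
  qed
  then show ?thesis using char_fun_image_central_power[OF G, of n] by simp
qed

lemma gen_mat_square:
  assumes "a \<in> {GU2, GV}" "g \<in> GL2"
  shows "char_fun K (gen_mat a ** (gen_mat a ** g)) \<in> eval_image \<longleftrightarrow> char_fun K g \<in> eval_image"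
    "char_fun K (g ** gen_mat a ** gen_mat a) \<in> eval_image \<longleftrightarrow> char_fun K g \<in> eval_image"
proof -
  have y: "y2 ** y2 \<in> K" unfolding mat_eqs mat2_mult
    by (rule K_I[of 1 1 _ _ 0 _ 1]) (simp_all add: emb_simps)
  have w: "w2 ** w2 = z_mat (- 4)" by (simp add: mat_eqs)
  have z: "char_fun K (z_mat (- 4) ** g) \<in> eval_image \<longleftrightarrow> char_fun K g \<in> eval_image"
    using char_fun_image_central_power[OF assms(2), of 2] by (simp add: char_fun_neg)
  show "char_fun K (gen_mat a ** (gen_mat a ** g)) \<in> eval_image \<longleftrightarrow> char_fun K g \<in> eval_image"
    using assms(1) w z y by (auto simp: matrix_mul_assoc)
  show "char_fun K (g ** gen_mat a ** gen_mat a) \<in> eval_image \<longleftrightarrow> char_fun K g \<in> eval_image"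
    using assms(1) w z y z_mat_commute[of "- 4" g] by (auto simp flip: matrix_mul_assoc)
qed

text \<open>Membership is inferred for the shorter product: multiplying by the same generator once
  more gives \<open>g\<close> back, up to an element of \<open>K\<close> or a central power of
  2.\<close>

lemma gen_mat_image:
  assumes "a \<in> {GU2, GV}" "g \<in> GL2"
  shows "char_fun K (gen_mat a ** g) \<in> eval_image \<Longrightarrow> char_fun K g \<in> eval_image"
    "char_fun K (g ** gen_mat a) \<in> eval_image \<Longrightarrow> char_fun K g \<in> eval_image"
proof -
  have a: "gen_mat a \<in> normalizer" using assms(1) normalizer_w2 normalizer_y2 by auto
  have im: "char_fun K (gen_mat a) \<in> eval_image" using eval_image_hecke_eval[of "free_var a"] by (simp add: hecke_eval_var gen_fun_eq)
  show "char_fun K g \<in> eval_image" if "char_fun K (gen_mat a ** g) \<in> eval_image"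
    using eval_image_mult[OF im that] gen_mat_square[OF assms] assms(2)
    by (simp add: char_fun_normalizer_left[OF a])
  show "char_fun K g \<in> eval_image" if "char_fun K (g ** gen_mat a) \<in> eval_image"
    using eval_image_mult[OF that im] gen_mat_square[OF assms] assms(2)
    by (simp add: char_fun_normalizer_right[OF a])
qed

text \<open>All \<open>m\<close> and \<open>e\<close> are treated at once, because the operations by
  \<open>u2\<close> and \<open>v\<close> act on the parities alone and respect
  \<open>e\<close>.\<close>

definition shape_in_image :: "parities \<Rightarrow> bool" where
  "shape_in_image A \<longleftrightarrow> (\<forall>m e g. shape m e A g \<longrightarrow> char_fun K g \<in> eval_image)"

lemma shape_in_image_act:
  assumes "a \<in> {GU2, GV}"
  shows "shape_in_image (act_left a A) \<Longrightarrow> shape_in_image A" "shape_in_image (act_right a A) \<Longrightarrow> shape_in_image A"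
proof -
  have *: "char_fun K g \<in> eval_image" if g: "shape m e A g" and
    im: "shape_in_image (act_left a A) \<or> shape_in_image (act_right a A)" for m e g
  proof -
    obtain n n' where "shape n e (act_left a A) (gen_mat a ** g)" "shape n' e (act_right a A) (g ** gen_mat a)"
      using shape_gen_left[OF g assms] shape_gen_right[OF g assms] by blast
    then show ?thesis
      using im gen_mat_image[OF assms shape_GL2[OF g]] unfolding shape_in_image_def by blast
  qed
  show "shape_in_image (act_left a A) \<Longrightarrow> shape_in_image A" "shape_in_image (act_right a A) \<Longrightarrow> shape_in_image A"
    unfolding shape_in_image_def[of A] using * by blast+
qed

text \<open>The determinant of a matrix with these parities is even, so \<open>e = Suc k\<close> for
  some \<open>k\<close>, and up to a central power of 2 the double coset is that of
  \<open>mid k\<close>. Its multiplicity is divided out by the scalar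
  \<open>1 / of_nat N\<close>.\<close>

lemma shape_in_image_E21: "shape_in_image E21"
  unfolding shape_in_image_def
proof safe
  fix m e g assume g: "shape m e E21 g"
  have "e \<noteq> 0"
  proof
    assume "e = 0"
    from g show False
    proof (rule shapeE)
      fix a b c d u assume *: "E21 = (odd2 a, odd2 b, odd2 c, odd2 d)" "odd2 u" "a * d - b * c = 2 ^ e * u"
      have "\<not> odd2 (a * d - b * c)" using *(1) by simp
      then show False using * \<open>e = 0\<close> by simp
    qed
  qed
  then obtain k where k: "e = Suc k" using not0_implies_Suc by blast
  let ?h = "word_mat (mid k)"
  \<comment> \<open>The word \<open>mid k\<close> has exponent \<open>int k\<close>, hence the shift
    by \<open>m - int k\<close>.\<close>
  have "shape (int k + (m - int k)) (Suc k) E21 (z_mat (2 powi (m - int k)) ** ?h)"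
    by (rule shape_z_mat[OF shape_mid])
  then have "g \<in> double_coset K (z_mat (2 powi (m - int k)) ** ?h)"
    using g k by (intro E21_double_coset) simp_all
  from double_coset_eq[OF this] have eq: "char_fun K g = char_fun K (z_mat (2 powi (m - int k)) ** ?h)"
    by (simp add: char_fun_def)
  obtain N where N: "N > 0" "eval_word (mid k) = (\<lambda>x. of_nat N * char_fun K ?h x)"
    using eval_word_mid by blast
  have "hecke_eval (free_scalar (1 / of_nat N) * wmon (mid k)) = char_fun K ?h"
    using N by (simp add: hecke_eval_scalar_wmon)
  then have "char_fun K ?h \<in> eval_image" using eval_image_hecke_eval by metis
  then show "char_fun K g \<in> eval_image" unfolding eq by (simp add: char_fun_image_central)
qed

lemma shape_in_image_one: "shape_in_image (True, False, False, True)"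
  unfolding shape_in_image_def
proof safe
  fix m e g assume "shape m e (True, False, False, True) g"
  from shape_unipotent(2)[OF this] obtain k where k: "k \<in> K" "g = z_mat (2 powi m) ** k" by auto
  have "char_fun K k = char_fun K (mat 1)" using char_fun_K(1)[OF k(1), of "mat 1"] by simp
  then have "char_fun K k \<in> eval_image" using eval_image_hecke_eval[of 1] by (simp add: hecke_eval_one)
  then show "char_fun K g \<in> eval_image" unfolding k(2) by (simp only: char_fun_image_central[OF K_subset_GL2[OF k(1)]])
qed

text \<open>Row and column operations have two orbits on the fifteen nonzero matrices. Facts 1 to 8
  fill the orbit of \<open>E21\<close>, the nine matrices of rank one; facts 9 to 13 fill the orbit
  of the identity, the six invertible ones.\<close>

lemma shape_in_image_all:
  assumes "A \<noteq> (False, False, False, False)" shows "shape_in_image A"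
proof -
  note V = shape_in_image_act[of GV] and U = shape_in_image_act[of GU2]
  have 1: "shape_in_image (True, False, False, False)"
    by (rule U(1)) (simp_all add: shape_in_image_E21)
  have 2: "shape_in_image (True, False, True, False)" by (rule V(1)) (simp_all add: 1)
  have 3: "shape_in_image (False, False, False, True)" by (rule U(2)) (simp_all add: shape_in_image_E21)
  have 4: "shape_in_image (False, True, False, False)" by (rule U(2)) (simp_all add: 1)
  have 5: "shape_in_image (False, True, False, True)" by (rule U(2)) (simp_all add: 2)
  have 6: "shape_in_image (False, False, True, True)" by (rule V(2)) (simp_all add: 3)
  have 7: "shape_in_image (True, True, False, False)" by (rule V(2)) (simp_all add: 4)
  have 8: "shape_in_image (True, True, True, True)" by (rule V(2)) (simp_all add: 5)
  have 9: "shape_in_image (False, True, True, False)" by (rule U(1)) (simp_all add: shape_in_image_one)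
  have 10: "shape_in_image (True, False, True, True)" by (rule V(1)) (simp_all add: shape_in_image_one)
  have 11: "shape_in_image (False, True, True, True)" by (rule U(2)) (simp_all add: 10)
  have 12: "shape_in_image (True, True, False, True)" by (rule V(2)) (simp_all add: 11)
  have 13: "shape_in_image (True, True, True, False)" by (rule U(2)) (simp_all add: 12)
  obtain a b c d where A: "A = (a, b, c, d)" by (metis prod_cases4)
  show ?thesis
    using assms 1 2 3 4 5 6 7 8 9 10 11 12 13 shape_in_image_E21 shape_in_image_one
    unfolding A by (cases a; cases b; cases c; cases d) simp_all
qed

lemma char_fun_image: assumes "g \<in> GL2" shows "char_fun K g \<in> eval_image"
proof -
  obtain m e A where A: "shape m e A g" using shape_exists[OF assms] by blast
  then have "A \<noteq> (False, False, False, False)" by (rule shapeE)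
  from shape_in_image_all[OF this] A show ?thesis unfolding shape_in_image_def by blast
qed

text \<open>A bi-invariant function is a finite combination of characteristic functions of double
  cosets. With the transversal kept fixed, subtracting \<open>f s\<close> times the function of the
  double coset of \<open>s\<close> creates no new nonzero value and removes the one at
  \<open>s\<close>.\<close>

lemma eval_image_eq: "eval_image = hecke_carrier K"
proof
  show "hecke_carrier K \<subseteq> eval_image"
  proof
    fix f assume "f \<in> hecke_carrier K"
    then obtain S where "transversal f S" using hecke_carrierD(5) by blast
    then show "f \<in> eval_image" using \<open>f \<in> hecke_carrier K\<close>
    proof (induction "card {s \<in> S. f s \<noteq> 0}" arbitrary: f rule: less_induct)
      case less
      have S: "finite S" "S \<subseteq> GL2" and cov: "\<And>x. f x \<noteq> 0 \<Longrightarrow> \<exists>s\<in>S. x \<in> coset s"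
        using less.prems(1) unfolding transversal_def by auto
      show ?case
      proof (cases "\<exists>s\<in>S. f s \<noteq> 0")
        case False
        then have "f x = 0" for x using transversal_expand[OF hecke_carrierD(4)[OF less.prems(2)] less.prems(1), of x] by simp
        then have "f = hecke_eval 0" by (simp add: hecke_eval_zero fun_eq_iff)
        then show ?thesis using eval_image_hecke_eval by metis
      next
        case True
        then obtain s where s: "s \<in> S" "f s \<noteq> 0" by blast
        have sG: "s \<in> GL2" using s S by blast
        let ?g = "char_fun K s"
        define h where "h x = f x - f s * ?g x" for x
        have h: "h \<in> hecke_carrier K" unfolding h_def using less.prems(2) sG by simp
        have f_dc: "f x = f s" if "x \<in> double_coset K s" for x
        proof -
          obtain k l where kl: "k \<in> K" "l \<in> K" "x = k ** s ** l" using \<open>x \<in> double_coset K s\<close> unfolding double_coset_iff by blast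
          then show ?thesis using hecke_carrierD(2,3)[OF less.prems(2)] sG K_subset_GL2 by simp
        qed
        have sub: "f x \<noteq> 0" if "h x \<noteq> 0" for x
          using that f_dc[of x] s unfolding h_def char_fun_def by (auto simp: indicator_def split: if_splits)
        have "\<forall>x. h x \<noteq> 0 \<longrightarrow> (\<exists>s\<in>S. x \<in> coset s)" using cov sub by blast
        then have "transversal h S" using less.prems(1) unfolding transversal_def by simp
        moreover have "h s = 0" unfolding h_def char_fun_def by simp
        then have "{s \<in> S. h s \<noteq> 0} \<subset> {s \<in> S. f s \<noteq> 0}" using sub s by auto
        then have "card {s \<in> S. h s \<noteq> 0} < card {s \<in> S. f s \<noteq> 0}" using S(1) by (intro psubset_card_mono) auto
        ultimately have "h \<in> eval_image" using less.hyps h by blast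
        moreover have "(\<lambda>x. f s * ?g x) \<in> eval_image" by (rule eval_image_smult[OF char_fun_image[OF sG]])
        ultimately have "(\<lambda>x. h x + f s * ?g x) \<in> eval_image" by (rule eval_image_add)
        then show ?thesis by (simp add: h_def)
      qed
    qed
  qed
qed (simp add: eval_image_def)

end

theorem theorem3:
  fixes \<mu> :: "q2mat measure"
  assumes "haar_measure \<mu>" and "emeasure \<mu> (K0 4) = 1"
  shows "\<exists>\<phi> \<in> ring_iso (free_alg Quot rel_ideal) (H_bar \<mu>).
           (\<forall>c. \<phi> (rel_ideal +>\<^bsub>free_alg\<^esub> free_scalar c) = Z_ideal \<mu> +>\<^bsub>H_alg \<mu>\<^esub> H_scalar \<mu> c) \<and>
           \<phi> (rel_ideal +>\<^bsub>free_alg\<^esub> free_var GU1) = Z_ideal \<mu> +>\<^bsub>H_alg \<mu>\<^esub> hecke_U 1 \<and>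
           \<phi> (rel_ideal +>\<^bsub>free_alg\<^esub> free_var GU2) = Z_ideal \<mu> +>\<^bsub>H_alg \<mu>\<^esub> hecke_U 2 \<and>
           \<phi> (rel_ideal +>\<^bsub>free_alg\<^esub> free_var GV) = Z_ideal \<mu> +>\<^bsub>H_alg \<mu>\<^esub> hecke_V"
proof -
  interpret hecke \<mu> using assms by unfold_locales
  interpret F: ring free_alg by (rule ring_free_alg)
  interpret R: ring "H_alg \<mu>" by (rule ring_H_alg)
  have "hecke_Z \<ominus>\<^bsub>H_alg \<mu>\<^esub> \<one>\<^bsub>H_alg \<mu>\<^esub> \<in> carrier (H_alg \<mu>)"
    by (rule R.minus_closed) (simp_all add: H_alg_simps)
  then interpret I: ideal "Z_ideal \<mu>" "H_alg \<mu>"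
    unfolding Z_ideal_def by (intro R.genideal_ideal) simp
  define h where "h p = Z_ideal \<mu> +>\<^bsub>H_alg \<mu>\<^esub> hecke_eval p" for p
  have hecke_eval_hom: "hecke_eval \<in> ring_hom free_alg (H_alg \<mu>)"
    by (rule ring_hom_memI) (simp_all add: free_alg_simps H_alg_simps hecke_eval_mult hecke_eval_add hecke_eval_one)
  have "h = (+>\<^bsub>H_alg \<mu>\<^esub>) (Z_ideal \<mu>) \<circ> hecke_eval" by (simp add: h_def fun_eq_iff)
  then have h_hom: "h \<in> ring_hom free_alg (H_bar \<mu>)"
    unfolding H_bar_def using ring_hom_trans[OF hecke_eval_hom I.rcos_ring_hom] by simp
  interpret h: ring_hom_ring free_alg "H_bar \<mu>" h
    by (rule ring_hom_ringI2[OF ring_free_alg _ h_hom]) (simp add: H_bar_def I.quotient_is_ring)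
  have kernel: "a_kernel free_alg (H_bar \<mu>) h = rel_ideal"
  proof -
    \<comment> \<open>The coset of \<open>hecke_eval p\<close> is the zero of the quotient exactly
      when \<open>hecke_eval p\<close> lies in the ideal, which \<open>hecke_eval_kernel\<close>
      translates back to the free algebra.\<close>
    have iff: "h p = Z_ideal \<mu> \<longleftrightarrow> p \<in> rel_ideal" for p
    proof -
      have "h p = Z_ideal \<mu> \<longleftrightarrow> hecke_eval p \<in> Z_ideal \<mu>"
        unfolding h_def using I.a_rcos_self I.a_rcos_const by (auto simp: H_alg_simps)
      then show ?thesis by (simp only: Z_ideal_eq hecke_eval_kernel)
    qed
    have zero: "\<zero>\<^bsub>H_bar \<mu>\<^esub> = Z_ideal \<mu>" by (simp add: H_bar_def FactRing_def)
    show ?thesis unfolding a_kernel_def' zero iff free_alg_simps by (simp only: UNIV_I simp_thms Collect_mem_eq)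
  qed
  have surj: "h ` carrier free_alg = carrier (H_bar \<mu>)"
  proof
    show "h ` carrier free_alg \<subseteq> carrier (H_bar \<mu>)" by (rule image_subsetI) (rule h.hom_closed)
    show "carrier (H_bar \<mu>) \<subseteq> h ` carrier free_alg"
    proof
      fix x assume "x \<in> carrier (H_bar \<mu>)"
      then obtain f where f: "f \<in> hecke_carrier K" "x = Z_ideal \<mu> +>\<^bsub>H_alg \<mu>\<^esub> f"
        unfolding H_bar_def FactRing_def A_RCOSETS_def' by (auto simp: H_alg_simps)
      then obtain p where "(\<lambda>x. f x - hecke_eval p x) \<in> Z_multiples"
        using eval_image_eq unfolding eval_image_def by blast
      then have "f \<ominus>\<^bsub>H_alg \<mu>\<^esub> hecke_eval p \<in> Z_ideal \<mu>"
        unfolding H_alg_minus[OF f(1) hecke_eval_hecke] Z_ideal_eq .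
      then have "x = h p"
        unfolding f(2) h_def using R.quotient_eq_iff_same_a_r_cos[OF I.is_ideal] f(1)
        by (simp add: H_alg_simps)
      then show "x \<in> h ` carrier free_alg" by (simp add: free_alg_simps)
    qed
  qed
  \<comment> \<open>\<open>h\<close> is constant on each coset of its kernel, so the image of a
    coset is a singleton, and its element is the value of the induced isomorphism.\<close>
  let ?\<phi> = "\<lambda>u. the_elem (h ` u)"
  have "?\<phi> \<in> ring_iso (free_alg Quot rel_ideal) (H_bar \<mu>)"
    using h.FactRing_iso_set[OF surj] unfolding kernel .
  moreover have "?\<phi> (rel_ideal +>\<^bsub>free_alg\<^esub> p) = h p" for p
    using h.the_elem_simp[of p] unfolding kernel by (simp add: free_alg_simps)
  moreover have "H_scalar \<mu> c = hecke_eval (free_scalar c)" for c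
    by (simp add: H_scalar_def H_alg_simps hecke_eval_scalar)
  ultimately show ?thesis
    by (intro bexI[of _ ?\<phi>]) (simp_all only: h_def hecke_eval_var gen_fun.simps simp_thms)
qed

end
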